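(* Let $T>0$ and let $(\Omega,(\mathcal{F}_t)_{t\in[0,T]},P)$ be a filtered probability space satisfying the usual conditions, with $\mathcal{F}_0$ trivial. Let $W$ be an $n$-dimensional Brownian motion in the filtration $(\mathcal{F}_t)$ and let $X$ be the $n$-dimensional Itô process \[ dX_i(t)=\mu_i(t)\,dt+\sum_{\nu=1}^n\sigma_{i\nu}(t)\,dW_\nu(t),\qquad i=1,\dots,n,\ t\in[0,T], \] with progressively measurable coefficients. Assume that $|\mu|$ is bounded and that there are finite constants $\varepsilon,M>0$ with \[ \varepsilon|\xi|^2\le|\sigma'(t)\xi|^2\le M|\xi|^2\quad\text{a.s. for all } t\in[0,T],\ \xi\in\mathbb{R}^n. \] Then $X$ has conditional full support (in $\mathbb{R}^n$).
   Context: $\sigma'(t)$ denotes the transpose of the matrix $\sigma(t)$. $X$ has conditional full support (in $\mathbb{R}^n$) means: for all $t\in[0,T]$ and every open set $G\subset C([0,T],\mathbb{R}^n)$ (topology of uniform convergence), $P(X\in G\mid\mathcal{F}_t)>0$ almost surely on the event $\{X|_{[0,t]}\in\{g|_{[0,t]}: g\in G\}\}$. *)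

theory Defs
  imports "HOL-Probability.Probability"
begin

text \<open>Time runs through the interval [0,T]. A filtration is given as a family of
  sub-sigma-algebras F t of M (measures whose sets matter only).\<close>

definition filtration_usual :: "'a measure \<Rightarrow> (real \<Rightarrow> 'a measure) \<Rightarrow> real \<Rightarrow> bool" where
  "filtration_usual M F T \<longleftrightarrow>
     (\<forall>t\<in>{0..T}. subalgebra M (F t)) \<and>
     (\<forall>s t. 0 \<le> s \<longrightarrow> s \<le> t \<longrightarrow> t \<le> T \<longrightarrow> sets (F s) \<subseteq> sets (F t)) \<and>
     \<comment> \<open>right continuity\<close>
     (\<forall>t\<in>{0..<T}. sets (F t) = (\<Inter>s\<in>{t<..T}. sets (F s))) \<and>
     \<comment> \<open>completeness: M is complete and F 0 contains all null sets\<close>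
     (\<forall>A N. N \<in> null_sets M \<longrightarrow> A \<subseteq> N \<longrightarrow> A \<in> sets M) \<and>
     null_sets M \<subseteq> sets (F 0)"

definition trivial_sigma :: "'a measure \<Rightarrow> 'a measure \<Rightarrow> bool" where
  "trivial_sigma M F0 \<longleftrightarrow> (\<forall>A\<in>sets F0. measure M A = 0 \<or> measure M A = 1)"

definition gauss_vec :: "real \<Rightarrow> (real ^ 'n) measure" where
  "gauss_vec v = density lborel (\<lambda>x. \<Prod>i\<in>UNIV. ennreal (normal_density 0 (sqrt v) (x $ i)))"

definition brownian_motion ::
  "'a measure \<Rightarrow> (real \<Rightarrow> 'a measure) \<Rightarrow> real \<Rightarrow> (real \<Rightarrow> 'a \<Rightarrow> real ^ 'n) \<Rightarrow> bool" where
  "brownian_motion M F T W \<longleftrightarrow>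
     (\<forall>t\<in>{0..T}. W t \<in> borel_measurable (F t)) \<and>
     (AE \<omega> in M. W 0 \<omega> = 0) \<and>
     (AE \<omega> in M. continuous_on {0..T} (\<lambda>t. W t \<omega>)) \<and>
     (\<forall>s t. 0 \<le> s \<longrightarrow> s < t \<longrightarrow> t \<le> T \<longrightarrow>
        distr M borel (\<lambda>\<omega>. W t \<omega> - W s \<omega>) = gauss_vec (t - s) \<and>
        (\<forall>A\<in>sets (F s). \<forall>B\<in>sets borel.
           measure M {\<omega> \<in> space M. \<omega> \<in> A \<and> W t \<omega> - W s \<omega> \<in> B}
           = measure M A * measure M {\<omega> \<in> space M. W t \<omega> - W s \<omega> \<in> B}))"

definition progressive ::
  "'a measure \<Rightarrow> (real \<Rightarrow> 'a measure) \<Rightarrow> real \<Rightarrow> (real \<Rightarrow> 'a \<Rightarrow> 'b::topological_space) \<Rightarrow> bool" where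
  "progressive M F T H \<longleftrightarrow>
     (\<forall>t\<in>{0..T}. (\<lambda>(s, \<omega>). H s \<omega>) \<in> borel_measurable (restrict_space borel {0..t} \<Otimes>\<^sub>M F t))"

definition elem_proc :: "nat \<Rightarrow> (nat \<Rightarrow> real) \<Rightarrow> (nat \<Rightarrow> 'a \<Rightarrow> real) \<Rightarrow> real \<Rightarrow> 'a \<Rightarrow> real" where
  "elem_proc m \<tau> h s \<omega> = (\<Sum>k<m. h k \<omega> * indicator {\<tau> k<..\<tau> (Suc k)} s)"

definition elem_int ::
  "(real \<Rightarrow> 'a \<Rightarrow> real) \<Rightarrow> nat \<Rightarrow> (nat \<Rightarrow> real) \<Rightarrow> (nat \<Rightarrow> 'a \<Rightarrow> real) \<Rightarrow> real \<Rightarrow> 'a \<Rightarrow> real" where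
  "elem_int B m \<tau> h t \<omega> = (\<Sum>k<m. h k \<omega> * (B (min t (\<tau> (Suc k))) \<omega> - B (min t (\<tau> k)) \<omega>))"

definition admissible_elem ::
  "'a measure \<Rightarrow> (real \<Rightarrow> 'a measure) \<Rightarrow> real \<Rightarrow> nat \<Rightarrow> (nat \<Rightarrow> real) \<Rightarrow> (nat \<Rightarrow> 'a \<Rightarrow> real) \<Rightarrow> bool" where
  "admissible_elem M F T m \<tau> h \<longleftrightarrow>
     \<tau> 0 = 0 \<and> \<tau> m = T \<and> (\<forall>k<m. \<tau> k < \<tau> (Suc k)) \<and>
     (\<forall>k<m. h k \<in> borel_measurable (F (\<tau> k)) \<and> (\<exists>C. \<forall>\<omega>\<in>space M. \<bar>h k \<omega>\<bar> \<le> C))"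

definition is_ito_integral ::
  "'a measure \<Rightarrow> (real \<Rightarrow> 'a measure) \<Rightarrow> real \<Rightarrow> (real \<Rightarrow> 'a \<Rightarrow> real) \<Rightarrow> (real \<Rightarrow> 'a \<Rightarrow> real)
     \<Rightarrow> (real \<Rightarrow> 'a \<Rightarrow> real) \<Rightarrow> bool" where
  "is_ito_integral M F T B H I \<longleftrightarrow>
     (\<forall>t\<in>{0..T}. I t \<in> borel_measurable (F t)) \<and>
     (AE \<omega> in M. continuous_on {0..T} (\<lambda>t. I t \<omega>)) \<and>
     (\<exists>m \<tau> h. (\<forall>j. admissible_elem M F T (m j) (\<tau> j) (h j)) \<and>
        (\<lambda>j. \<integral>\<^sup>+ \<omega>. (\<integral>\<^sup>+ s. ennreal ((H s \<omega> - elem_proc (m j) (\<tau> j) (h j) s \<omega>)\<^sup>2)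
                 * indicator {0..T} s \<partial>lborel) \<partial>M) \<longlonglongrightarrow> 0 \<and>
        (\<forall>t\<in>{0..T}. (\<lambda>j. \<integral>\<^sup>+ \<omega>. ennreal ((I t \<omega> - elem_int B (m j) (\<tau> j) (h j) t \<omega>)\<^sup>2) \<partial>M)
                 \<longlonglongrightarrow> 0))"

definition ito_process ::
  "'a measure \<Rightarrow> (real \<Rightarrow> 'a measure) \<Rightarrow> real \<Rightarrow> (real \<Rightarrow> 'a \<Rightarrow> real ^ 'n)
     \<Rightarrow> (real \<Rightarrow> 'a \<Rightarrow> real ^ 'n) \<Rightarrow> (real \<Rightarrow> 'a \<Rightarrow> real ^ 'n ^ 'n)
     \<Rightarrow> (real \<Rightarrow> 'a \<Rightarrow> real ^ 'n) \<Rightarrow> bool" where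
  "ito_process M F T W \<mu> \<sigma> X \<longleftrightarrow>
     (\<forall>t\<in>{0..T}. X t \<in> borel_measurable (F t)) \<and>
     (AE \<omega> in M. continuous_on {0..T} (\<lambda>t. X t \<omega>)) \<and>
     (\<exists>I :: 'n \<Rightarrow> 'n \<Rightarrow> real \<Rightarrow> 'a \<Rightarrow> real.
        (\<forall>i \<nu>. is_ito_integral M F T (\<lambda>t \<omega>. W t \<omega> $ \<nu>) (\<lambda>t \<omega>. \<sigma> t \<omega> $ i $ \<nu>) (I i \<nu>)) \<and>
        (\<forall>t\<in>{0..T}. AE \<omega> in M. \<forall>i.
           X t \<omega> $ i = X 0 \<omega> $ i + (LINT s:{0..t}|lborel. \<mu> s \<omega> $ i) + (\<Sum>\<nu>\<in>UNIV. I i \<nu> t \<omega>)))"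

text \<open>Open sets of C([0,T],R^n) with the topology of uniform convergence. Paths are
  functions real => R^n, only their values on [0,T] matter.\<close>
definition uniform_open :: "real \<Rightarrow> (real \<Rightarrow> 'b::metric_space) set \<Rightarrow> bool" where
  "uniform_open T G \<longleftrightarrow>
     (\<forall>g\<in>G. continuous_on {0..T} g \<and>
        (\<exists>e>0. \<forall>h. continuous_on {0..T} h \<and> (\<forall>s\<in>{0..T}. dist (h s) (g s) < e) \<longrightarrow> h \<in> G))"

definition cond_full_support ::
  "'a measure \<Rightarrow> (real \<Rightarrow> 'a measure) \<Rightarrow> real \<Rightarrow> (real \<Rightarrow> 'a \<Rightarrow> 'b::metric_space) \<Rightarrow> bool" where
  "cond_full_support M F T X \<longleftrightarrow>
     (\<forall>t\<in>{0..T}. \<forall>G. uniform_open T G \<longrightarrow>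
        (AE \<omega> in M. (\<exists>g\<in>G. \<forall>s\<in>{0..t}. X s \<omega> = g s) \<longrightarrow>
           real_cond_exp M (F t) (indicator {\<omega>' \<in> space M. (\<lambda>s. X s \<omega>') \<in> G}) \<omega> > 0))"

end

theory Submission
  imports Defs
begin

text \<open>For a Lipschitz path p and a radius r let b be the cubed positive part of r^2 - |y|^2. By
  ellipticity and boundedness of the coefficients, exp (l s) b (X s - p s) is a submartingale once l is
  large: near the boundary of the ball the second-order term of b wins, inside it the factor
  exp (l s) does. This is proved without an Ito formula, by expanding b over the short steps of the
  elementary approximations of the stochastic integrals and passing to the limit.

  Since b is positive exactly inside the ball, the submartingale inequality may be iterated
  while discarding all paths that have left the tube of radius r around p at one of finitely
  many times. The lower bound so obtained for the conditional probability of remaining in the tube is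
  independent of these times, hence holds for a countable dense set of times and, by continuity, for
  the whole path. Open sets of paths are countable unions of tubes around polynomial paths with
  coefficients in a countable dense set.\<close>

subsection \<open>The bump function\<close>

definition gap :: "real \<Rightarrow> 'b::real_normed_vector \<Rightarrow> real" where
  "gap r x = max 0 (r\<^sup>2 - (norm x)\<^sup>2)"

definition bump :: "real \<Rightarrow> 'b::real_normed_vector \<Rightarrow> real" where
  "bump r x = gap r x ^ 3"

lemma gap_nonneg [simp]: "0 \<le> gap r x"
  by (simp add: gap_def)

lemma gap_le: "gap r x \<le> r\<^sup>2"
  by (simp add: gap_def)

lemma gap_pos_iff:
  assumes "r > 0"
  shows "0 < gap r x \<longleftrightarrow> norm x < r"
  using assms power_strict_mono[of "norm x" r 2] power_mono[of r "norm x" 2]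
  by (cases "norm x < r") (auto simp: gap_def)

lemma gap_mult_norm_power_le:
  assumes "r > 0"
  shows "gap r x * norm x ^ k \<le> gap r x * r ^ k"
proof (cases "norm x < r")
  case True
  then show ?thesis by (intro mult_left_mono power_mono) auto
next
  case False
  then have "gap r x = 0" using gap_pos_iff[OF assms, of x] gap_nonneg[of r x] by linarith
  then show ?thesis by simp
qed

lemma gap_power_le: "gap r x ^ k \<le> r ^ (2 * k)"
  using power_mono[OF gap_le gap_nonneg] by (simp add: power_mult)

lemma bump_nonneg [simp]: "0 \<le> bump r x"
  by (simp add: bump_def)

lemma bump_le: "bump r x \<le> r ^ 6"
  using gap_power_le[of r x 3] by (simp add: bump_def)

lemma bump_pos_iff:
  assumes "r > 0"
  shows "0 < bump r x \<longleftrightarrow> norm x < r"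
  using gap_pos_iff[OF assms, of x] gap_nonneg[of r x] by (auto simp: bump_def zero_less_power_eq)

lemma gap_measurable [measurable]:
  "gap r \<in> borel_measurable (borel :: 'b::euclidean_space measure)"
  unfolding gap_def by measurable

lemma bump_measurable [measurable]:
  "bump r \<in> borel_measurable (borel :: 'b::euclidean_space measure)"
  unfolding bump_def by measurable

lemma gap_lipschitz_on:
  assumes "r > 0"
  shows "(2 * r)-lipschitz_on UNIV (gap r :: 'b::real_normed_vector \<Rightarrow> real)"
proof (rule lipschitz_onI)
  fix x y :: 'b
  define a where "a = min (norm x) r"
  define b where "b = min (norm y) r"
  have ab: "0 \<le> a" "a \<le> r" "0 \<le> b" "b \<le> r" "\<bar>a - b\<bar> \<le> norm (x - y)"
    using assms norm_triangle_ineq3[of x y] by (auto simp: a_def b_def min_def)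
  have gap_eq: "gap r z = r\<^sup>2 - (min (norm z) r)\<^sup>2" for z :: 'b
    using assms power_mono[of r "norm z" 2] power_mono[of "norm z" r 2]
    by (auto simp: gap_def min_def max_def)
  have "gap r x - gap r y = (b - a) * (b + a)"
    by (simp add: gap_eq a_def b_def power2_eq_square algebra_simps)
  then have "\<bar>gap r x - gap r y\<bar> = \<bar>a - b\<bar> * (b + a)"
    using ab by (simp add: abs_mult abs_minus_commute)
  also have "\<dots> \<le> norm (x - y) * (2 * r)"
    using ab by (intro mult_mono) auto
  finally show "dist (gap r x) (gap r y) \<le> 2 * r * dist x y"
    by (simp add: dist_norm mult.commute)
qed (use assms in simp)

lemma bump_lipschitz_on:
  assumes "r > 0"
  shows "(6 * r ^ 5)-lipschitz_on UNIV (bump r :: 'b::real_normed_vector \<Rightarrow> real)"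
proof (rule lipschitz_onI)
  fix x y :: 'b
  let ?p = "gap r x" and ?q = "gap r y"
  have "bump r x - bump r y = (?p - ?q) * (?p\<^sup>2 + ?p * ?q + ?q\<^sup>2)"
    by (simp add: bump_def power2_eq_square power3_eq_cube algebra_simps)
  then have "\<bar>bump r x - bump r y\<bar> = \<bar>?p - ?q\<bar> * (?p\<^sup>2 + ?p * ?q + ?q\<^sup>2)"
    by (simp add: abs_mult)
  also have "\<dots> \<le> (2 * r * dist x y) * ((r\<^sup>2)\<^sup>2 + r\<^sup>2 * r\<^sup>2 + (r\<^sup>2)\<^sup>2)"
    using lipschitz_onD[OF gap_lipschitz_on[OF assms], of x y] assms
    by (intro mult_mono add_mono power_mono gap_le) (auto simp: dist_norm)
  also have "\<dots> = 6 * r ^ 5 * dist x y"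
    by (simp add: power2_eq_square power_numeral_reduce algebra_simps)
  finally show "dist (bump r x) (bump r y) \<le> 6 * r ^ 5 * dist x y"
    by (simp add: dist_norm)
qed (use assms in simp)

lemma max_cube_ge:
  fixes q d :: real
  assumes "q \<ge> 0"
  shows "(max 0 (q + d)) ^ 3 \<ge> q ^ 3 + 3 * q\<^sup>2 * d + 3 * q * d\<^sup>2 - \<bar>d\<bar> ^ 3"
proof (cases "q + d \<ge> 0")
  case True
  have "- (\<bar>d\<bar> ^ 3) \<le> d ^ 3"
    by (metis abs_ge_minus_self minus_le_iff power_abs)
  moreover have "(q + d) ^ 3 = q ^ 3 + 3 * q\<^sup>2 * d + 3 * q * d\<^sup>2 + d ^ 3"
    by (simp add: power2_eq_square power3_eq_cube algebra_simps)
  ultimately show ?thesis using True by (simp add: max_def)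
next
  case False
  then have "\<bar>d\<bar> ^ 3 = - (d ^ 3)" using assms by (simp add: power3_eq_cube)
  then have "q ^ 3 + 3 * q\<^sup>2 * d + 3 * q * d\<^sup>2 - \<bar>d\<bar> ^ 3 = (q + d) ^ 3"
    by (simp add: power2_eq_square power3_eq_cube algebra_simps)
  also have "\<dots> \<le> 0" using False by (simp add: power_le_zero_eq)
  finally show ?thesis using False by (simp add: max_def)
qed

definition bump_taylor :: "real \<Rightarrow> 'b::real_inner \<Rightarrow> 'b \<Rightarrow> real" where
  "bump_taylor r x z = bump r x - 6 * (gap r x)\<^sup>2 * (x \<bullet> z)
     - 3 * (gap r x)\<^sup>2 * (norm z)\<^sup>2 + 12 * gap r x * (x \<bullet> z)\<^sup>2"

lemma bump_taylor_le_near: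
  assumes x: "norm x < r" and z: "norm z \<le> 2 * r"
  shows "bump_taylor r x z - 76 * r ^ 3 * norm z ^ 3 \<le> bump r (x + z)"
proof -
  define q where "q = r\<^sup>2 - (norm x)\<^sup>2"
  have r: "r > 0" using x norm_ge_zero[of x] by linarith
  have gap: "gap r x = q" and q: "0 < q" "q \<le> r\<^sup>2"
    using gap_pos_iff[OF r, of x] x gap_le[of r x] by (auto simp: gap_def q_def)
  define d where "d = - 2 * (x \<bullet> z) - (norm z)\<^sup>2"
  have "(norm (x + z))\<^sup>2 = (norm x)\<^sup>2 + 2 * (x \<bullet> z) + (norm z)\<^sup>2"
    by (simp add: power2_norm_eq_inner inner_add_left inner_add_right inner_commute)
  then have gap_add: "gap r (x + z) = max 0 (q + d)" by (simp add: gap_def q_def d_def)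
  have xz: "\<bar>x \<bullet> z\<bar> \<le> r * norm z"
    using Cauchy_Schwarz_ineq2[of x z] x by (meson less_imp_le mult_right_mono norm_ge_zero order_trans)
  have "(norm z)\<^sup>2 \<le> 2 * (r * norm z)"
    using mult_right_mono[OF z norm_ge_zero[of z]] by (simp add: power2_eq_square mult.assoc)
  then have "\<bar>d\<bar> \<le> 4 * (r * norm z)"
    using xz zero_le_power2[of "norm z"] unfolding d_def by linarith
  then have "\<bar>d\<bar> ^ 3 \<le> (4 * (r * norm z)) ^ 3" by (rule power_mono) simp
  then have cube: "\<bar>d\<bar> ^ 3 \<le> 64 * r ^ 3 * norm z ^ 3" by (simp add: power_mult_distrib)
  have "12 * q * (x \<bullet> z)\<^sup>2 - 12 * r ^ 3 * norm z ^ 3 \<le> 3 * q * d\<^sup>2"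
  proof -
    have "d\<^sup>2 = 4 * (x \<bullet> z)\<^sup>2 + 4 * ((x \<bullet> z) * (norm z)\<^sup>2) + ((norm z)\<^sup>2)\<^sup>2"
      by (simp add: d_def power2_eq_square algebra_simps)
    moreover have "- (r * norm z ^ 3) \<le> (x \<bullet> z) * (norm z)\<^sup>2"
      using mult_right_mono[of "- (r * norm z)" "x \<bullet> z" "(norm z)\<^sup>2"] abs_le_D2[OF xz]
      by (simp add: power_numeral_reduce mult.assoc)
    ultimately have "4 * (x \<bullet> z)\<^sup>2 - 4 * (r * norm z ^ 3) \<le> d\<^sup>2"
      using zero_le_power2[of "(norm z)\<^sup>2"] by linarith
    then have "3 * q * (4 * (x \<bullet> z)\<^sup>2 - 4 * (r * norm z ^ 3)) \<le> 3 * q * d\<^sup>2"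
      using q by (intro mult_left_mono) auto
    moreover have "q * (r * norm z ^ 3) \<le> r\<^sup>2 * (r * norm z ^ 3)"
      using q r by (intro mult_right_mono) auto
    ultimately show ?thesis by (simp add: power2_eq_square power3_eq_cube algebra_simps)
  qed
  moreover have "3 * q\<^sup>2 * d = - 6 * q\<^sup>2 * (x \<bullet> z) - 3 * q\<^sup>2 * (norm z)\<^sup>2"
    by (simp add: d_def algebra_simps)
  ultimately show ?thesis
    using max_cube_ge[of q d] q cube by (simp add: bump_def bump_taylor_def gap gap_add)
qed

lemma bump_taylor_le_far:
  assumes x: "norm x < r" and z: "2 * r \<le> norm z"
  shows "bump_taylor r x z - 76 * r ^ 3 * norm z ^ 3 \<le> bump r (x + z)"
proof -
  have r: "r > 0" using x norm_ge_zero[of x] by linarith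
  let ?n = "norm z" and ?q = "gap r x"
  have xz: "\<bar>x \<bullet> z\<bar> \<le> r * ?n"
    using Cauchy_Schwarz_ineq2[of x z] x by (meson less_imp_le mult_right_mono norm_ge_zero order_trans)
  have r_le: "r ^ k * ?n ^ (3 - k) \<le> ?n ^ 3" if "k \<le> 3" for k
  proof -
    have "r ^ k * ?n ^ (3 - k) \<le> ?n ^ k * ?n ^ (3 - k)"
      using z r by (intro mult_right_mono power_mono) auto
    then show ?thesis using that by (simp flip: power_add)
  qed
  have "bump r x \<le> r ^ 3 * ?n ^ 3"
    using bump_le[of r x] mult_left_mono[OF r_le[of 3], of "r ^ 3"] r by (simp flip: power_add)
  moreover have "- (?q\<^sup>2 * (x \<bullet> z)) \<le> r ^ 3 * ?n ^ 3"
  proof -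
    have "- (?q\<^sup>2 * (x \<bullet> z)) \<le> ?q\<^sup>2 * (r * ?n)"
      using mult_left_mono[of "- (x \<bullet> z)" "r * ?n" "?q\<^sup>2"] xz by simp
    also have "\<dots> \<le> r ^ 4 * (r * ?n)"
      using gap_power_le[of r x 2] r by (intro mult_right_mono) auto
    also have "\<dots> = r ^ 3 * (r ^ 2 * ?n ^ (3 - 2))" by (simp add: power_numeral_reduce)
    also have "\<dots> \<le> r ^ 3 * ?n ^ 3" using r by (intro mult_left_mono r_le) auto
    finally show ?thesis .
  qed
  moreover have "?q * (x \<bullet> z)\<^sup>2 \<le> r ^ 3 * ?n ^ 3"
  proof -
    have "?q * (x \<bullet> z)\<^sup>2 \<le> r\<^sup>2 * (r * ?n)\<^sup>2"
      using gap_le[of r x] power_mono[OF xz abs_ge_zero, of 2] by (intro mult_mono) auto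
    also have "\<dots> = r ^ 3 * (r ^ 1 * ?n ^ (3 - 1))"
      by (simp add: power_mult_distrib power_numeral_reduce)
    also have "\<dots> \<le> r ^ 3 * ?n ^ 3" using r by (intro mult_left_mono r_le) auto
    finally show ?thesis .
  qed
  moreover have "0 \<le> ?q\<^sup>2 * ?n\<^sup>2" "0 \<le> r ^ 3 * ?n ^ 3" using r by auto
  ultimately have "bump_taylor r x z - 76 * r ^ 3 * ?n ^ 3 \<le> 0"
    unfolding bump_taylor_def mult.assoc by linarith
  then show ?thesis using bump_nonneg[of r "x + z"] by linarith
qed

lemma bump_taylor_le:
  assumes "r > 0"
  shows "bump_taylor r x z - 76 * r ^ 3 * norm z ^ 3 \<le> bump r (x + z)"
proof (cases "norm x < r")
  case True
  then show ?thesis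
    using bump_taylor_le_near bump_taylor_le_far by (metis linear)
next
  case False
  then have "gap r x = 0" using gap_pos_iff[OF assms, of x] gap_nonneg[of r x] by linarith
  then have "bump_taylor r x z = 0" by (simp add: bump_taylor_def bump_def)
  moreover have "0 \<le> 76 * r ^ 3 * norm z ^ 3" using assms by simp
  ultimately show ?thesis using bump_nonneg[of r "x + z"] by linarith
qed

lemma gap_mult_inner_add_sq_ge:
  assumes r: "r > 0"
  shows "gap r x * (x \<bullet> w)\<^sup>2 - 2 * (r ^ 4 * (norm b * norm w)) \<le> gap r x * (x \<bullet> (b + w))\<^sup>2"
proof -
  let ?q = "gap r x" and ?p = "norm b * norm w"
  have "?q * (\<bar>x \<bullet> b\<bar> * \<bar>x \<bullet> w\<bar>) \<le> ?q * (norm x * norm b * (norm x * norm w))"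
    by (intro mult_left_mono mult_mono Cauchy_Schwarz_ineq2) auto
  also have "\<dots> = ?q * norm x ^ 2 * ?p" by (simp add: power2_eq_square mult_ac)
  also have "\<dots> \<le> ?q * r ^ 2 * ?p"
    using r by (intro mult_right_mono gap_mult_norm_power_le) auto
  also have "\<dots> \<le> r ^ 2 * r ^ 2 * ?p"
    using gap_le[of r x] by (intro mult_right_mono) auto
  finally have "?q * (\<bar>x \<bullet> b\<bar> * \<bar>x \<bullet> w\<bar>) \<le> r ^ 4 * ?p"
    by (simp flip: power_add)
  moreover have "(x \<bullet> w)\<^sup>2 - 2 * (\<bar>x \<bullet> b\<bar> * \<bar>x \<bullet> w\<bar>) \<le> (x \<bullet> (b + w))\<^sup>2"
  proof -
    have "(x \<bullet> (b + w))\<^sup>2 = (x \<bullet> b)\<^sup>2 + (x \<bullet> w)\<^sup>2 + 2 * ((x \<bullet> b) * (x \<bullet> w))"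
      by (simp add: inner_add_right power2_sum)
    then show ?thesis
      using abs_ge_minus_self[of "(x \<bullet> b) * (x \<bullet> w)"] zero_le_power2[of "x \<bullet> b"]
      unfolding abs_mult by linarith
  qed
  then have "?q * ((x \<bullet> w)\<^sup>2 - 2 * (\<bar>x \<bullet> b\<bar> * \<bar>x \<bullet> w\<bar>)) \<le> ?q * (x \<bullet> (b + w))\<^sup>2"
    by (rule mult_left_mono) simp
  ultimately show ?thesis by (simp add: right_diff_distrib)
qed

lemma bump_taylor_add_ge:
  assumes r: "r > 0"
  shows "bump_taylor r x w - 6 * (gap r x)\<^sup>2 * r * norm b
      - r ^ 4 * (30 * (norm b * norm w) + 3 * (norm b)\<^sup>2) \<le> bump_taylor r x (b + w)"
proof -
  let ?q = "gap r x" and ?p = "norm b * norm w"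
  have q4: "?q\<^sup>2 \<le> r ^ 4" using gap_power_le[of r x 2] by simp
  have linear: "?q\<^sup>2 * (x \<bullet> b) \<le> ?q\<^sup>2 * r * norm b"
  proof -
    have "?q\<^sup>2 * (x \<bullet> b) \<le> ?q * (?q * norm x ^ 1) * norm b"
      using mult_left_mono[OF norm_cauchy_schwarz[of x b], of "?q\<^sup>2"]
      by (simp add: power2_eq_square mult.assoc)
    also have "\<dots> \<le> ?q * (?q * r ^ 1) * norm b"
      using r by (intro mult_right_mono mult_left_mono gap_mult_norm_power_le) auto
    finally show ?thesis by (simp add: power2_eq_square mult.assoc)
  qed
  have square: "?q\<^sup>2 * (norm (b + w))\<^sup>2 \<le> ?q\<^sup>2 * (norm w)\<^sup>2 + r ^ 4 * (2 * ?p + (norm b)\<^sup>2)"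
  proof -
    have "(norm (b + w))\<^sup>2 \<le> (norm b + norm w)\<^sup>2" by (intro power_mono norm_triangle_ineq) simp
    then have "?q\<^sup>2 * (norm (b + w))\<^sup>2 \<le> ?q\<^sup>2 * ((norm w)\<^sup>2 + (2 * ?p + (norm b)\<^sup>2))"
      by (intro mult_left_mono) (simp_all add: power2_sum algebra_simps)
    moreover have "?q\<^sup>2 * (2 * ?p + (norm b)\<^sup>2) \<le> r ^ 4 * (2 * ?p + (norm b)\<^sup>2)"
      using q4 by (intro mult_right_mono) auto
    ultimately show ?thesis unfolding distrib_left[of "?q\<^sup>2"] by linarith
  qed
  show ?thesis
    using linear square gap_mult_inner_add_sq_ge[OF r, of x w b]
    unfolding bump_taylor_def inner_add_right[of x b w] distrib_left mult.assoc
    by linarith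
qed

lemma cube_add_le:
  fixes a b :: real
  assumes "0 \<le> a" "0 \<le> b"
  shows "(a + b) ^ 3 \<le> 8 * (a ^ 3 + b ^ 3)"
proof -
  have "(a + b) ^ 3 \<le> (2 * max a b) ^ 3" using assms by (intro power_mono) auto
  also have "\<dots> = 8 * (max a b) ^ 3" by (simp add: power_mult_distrib)
  also have "\<dots> \<le> 8 * (a ^ 3 + b ^ 3)" using assms by (simp add: max_def)
  finally show ?thesis .
qed

lemma square_mult_le_cubes:
  fixes a b :: real
  assumes "0 \<le> a" "0 \<le> b"
  shows "a\<^sup>2 * b \<le> a ^ 3 + b ^ 3"
proof (cases "b \<le> a")
  case True
  then have "a\<^sup>2 * b \<le> a\<^sup>2 * a" by (rule mult_left_mono) simp
  then show ?thesis using assms by (simp add: power_numeral_reduce add_increasing2)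
next
  case False
  then have "a\<^sup>2 * b \<le> b\<^sup>2 * b" using assms by (intro mult_right_mono power_mono) auto
  then show ?thesis using assms by (simp add: power_numeral_reduce add_increasing)
qed

definition drift_remainder :: "real \<Rightarrow> real \<Rightarrow> real" where
  "drift_remainder r c = r ^ 4 * (30 * c + 3 * c\<^sup>2) + 608 * r ^ 3 * (c ^ 3 + 1)"

lemma drift_remainder_nonneg: "0 \<le> r \<Longrightarrow> 0 \<le> c \<Longrightarrow> 0 \<le> drift_remainder r c"
  by (simp add: drift_remainder_def)

text \<open>Here h is the square root of a step length, so that error terms of order h^3 vanish in the
  limit of small steps.\<close>

lemma bump_taylor_drift_le:
  assumes r: "r > 0" and c: "c \<ge> 0" and h: "0 \<le> h" "h \<le> 1" and b: "norm b \<le> c * h\<^sup>2"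
  shows "bump_taylor r x w - 6 * (gap r x)\<^sup>2 * r * c * h\<^sup>2
      - drift_remainder r c * (h ^ 3 + norm w ^ 3) \<le> bump r (x + b + w)"
proof -
  define e where "e = h ^ 3 + norm w ^ 3"
  have e: "h ^ 3 \<le> e" "norm w ^ 3 \<le> e" "0 \<le> e" using h by (auto simp: e_def)
  have "6 * (gap r x)\<^sup>2 * r * norm b \<le> 6 * (gap r x)\<^sup>2 * r * (c * h\<^sup>2)"
    using b r by (intro mult_left_mono) auto
  moreover have "r ^ 4 * (30 * (norm b * norm w) + 3 * (norm b)\<^sup>2) \<le> r ^ 4 * (30 * c + 3 * c\<^sup>2) * e"
  proof -
    have "norm b * norm w \<le> c * (h\<^sup>2 * norm w)"
      using mult_right_mono[OF b norm_ge_zero[of w]] by (simp add: mult.assoc)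
    also have "\<dots> \<le> c * e"
      using square_mult_le_cubes[of h "norm w"] h c unfolding e_def by (intro mult_left_mono) auto
    finally have "norm b * norm w \<le> c * e" .
    moreover have "(norm b)\<^sup>2 \<le> c\<^sup>2 * e"
    proof -
      have "(norm b)\<^sup>2 \<le> c\<^sup>2 * h ^ 4"
        using power_mono[OF b norm_ge_zero, of 2] by (simp add: power_mult_distrib)
      also have "\<dots> \<le> c\<^sup>2 * e"
        using power_decreasing[of 3 4 h] h e(1) by (intro mult_left_mono) auto
      finally show ?thesis .
    qed
    ultimately have "30 * (norm b * norm w) + 3 * (norm b)\<^sup>2 \<le> (30 * c + 3 * c\<^sup>2) * e"
      by (simp add: distrib_right)
    then show ?thesis unfolding mult.assoc by (rule mult_left_mono) (use r in simp)
  qed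
  moreover have "76 * r ^ 3 * norm (b + w) ^ 3 \<le> 608 * r ^ 3 * (c ^ 3 + 1) * e"
  proof -
    have "norm (b + w) ^ 3 \<le> (c * h + norm w) ^ 3"
    proof (intro power_mono norm_triangle_le add_right_mono)
      show "norm b \<le> c * h"
        using b mult_left_mono[OF mult_left_le[OF h(2,1)] c] by (simp add: power2_eq_square)
    qed simp
    also have "\<dots> \<le> 8 * ((c * h) ^ 3 + norm w ^ 3)" using c h by (intro cube_add_le) auto
    also have "\<dots> \<le> 8 * (c ^ 3 * e + e)"
      using e c by (simp add: power_mult_distrib add_mono mult_left_mono)
    finally show ?thesis
      using mult_left_mono[of "norm (b + w) ^ 3" "8 * (c ^ 3 * e + e)" "76 * r ^ 3"] r
      by (simp add: algebra_simps)
  qed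
  ultimately show ?thesis
    using bump_taylor_le[OF r, of x "b + w"] bump_taylor_add_ge[OF r, of x w b]
    by (simp add: drift_remainder_def e_def[symmetric] algebra_simps)
qed

subsection \<open>Ellipticity\<close>

lemma norm_matrix_sq:
  fixes A :: "real ^ 'n ^ 'm"
  shows "(norm A)\<^sup>2 = (\<Sum>i\<in>UNIV. (norm (A $ i))\<^sup>2)"
  by (simp add: norm_vec_def[of A] L2_set_def sum_nonneg)

lemma norm_matrix_vector_mult_sq:
  fixes A :: "real ^ 'n ^ 'm"
  shows "(norm (A *v x))\<^sup>2 = (\<Sum>i\<in>UNIV. (A $ i \<bullet> x)\<^sup>2)"
  by (simp add: norm_vec_def L2_set_def sum_nonneg matrix_vector_mul_component)

lemma norm_matrix_vector_mult_le:
  fixes A :: "real ^ 'n ^ 'm"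
  shows "norm (A *v x) \<le> norm A * norm x"
proof (rule power2_le_imp_le)
  have "(norm (A *v x))\<^sup>2 \<le> (\<Sum>i\<in>UNIV. (norm (A $ i))\<^sup>2 * (norm x)\<^sup>2)"
    unfolding norm_matrix_vector_mult_sq
    by (intro sum_mono) (metis Cauchy_Schwarz_ineq2 abs_ge_zero power2_abs power_mono power_mult_distrib)
  also have "\<dots> = (norm A * norm x)\<^sup>2"
    by (simp add: norm_matrix_sq power_mult_distrib sum_distrib_right)
  finally show "(norm (A *v x))\<^sup>2 \<le> (norm A * norm x)\<^sup>2" .
qed simp

lemma norm_transpose:
  fixes A :: "real ^ 'n ^ 'm"
  shows "norm (transpose A) = norm A"
proof -
  have "(norm (transpose A))\<^sup>2 = (\<Sum>i\<in>UNIV. \<Sum>j\<in>UNIV. (A $ j $ i)\<^sup>2)"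
    unfolding norm_matrix_sq by (simp add: norm_vec_def L2_set_def sum_nonneg transpose_def)
  also have "\<dots> = (norm A)\<^sup>2"
    unfolding norm_matrix_sq by (subst sum.swap) (simp add: norm_vec_def L2_set_def sum_nonneg)
  finally show ?thesis by simp
qed

lemma norm_transpose_mult_le:
  fixes A :: "real ^ 'n ^ 'm"
  shows "norm (transpose A *v x) \<le> norm A * norm x"
  using norm_matrix_vector_mult_le[of "transpose A" x] by (simp add: norm_transpose)

lemma norm_add_sq_le:
  fixes a b :: "'b::real_normed_vector"
  shows "(norm (a + b))\<^sup>2 \<le> 2 * (norm a)\<^sup>2 + 2 * (norm b)\<^sup>2"
proof -
  have "(norm (a + b))\<^sup>2 \<le> (norm a + norm b)\<^sup>2"
    by (intro power_mono norm_triangle_ineq) simp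
  also have "\<dots> \<le> 2 * (norm a)\<^sup>2 + 2 * (norm b)\<^sup>2"
    using sum_squares_bound[of "norm a" "norm b"] by (simp add: power2_sum)
  finally show ?thesis .
qed

definition elliptic :: "real \<Rightarrow> real \<Rightarrow> real ^ 'n ^ 'm \<Rightarrow> bool" where
  "elliptic \<epsilon> N S \<longleftrightarrow> (\<forall>\<xi>. \<epsilon> * (norm \<xi>)\<^sup>2 \<le> (norm (transpose S *v \<xi>))\<^sup>2) \<and> (norm S)\<^sup>2 \<le> N"

lemma ellipticI:
  fixes S :: "real ^ 'n ^ 'm"
  assumes lower: "\<And>\<xi>. \<epsilon> * (norm \<xi>)\<^sup>2 \<le> (norm (transpose S *v \<xi>))\<^sup>2"
    and upper: "\<And>\<xi>. (norm (transpose S *v \<xi>))\<^sup>2 \<le> K * (norm \<xi>)\<^sup>2"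
  shows "elliptic \<epsilon> (real CARD('m) * K) S"
proof -
  have "S $ i = transpose S *v axis i 1" for i
    by (simp only: matrix_vector_mult_basis column_transpose) (simp add: row_def)
  then have "(norm (S $ i))\<^sup>2 \<le> K" for i
    using upper by (metis mult.right_neutral norm_axis_1 power_one)
  then have "(\<Sum>i\<in>UNIV. (norm (S $ i))\<^sup>2) \<le> (\<Sum>i\<in>(UNIV :: 'm set). K)"
    by (intro sum_mono)
  then show ?thesis using lower by (simp add: elliptic_def norm_matrix_sq)
qed

text \<open>The generator, at the position x and for the diffusion matrix H, of a process whose drift has
  norm at most c, applied to the bump function; the last term is the worst case of the drift.\<close>

definition bump_generator :: "real \<Rightarrow> real \<Rightarrow> real ^ 'n ^ 'm \<Rightarrow> real ^ 'm \<Rightarrow> real" where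
  "bump_generator r c H x = 12 * gap r x * (norm (transpose H *v x))\<^sup>2
     - 3 * (gap r x)\<^sup>2 * (norm H)\<^sup>2 - 6 * (gap r x)\<^sup>2 * r * c"

definition bump_rate :: "real \<Rightarrow> real \<Rightarrow> real \<Rightarrow> real \<Rightarrow> real" where
  "bump_rate \<epsilon> N r c = (6 * r * c + 6 * N + 6 * \<epsilon>)\<^sup>2 / (24 * \<epsilon> * r\<^sup>2)"

lemma bump_rate_nonneg: "\<epsilon> > 0 \<Longrightarrow> 0 \<le> bump_rate \<epsilon> N r c"
  by (simp add: bump_rate_def)

lemma elliptic_transpose_mult_sq_ge:
  assumes "elliptic \<epsilon> N S"
  shows "\<epsilon> / 2 * (norm x)\<^sup>2 - (norm (H - S))\<^sup>2 * (norm x)\<^sup>2 \<le> (norm (transpose H *v x))\<^sup>2"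
proof -
  have "transpose (H - S) = transpose H - transpose S"
    by (simp add: transpose_def vec_eq_iff)
  then have "transpose S *v x = transpose H *v x + - (transpose (H - S) *v x)"
    by (simp add: matrix_vector_mult_diff_rdistrib)
  then have "(norm (transpose S *v x))\<^sup>2
      \<le> 2 * (norm (transpose H *v x))\<^sup>2 + 2 * (norm (transpose (H - S) *v x))\<^sup>2"
    using norm_add_sq_le[of "transpose H *v x" "- (transpose (H - S) *v x)"] by simp
  moreover have "(norm (transpose (H - S) *v x))\<^sup>2 \<le> (norm (H - S))\<^sup>2 * (norm x)\<^sup>2"
    using power_mono[OF norm_transpose_mult_le[of "H - S" x], of 2] by (simp add: power_mult_distrib)
  moreover have "\<epsilon> * (norm x)\<^sup>2 \<le> (norm (transpose S *v x))\<^sup>2"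
    using assms by (simp add: elliptic_def)
  ultimately show ?thesis by simp
qed

lemma bump_generator_ge:
  fixes S H :: "real ^ 'n ^ 'm"
  assumes S: "elliptic \<epsilon> N S" and pos: "r > 0" "\<epsilon> > 0"
  shows "- bump_rate \<epsilon> N r c * bump r x - 18 * r ^ 4 * (norm (H - S))\<^sup>2
    \<le> bump_generator r c H x"
proof -
  define C where "C = 6 * r * c + 6 * N + 6 * \<epsilon>"
  let ?q = "gap r x" and ?E = "(norm (H - S))\<^sup>2"
  have norm_H: "(norm H)\<^sup>2 \<le> 2 * N + 2 * ?E"
    using norm_add_sq_le[of S "H - S"] S by (simp add: elliptic_def)
  have gap_norm: "?q * (norm x)\<^sup>2 = ?q * r\<^sup>2 - ?q\<^sup>2"
    by (cases "(norm x)\<^sup>2 < r\<^sup>2") (simp_all add: gap_def max_def power2_eq_square algebra_simps)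
  have "6 * \<epsilon> * (?q * r\<^sup>2 - ?q\<^sup>2) - 12 * (r ^ 4 * ?E) \<le> 12 * ?q * (norm (transpose H *v x))\<^sup>2"
  proof -
    have "?q * (\<epsilon> / 2 * (norm x)\<^sup>2 - ?E * (norm x)\<^sup>2) \<le> ?q * (norm (transpose H *v x))\<^sup>2"
      by (intro mult_left_mono elliptic_transpose_mult_sq_ge[OF S]) simp
    moreover have "?q * (norm x)\<^sup>2 * ?E \<le> r\<^sup>2 * r\<^sup>2 * ?E"
      using gap_mult_norm_power_le[OF pos(1), of x 2] mult_right_mono[OF gap_le[of r x], of "r\<^sup>2"]
      by (intro mult_right_mono) auto
    moreover have "?q * (\<epsilon> / 2 * (norm x)\<^sup>2 - ?E * (norm x)\<^sup>2)
        = \<epsilon> / 2 * (?q * (norm x)\<^sup>2) - ?q * (norm x)\<^sup>2 * ?E"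
      by (simp add: algebra_simps)
    ultimately show ?thesis unfolding gap_norm by (simp add: mult.assoc flip: power_add)
  qed
  moreover have "3 * ?q\<^sup>2 * (norm H)\<^sup>2 \<le> 6 * N * ?q\<^sup>2 + 6 * (r ^ 4 * ?E)"
    using mult_left_mono[OF norm_H, of "3 * ?q\<^sup>2"] mult_right_mono[OF gap_power_le[of r x 2], of ?E]
    by (simp add: algebra_simps)
  moreover have "?q * (C * ?q - 6 * \<epsilon> * r\<^sup>2) \<le> ?q * (bump_rate \<epsilon> N r c * ?q\<^sup>2)"
  proof (rule mult_left_mono)
    have "0 \<le> (C * ?q - 12 * \<epsilon> * r\<^sup>2)\<^sup>2 / (24 * \<epsilon> * r\<^sup>2)" using pos by simp
    also have "\<dots> = bump_rate \<epsilon> N r c * ?q\<^sup>2 - C * ?q + 6 * \<epsilon> * r\<^sup>2"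
      unfolding bump_rate_def C_def[symmetric] using pos by (simp add: field_simps power2_eq_square)
    finally show "C * ?q - 6 * \<epsilon> * r\<^sup>2 \<le> bump_rate \<epsilon> N r c * ?q\<^sup>2" by simp
  qed simp
  ultimately show ?thesis
    unfolding bump_generator_def C_def bump_def
    by (simp add: algebra_simps power_numeral_reduce)
qed

subsection \<open>Moments of the Gaussian vector\<close>

lemma has_bochner_integral_lborel_prod:
  fixes f :: "'b::euclidean_space \<Rightarrow> real \<Rightarrow> real"
  assumes f: "\<And>b. b \<in> Basis \<Longrightarrow> has_bochner_integral lborel (f b) (I b)"
  shows "has_bochner_integral lborel (\<lambda>x. \<Prod>b\<in>Basis. f b (x \<bullet> b)) (\<Prod>b\<in>Basis. I b)"
proof -
  interpret product_sigma_finite "\<lambda>b :: 'b. lborel :: real measure" ..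
  have [measurable]: "f b \<in> borel_measurable borel" if "b \<in> Basis" for b
    using f[OF that] by (auto simp: has_bochner_integral_iff dest: borel_measurable_integrable)
  have "has_bochner_integral (\<Pi>\<^sub>M b\<in>Basis. lborel) (\<lambda>y. \<Prod>b\<in>Basis. f b (y b)) (\<Prod>b\<in>Basis. I b)"
    using f by (simp add: has_bochner_integral_iff product_integrable_prod product_integral_prod)
  then show ?thesis
    by (subst lborel_eq, intro has_bochner_integral_distr)
      (simp_all add: inner_sum_left_Basis cong: prod.cong)
qed

lemma prod_Basis_vec:
  fixes f :: "real ^ 'n \<Rightarrow> 'b::comm_monoid_mult"
  shows "(\<Prod>b\<in>Basis. f b) = (\<Prod>i\<in>UNIV. f (axis i 1))"
proof -
  have Basis_eq: "(Basis :: (real ^ 'n) set) = range (\<lambda>i. axis i 1)"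
    by (auto simp: Basis_vec_def)
  have "inj (\<lambda>i :: 'n. axis i (1 :: real))"
    by (auto simp: inj_on_def axis_eq_axis)
  then show ?thesis unfolding Basis_eq by (simp add: prod.reindex)
qed

lemma has_bochner_integral_lborel_prod_vec:
  fixes f :: "'n::finite \<Rightarrow> real \<Rightarrow> real"
  assumes "\<And>i. has_bochner_integral lborel (f i) (I i)"
  shows "has_bochner_integral lborel (\<lambda>x. \<Prod>i\<in>UNIV. f i (x $ i)) (\<Prod>i\<in>UNIV. I i)"
proof -
  define j where "j b = (SOME i. b = axis i (1 :: real))" for b :: "real ^ 'n"
  have j: "j (axis i 1) = i" for i
    unfolding j_def by (rule some_equality) (auto simp: axis_eq_axis)
  have "has_bochner_integral lborel (\<lambda>x. \<Prod>b\<in>Basis. f (j b) (x \<bullet> b)) (\<Prod>b\<in>Basis. I (j b))"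
    by (intro has_bochner_integral_lborel_prod assms)
  then show ?thesis
    by (simp add: prod_Basis_vec j inner_axis)
qed

lemma norm_vec_power_le:
  fixes x :: "real ^ 'n::finite"
  shows "norm x ^ k \<le> real CARD('n) ^ k * (\<Sum>i\<in>UNIV. \<bar>x $ i\<bar> ^ k)"
proof -
  obtain i where max: "\<And>j. \<bar>x $ j\<bar> \<le> \<bar>x $ i\<bar>"
  proof -
    have "Max (range (\<lambda>j. \<bar>x $ j\<bar>)) \<in> range (\<lambda>j. \<bar>x $ j\<bar>)" by (intro Max_in) auto
    then obtain i where "Max (range (\<lambda>j. \<bar>x $ j\<bar>)) = \<bar>x $ i\<bar>" by (rule rangeE)
    then show thesis
      using that Max_ge[of "range (\<lambda>j. \<bar>x $ j\<bar>)"]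
      by (metis finite_class.finite_UNIV finite_imageI rangeI)
  qed
  have "norm x \<le> (\<Sum>j\<in>UNIV. \<bar>x $ j\<bar>)" by (rule norm_le_l1_cart)
  also have "\<dots> \<le> (\<Sum>j\<in>(UNIV :: 'n set). \<bar>x $ i\<bar>)" by (intro sum_mono max)
  finally have "norm x ^ k \<le> (real CARD('n) * \<bar>x $ i\<bar>) ^ k" by (intro power_mono) auto
  also have "\<dots> \<le> real CARD('n) ^ k * (\<Sum>i\<in>UNIV. \<bar>x $ i\<bar> ^ k)"
    unfolding power_mult_distrib by (intro mult_left_mono member_le_sum) auto
  finally show ?thesis .
qed

lemma borel_measurable_vec_nth_comp [measurable (raw)]:
  fixes f :: "'a \<Rightarrow> 'b::real_normed_vector ^ 'n"
  assumes "f \<in> borel_measurable M"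
  shows "(\<lambda>x. f x $ i) \<in> borel_measurable M"
  by (rule measurable_compose[OF assms borel_measurable_continuous_onI]) (intro continuous_intros)

lemma has_bochner_integral_gauss_vec_prod:
  fixes f :: "'n::finite \<Rightarrow> real \<Rightarrow> real"
  assumes [measurable]: "\<And>i. f i \<in> borel_measurable borel"
    and f: "\<And>i. has_bochner_integral lborel (\<lambda>y. normal_density 0 (sqrt v) y * f i y) (I i)"
  shows "has_bochner_integral (gauss_vec v) (\<lambda>x. \<Prod>i\<in>UNIV. f i (x $ i)) (\<Prod>i\<in>UNIV. I i)"
  unfolding gauss_vec_def prod_ennreal[OF normal_density_nonneg]
proof (rule has_bochner_integral_density)
  show "has_bochner_integral lborel
      (\<lambda>x. (\<Prod>i\<in>UNIV. normal_density 0 (sqrt v) (x $ i)) *\<^sub>R (\<Prod>i\<in>UNIV. f i (x $ i))) (\<Prod>i\<in>UNIV. I i)"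
    using has_bochner_integral_lborel_prod_vec[OF f] by (simp add: prod.distrib)
qed (auto intro!: prod_nonneg)

context
  fixes v :: real
  assumes v: "v > 0"
begin

lemma has_bochner_integral_gauss_vec_nth:
  fixes i :: "'n::finite"
  assumes [measurable]: "f \<in> borel_measurable borel"
    and f: "has_bochner_integral lborel (\<lambda>y. normal_density 0 (sqrt v) y * f y) a"
  shows "has_bochner_integral (gauss_vec v) (\<lambda>x :: real ^ 'n. f (x $ i)) a"
proof -
  have "has_bochner_integral (gauss_vec v) (\<lambda>x. \<Prod>k\<in>UNIV. (if k = i then f else (\<lambda>_. 1)) (x $ k))
      (\<Prod>k\<in>UNIV. if k = i then a else 1)"
    using f normal_moment_even[of "sqrt v" 0 0] v
    by (intro has_bochner_integral_gauss_vec_prod) auto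
  moreover have "(\<Prod>k\<in>UNIV. (if k = i then f else (\<lambda>_. 1)) (x $ k)) = f (x $ i)" for x
    by (subst prod.remove[of _ i]) (auto intro: prod.neutral)
  ultimately show ?thesis by simp
qed

lemma has_bochner_integral_gauss_vec_first_moment:
  "has_bochner_integral (gauss_vec v) (\<lambda>x :: real ^ 'n::finite. x $ i) 0"
  using normal_moment_odd[of "sqrt v" 0 0] v by (intro has_bochner_integral_gauss_vec_nth) auto

lemma has_bochner_integral_gauss_vec_second_moment:
  "has_bochner_integral (gauss_vec v) (\<lambda>x :: real ^ 'n::finite. x $ i * x $ j) (if i = j then v else 0)"
proof (cases "i = j")
  case True
  have "has_bochner_integral (gauss_vec v) (\<lambda>x :: real ^ 'n. (x $ i)\<^sup>2) v"
    using normal_moment_even[of "sqrt v" 0 1] v by (intro has_bochner_integral_gauss_vec_nth) auto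
  then show ?thesis using True by (simp add: power2_eq_square)
next
  case False
  let ?f = "\<lambda>k y. if k = i \<or> k = j then y else 1 :: real"
  have "has_bochner_integral (gauss_vec v) (\<lambda>x. \<Prod>k\<in>UNIV. ?f k (x $ k))
      (\<Prod>k\<in>UNIV. if k = i \<or> k = j then 0 else 1)"
  proof (rule has_bochner_integral_gauss_vec_prod)
    show "has_bochner_integral lborel (\<lambda>y. normal_density 0 (sqrt v) y * ?f k y)
        (if k = i \<or> k = j then 0 else 1)" for k
      using normal_moment_even[of "sqrt v" 0 0] normal_moment_odd[of "sqrt v" 0 0] v
      by (cases "k = i \<or> k = j") (simp_all only: if_True if_False, simp_all)
  qed simp
  moreover have "(\<Prod>k\<in>UNIV. ?f k (x $ k)) = x $ i * x $ j" for x :: "real ^ 'n"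
    using False
    by (subst prod.remove[of _ i], simp, simp, subst prod.remove[of _ j]) (auto intro: prod.neutral)
  moreover have "(\<Prod>k\<in>UNIV. if k = i \<or> k = j then 0 else 1 :: real) = 0"
    by (rule prod_zero) auto
  ultimately show ?thesis using False by simp
qed

lemma
  shows integrable_gauss_vec_norm_cube:
      "integrable (gauss_vec v) (\<lambda>x :: real ^ 'n::finite. norm x ^ 3)" (is ?integrable)
    and gauss_vec_norm_cube_le:
      "(\<integral>x. norm x ^ 3 \<partial>(gauss_vec v :: (real ^ 'n) measure)) \<le> 2 * real CARD('n) ^ 4 * (v * sqrt v)"
      (is ?bound)
proof -
  define m where "m = 2 * sqrt v ^ 3 * sqrt (2 / pi)"
  have cube: "has_bochner_integral (gauss_vec v) (\<lambda>x :: real ^ 'n. \<bar>x $ i\<bar> ^ 3) m" for i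
    using normal_moment_abs_odd[of "sqrt v" 0 1] v
    unfolding m_def by (intro has_bochner_integral_gauss_vec_nth) (auto simp: numeral_3_eq_3)
  have dominating: "has_bochner_integral (gauss_vec v)
      (\<lambda>x :: real ^ 'n. real CARD('n) ^ 3 * (\<Sum>i\<in>UNIV. \<bar>x $ i\<bar> ^ 3))
      (real CARD('n) ^ 3 * (\<Sum>i\<in>(UNIV :: 'n set). m))"
    by (intro has_bochner_integral_mult_right has_bochner_integral_sum cube)
  show integrable: ?integrable
  proof (rule Bochner_Integration.integrable_bound[OF integrable.intros[OF dominating]])
    show "AE x in gauss_vec v. norm (norm (x :: real ^ 'n) ^ 3)
        \<le> norm (real CARD('n) ^ 3 * (\<Sum>i\<in>UNIV. \<bar>x $ i\<bar> ^ 3))"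
      using order_trans[OF norm_vec_power_le abs_ge_self] by (intro AE_I2) simp
  qed (simp add: gauss_vec_def)
  have "(\<integral>x. norm x ^ 3 \<partial>(gauss_vec v :: (real ^ 'n) measure)) \<le> real CARD('n) ^ 3 * (\<Sum>i\<in>(UNIV :: 'n set). m)"
    unfolding has_bochner_integral_integral_eq[OF dominating, symmetric]
    by (intro integral_mono integrable integrable.intros[OF dominating] norm_vec_power_le)
  also have "\<dots> = real CARD('n) ^ 4 * m" by (simp add: power_numeral_reduce)
  also have "m \<le> 2 * (v * sqrt v)"
  proof -
    have "sqrt (2 / pi) \<le> 1" using pi_gt3 by simp
    then have "m \<le> 2 * sqrt v ^ 3 * 1" unfolding m_def using v by (intro mult_left_mono) auto
    then show ?thesis using v by (simp add: power3_eq_cube)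
  qed
  finally show ?bound by (simp add: mult_ac)
qed

end

subsection \<open>Brownian increments\<close>

locale filtered_prob_space = prob_space M
  for M :: "'a measure" and F :: "real \<Rightarrow> 'a measure" and T :: real +
  assumes T_pos: "T > 0"
    and filtration: "filtration_usual M F T"
begin

lemma subalgebra_F: "t \<in> {0..T} \<Longrightarrow> subalgebra M (F t)"
  using filtration by (auto simp: filtration_usual_def)

lemma space_F: "t \<in> {0..T} \<Longrightarrow> space (F t) = space M"
  using subalgebra_F by (auto simp: subalgebra_def)

lemma sets_F: "t \<in> {0..T} \<Longrightarrow> A \<in> sets (F t) \<Longrightarrow> A \<in> events"
  using subalgebra_F by (auto simp: subalgebra_def)

lemma sets_F_mono: "0 \<le> s \<Longrightarrow> s \<le> t \<Longrightarrow> t \<le> T \<Longrightarrow> A \<in> sets (F s) \<Longrightarrow> A \<in> sets (F t)"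
  using filtration by (auto simp: filtration_usual_def)

lemma measurable_F: "t \<in> {0..T} \<Longrightarrow> f \<in> measurable (F t) N \<Longrightarrow> f \<in> measurable M N"
  using subalgebra_F measurable_from_subalg by blast

lemma measurable_F_mono:
  assumes "0 \<le> s" "s \<le> t" "t \<le> T" "f \<in> measurable (F s) N"
  shows "f \<in> measurable (F t) N"
proof (rule measurable_from_subalg)
  show "subalgebra (F t) (F s)"
    using sets_F_mono[OF assms(1-3)] space_F[of s] space_F[of t] assms(1-3)
    by (auto simp: subalgebra_def)
qed (rule assms)

lemma integrable_F_bounded:
  fixes Y :: "'a \<Rightarrow> 'b::{banach, second_countable_topology}"
  assumes "t \<in> {0..T}" "Y \<in> borel_measurable (F t)" "\<And>\<omega>. \<omega> \<in> space M \<Longrightarrow> norm (Y \<omega>) \<le> C"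
  shows "integrable M Y"
  using assms by (intro integrable_const_bound[of _ C] AE_I2 measurable_F[of t]) auto

end

locale filtered_brownian = filtered_prob_space M F T
  for M :: "'a measure" and F :: "real \<Rightarrow> 'a measure" and T :: real +
  fixes W :: "real \<Rightarrow> 'a \<Rightarrow> real ^ 'n::finite"
  assumes brownian: "brownian_motion M F T W"
begin

lemma W_adapted: "t \<in> {0..T} \<Longrightarrow> W t \<in> borel_measurable (F t)"
  using brownian by (auto simp: brownian_motion_def)

context
  fixes u v :: real
  assumes uv: "0 \<le> u" "u < v" "v \<le> T"
begin

lemma increment_measurable [measurable]: "(\<lambda>\<omega>. W v \<omega> - W u \<omega>) \<in> borel_measurable M"
  using uv by (intro borel_measurable_diff measurable_F[OF _ W_adapted]) auto

lemma increment_distr: "distr M borel (\<lambda>\<omega>. W v \<omega> - W u \<omega>) = gauss_vec (v - u)"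
  using brownian uv by (auto simp: brownian_motion_def)

lemma increment_indep:
  fixes g :: "real ^ 'n \<Rightarrow> real" and Y :: "'a \<Rightarrow> real"
  assumes Y: "Y \<in> borel_measurable (F u)" and [measurable]: "g \<in> borel_measurable borel"
  shows "indep_var borel Y borel (\<lambda>\<omega>. g (W v \<omega> - W u \<omega>))"
proof -
  let ?D = "\<lambda>\<omega>. W v \<omega> - W u \<omega>"
  have u: "u \<in> {0..T}" using uv by auto
  have [measurable]: "Y \<in> borel_measurable M" using measurable_F[OF u Y] .
  have sigma_sets_vimage:
    "sigma_sets (space M) {f -` A \<inter> space M |A. A \<in> sets borel} = {f -` A \<inter> space M |A. A \<in> sets borel}"
    for f :: "'a \<Rightarrow> real"
    using sigma_sets_vimage_commute[of f "space M" UNIV "sets (borel :: real measure)"]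
      sets.sigma_sets_eq[of "borel :: real measure"] by auto
  show ?thesis
    unfolding indep_var_eq sigma_sets_vimage
  proof (intro conjI indep_setI)
    show "{Y -` A \<inter> space M |A. A \<in> sets borel} \<subseteq> events"
      "{(\<lambda>\<omega>. g (?D \<omega>)) -` A \<inter> space M |A. A \<in> sets borel} \<subseteq> events"
      by (auto intro: measurable_sets)
    fix a b
    assume "a \<in> {Y -` A \<inter> space M |A. A \<in> sets borel}"
      and "b \<in> {(\<lambda>\<omega>. g (?D \<omega>)) -` A \<inter> space M |A. A \<in> sets borel}"
    then obtain A B where A: "A \<in> sets borel" "a = Y -` A \<inter> space (F u)"
      and B: "B \<in> sets borel" "b = (\<lambda>\<omega>. g (?D \<omega>)) -` B \<inter> space M"
      by (auto simp: space_F[OF u])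
    have a: "a \<in> sets (F u)" using A Y by (auto intro: measurable_sets)
    have "g -` B \<in> sets borel" using measurable_sets[of g borel borel B] B by simp
    then have "prob {\<omega> \<in> space M. \<omega> \<in> a \<and> ?D \<omega> \<in> g -` B} = prob a * prob {\<omega> \<in> space M. ?D \<omega> \<in> g -` B}"
      using brownian uv a unfolding brownian_motion_def by blast
    moreover have "a \<inter> b = {\<omega> \<in> space M. \<omega> \<in> a \<and> ?D \<omega> \<in> g -` B}" "b = {\<omega> \<in> space M. ?D \<omega> \<in> g -` B}"
      using B by auto
    ultimately show "prob (a \<inter> b) = prob a * prob b" by simp
  qed auto
qed

lemma has_bochner_integral_increment:
  fixes g :: "real ^ 'n \<Rightarrow> real"
  assumes g [measurable]: "g \<in> borel_measurable borel" and "has_bochner_integral (gauss_vec (v - u)) g a"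
  shows "has_bochner_integral M (\<lambda>\<omega>. g (W v \<omega> - W u \<omega>)) a"
  using assms(2) integrable_distr[OF increment_measurable, of g] integral_distr[OF increment_measurable g]
  unfolding has_bochner_integral_iff increment_distr by simp

lemma has_bochner_integral_mult_increment:
  fixes g :: "real ^ 'n \<Rightarrow> real" and Y :: "'a \<Rightarrow> real"
  assumes Y: "Y \<in> borel_measurable (F u)" "integrable M Y"
    and g: "g \<in> borel_measurable borel" "has_bochner_integral (gauss_vec (v - u)) g a"
  shows "has_bochner_integral M (\<lambda>\<omega>. Y \<omega> * g (W v \<omega> - W u \<omega>)) (expectation Y * a)"
proof -
  note indep = increment_indep[OF Y(1) g(1)]
  have "integrable M (\<lambda>\<omega>. g (W v \<omega> - W u \<omega>))" "expectation (\<lambda>\<omega>. g (W v \<omega> - W u \<omega>)) = a"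
    using has_bochner_integral_increment[OF g] by (auto simp: has_bochner_integral_iff)
  then show ?thesis
    using indep_var_integrable[OF indep Y(2)] indep_var_lebesgue_integral[OF indep Y(2)]
    by (simp add: has_bochner_integral_iff)
qed

lemma has_bochner_integral_inner_increment:
  fixes a :: "'a \<Rightarrow> real ^ 'n"
  assumes a [measurable]: "a \<in> borel_measurable (F u)" and int: "integrable M a"
  shows "has_bochner_integral M (\<lambda>\<omega>. a \<omega> \<bullet> (W v \<omega> - W u \<omega>)) 0"
proof -
  have "has_bochner_integral M (\<lambda>\<omega>. a \<omega> $ i * (W v \<omega> - W u \<omega>) $ i) (expectation (\<lambda>\<omega>. a \<omega> $ i) * 0)" for i
    using uv by (intro has_bochner_integral_mult_increment has_bochner_integral_gauss_vec_first_moment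
        integrable_bounded_linear[OF bounded_linear_vec_nth int]) auto
  then have "has_bochner_integral M (\<lambda>\<omega>. \<Sum>i\<in>UNIV. a \<omega> $ i * (W v \<omega> - W u \<omega>) $ i) (\<Sum>i\<in>(UNIV :: 'n set). 0)"
    by (intro has_bochner_integral_sum) simp
  then show ?thesis by (simp add: inner_vec_def)
qed

lemma has_bochner_integral_inner_mult_inner_increment:
  fixes a b :: "'a \<Rightarrow> real ^ 'n"
  assumes [measurable]: "a \<in> borel_measurable (F u)" "b \<in> borel_measurable (F u)"
    and int: "integrable M (\<lambda>\<omega>. norm (a \<omega>) * norm (b \<omega>))"
  shows "has_bochner_integral M (\<lambda>\<omega>. (a \<omega> \<bullet> (W v \<omega> - W u \<omega>)) * (b \<omega> \<bullet> (W v \<omega> - W u \<omega>)))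
    ((v - u) * expectation (\<lambda>\<omega>. a \<omega> \<bullet> b \<omega>))"
proof -
  let ?D = "\<lambda>\<omega>. W v \<omega> - W u \<omega>"
  have u: "u \<in> {0..T}" using uv by auto
  have [measurable]: "a \<in> borel_measurable M" "b \<in> borel_measurable M"
    using assms(1,2) by (auto intro: measurable_F[OF u])
  have int_nth: "integrable M (\<lambda>\<omega>. a \<omega> $ i * b \<omega> $ j)" for i j
    by (rule Bochner_Integration.integrable_bound[OF int])
      (auto intro!: AE_I2 mult_mono component_le_norm_cart simp: abs_mult)
  have "has_bochner_integral M (\<lambda>\<omega>. (a \<omega> $ i * b \<omega> $ j) * (?D \<omega> $ i * ?D \<omega> $ j))
      (expectation (\<lambda>\<omega>. a \<omega> $ i * b \<omega> $ j) * (if i = j then v - u else 0))" for i j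
    using uv by (intro has_bochner_integral_mult_increment[where g = "\<lambda>x. x $ i * x $ j"]
        has_bochner_integral_gauss_vec_second_moment int_nth) auto
  then have "has_bochner_integral M (\<lambda>\<omega>. \<Sum>i\<in>UNIV. \<Sum>j\<in>UNIV. (a \<omega> $ i * b \<omega> $ j) * (?D \<omega> $ i * ?D \<omega> $ j))
      (\<Sum>i\<in>UNIV. \<Sum>j\<in>UNIV. expectation (\<lambda>\<omega>. a \<omega> $ i * b \<omega> $ j) * (if i = j then v - u else 0))"
    by (intro has_bochner_integral_sum)
  moreover have "(\<Sum>i\<in>UNIV. \<Sum>j\<in>UNIV. (a \<omega> $ i * b \<omega> $ j) * (?D \<omega> $ i * ?D \<omega> $ j))
      = (a \<omega> \<bullet> ?D \<omega>) * (b \<omega> \<bullet> ?D \<omega>)" for \<omega>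
    unfolding inner_vec_def sum_product by (intro sum.cong refl) simp
  moreover have "(\<Sum>i\<in>UNIV. \<Sum>j\<in>UNIV. expectation (\<lambda>\<omega>. a \<omega> $ i * b \<omega> $ j) * (if i = j then v - u else 0))
      = (v - u) * expectation (\<lambda>\<omega>. a \<omega> \<bullet> b \<omega>)"
    using int_nth by (simp add: mult_delta_right inner_vec_def flip: sum_distrib_left sum_distrib_right)
  ultimately show ?thesis by simp
qed

lemma has_bochner_integral_matrix_increment:
  fixes H :: "'a \<Rightarrow> real ^ 'n ^ 'm" and Y :: "'a \<Rightarrow> real"
  assumes [measurable]: "H \<in> borel_measurable (F u)" "Y \<in> borel_measurable (F u)"
    and int: "integrable M (\<lambda>\<omega>. Y \<omega> * (norm (H \<omega>))\<^sup>2)"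
  shows "has_bochner_integral M (\<lambda>\<omega>. Y \<omega> * (norm (H \<omega> *v (W v \<omega> - W u \<omega>)))\<^sup>2)
    ((v - u) * expectation (\<lambda>\<omega>. Y \<omega> * (norm (H \<omega>))\<^sup>2))"
proof -
  let ?D = "\<lambda>\<omega>. W v \<omega> - W u \<omega>"
  have u: "u \<in> {0..T}" using uv by auto
  have [measurable]: "H \<in> borel_measurable M" "Y \<in> borel_measurable M"
    using assms(1,2) by (auto intro: measurable_F[OF u])
  have int_nth: "integrable M (\<lambda>\<omega>. Y \<omega> * (norm (H \<omega> $ i))\<^sup>2)" for i
    by (rule Bochner_Integration.integrable_bound[OF int])
      (auto intro!: AE_I2 mult_mono power_mono Finite_Cartesian_Product.norm_nth_le simp: abs_mult)
  have "has_bochner_integral M (\<lambda>\<omega>. ((Y \<omega> *\<^sub>R H \<omega> $ i) \<bullet> ?D \<omega>) * (H \<omega> $ i \<bullet> ?D \<omega>))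
      ((v - u) * expectation (\<lambda>\<omega>. (Y \<omega> *\<^sub>R H \<omega> $ i) \<bullet> H \<omega> $ i))" for i
  proof (rule has_bochner_integral_inner_mult_inner_increment)
    show "integrable M (\<lambda>\<omega>. norm (Y \<omega> *\<^sub>R H \<omega> $ i) * norm (H \<omega> $ i))"
      using integrable_abs[OF int_nth] by (simp add: abs_mult power2_eq_square mult.assoc)
  qed measurable
  then have "has_bochner_integral M (\<lambda>\<omega>. \<Sum>i\<in>UNIV. ((Y \<omega> *\<^sub>R H \<omega> $ i) \<bullet> ?D \<omega>) * (H \<omega> $ i \<bullet> ?D \<omega>))
      (\<Sum>i\<in>UNIV. (v - u) * expectation (\<lambda>\<omega>. (Y \<omega> *\<^sub>R H \<omega> $ i) \<bullet> H \<omega> $ i))"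
    by (rule has_bochner_integral_sum)
  moreover have "(\<Sum>i\<in>UNIV. ((Y \<omega> *\<^sub>R H \<omega> $ i) \<bullet> ?D \<omega>) * (H \<omega> $ i \<bullet> ?D \<omega>)) = Y \<omega> * (norm (H \<omega> *v ?D \<omega>))\<^sup>2" for \<omega>
    unfolding norm_matrix_vector_mult_sq by (simp add: sum_distrib_left power2_eq_square mult.assoc)
  moreover have "(\<Sum>i\<in>UNIV. (v - u) * expectation (\<lambda>\<omega>. (Y \<omega> *\<^sub>R H \<omega> $ i) \<bullet> H \<omega> $ i))
      = (v - u) * expectation (\<lambda>\<omega>. Y \<omega> * (norm (H \<omega>))\<^sup>2)"
    using int_nth unfolding norm_matrix_sq
    by (simp add: sum_distrib_left flip: power2_norm_eq_inner)
  ultimately show ?thesis by simp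
qed

end

end

subsection \<open>One step with a predictable diffusion matrix\<close>

lemma gap_mult_norm_transpose_power_le:
  fixes H :: "real ^ 'n ^ 'm"
  assumes r: "r > 0" and B: "norm H \<le> B"
  shows "gap r x * norm (transpose H *v x) ^ k \<le> r\<^sup>2 * (B * r) ^ k"
proof -
  have B0: "0 \<le> B" using B norm_ge_zero order_trans by blast
  have "norm (transpose H *v x) \<le> B * norm x"
    using norm_transpose_mult_le[of H x] mult_right_mono[OF B norm_ge_zero[of x]] by linarith
  then have "gap r x * norm (transpose H *v x) ^ k \<le> gap r x * (B * norm x) ^ k"
    by (intro mult_left_mono power_mono) auto
  also have "\<dots> = B ^ k * (gap r x * norm x ^ k)" by (simp add: power_mult_distrib)
  also have "\<dots> \<le> B ^ k * (r\<^sup>2 * r ^ k)"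
    using r B0
    by (intro mult_left_mono order_trans[OF gap_mult_norm_power_le mult_right_mono[OF gap_le]]) auto
  finally show ?thesis by (simp add: power_mult_distrib mult_ac)
qed

lemma bump_generator_abs_le:
  assumes r: "r > 0" and c: "c \<ge> 0" and H: "norm H \<le> B"
  shows "\<bar>bump_generator r c H x\<bar> \<le> 12 * (r\<^sup>2 * (B * r)\<^sup>2) + 3 * (r ^ 4 * B\<^sup>2) + 6 * (r ^ 4 * r * c)"
proof -
  let ?q = "gap r x"
  have gap_sq: "?q\<^sup>2 \<le> r ^ 4" using gap_power_le[of r x 2] by simp
  have "?q\<^sup>2 * (norm H)\<^sup>2 \<le> r ^ 4 * B\<^sup>2"
    using gap_sq H by (intro mult_mono power_mono) auto
  moreover have "?q\<^sup>2 * r * c \<le> r ^ 4 * r * c"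
    using gap_sq r c by (intro mult_right_mono) auto
  moreover have "0 \<le> ?q * (norm (transpose H *v x))\<^sup>2" "0 \<le> ?q\<^sup>2 * (norm H)\<^sup>2" "0 \<le> ?q\<^sup>2 * r * c"
    using r c by auto
  ultimately show ?thesis
    using gap_mult_norm_transpose_power_le[OF r H, of x 2]
    unfolding bump_generator_def mult.assoc[of 12] mult.assoc[of 3] mult.assoc[of 6] abs_le_iff
    by linarith
qed

lemma borel_measurable_transpose_mult [measurable (raw)]:
  fixes f :: "'a \<Rightarrow> real ^ 'n ^ 'm"
  assumes "f \<in> borel_measurable N" "g \<in> borel_measurable N"
  shows "(\<lambda>\<omega>. transpose (f \<omega>) *v g \<omega>) \<in> borel_measurable N"
  by (rule borel_measurable_continuous_Pair[OF assms])
    (auto simp: transpose_def matrix_vector_mult_def intro!: continuous_intros)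

lemma bump_generator_measurable [measurable (raw)]:
  fixes f :: "'a \<Rightarrow> real ^ 'n ^ 'm"
  assumes "f \<in> borel_measurable N" "g \<in> borel_measurable N"
  shows "(\<lambda>\<omega>. bump_generator r c (f \<omega>) (g \<omega>)) \<in> borel_measurable N"
  using assms unfolding bump_generator_def by measurable

lemma (in prob_space) integrable_indicator_mult_bump:
  fixes Y :: "'a \<Rightarrow> 'b::euclidean_space"
  assumes [measurable]: "A \<in> events" "Y \<in> borel_measurable M"
  shows "integrable M (\<lambda>\<omega>. indicator A \<omega> * bump r (Y \<omega>))"
proof (rule integrable_const_bound[of _ "r ^ 6"])
  show "AE \<omega> in M. norm (indicator A \<omega> * bump r (Y \<omega>)) \<le> r ^ 6"
    by (intro AE_I2) (auto simp: indicator_def bump_le)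
qed measurable

lemma (in prob_space) integrable_indicator_mult_bump_generator:
  fixes H :: "'a \<Rightarrow> real ^ 'n ^ 'm"
  assumes r: "r > 0" and c: "c \<ge> 0" and B: "\<And>\<omega>. \<omega> \<in> space M \<Longrightarrow> norm (H \<omega>) \<le> B"
    and [measurable]: "A \<in> events" "H \<in> borel_measurable M" "x \<in> borel_measurable M"
  shows "integrable M (\<lambda>\<omega>. indicator A \<omega> * bump_generator r c (H \<omega>) (x \<omega>))"
proof (rule integrable_const_bound[OF AE_I2])
  show "norm (indicator A \<omega> * bump_generator r c (H \<omega>) (x \<omega>))
      \<le> 12 * (r\<^sup>2 * (B * r)\<^sup>2) + 3 * (r ^ 4 * B\<^sup>2) + 6 * (r ^ 4 * r * c)" if "\<omega> \<in> space M" for \<omega>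
    using bump_generator_abs_le[OF r c B[OF that], of "x \<omega>"] by (auto simp: indicator_def)
qed measurable

definition bump_step_lower ::
  "real \<Rightarrow> real \<Rightarrow> real \<Rightarrow> real \<Rightarrow> real ^ 'm \<Rightarrow> real ^ 'n ^ 'm \<Rightarrow> real ^ 'n \<Rightarrow> real" where
  "bump_step_lower r c B \<delta> x H d = bump_taylor r x (H *v d) - \<delta> * (6 * (gap r x)\<^sup>2 * r * c)
     - drift_remainder r c * (\<delta> * sqrt \<delta> + B ^ 3 * norm d ^ 3)"

lemma bump_step_lower_le:
  fixes H :: "real ^ 'n ^ 'm"
  assumes r: "r > 0" and c: "c \<ge> 0" and \<delta>: "0 \<le> \<delta>" "\<delta> \<le> 1" and H: "norm H \<le> B"
    and z: "norm (z - x - H *v d) \<le> c * \<delta>"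
  shows "bump_step_lower r c B \<delta> x H d \<le> bump r z"
proof -
  define h where "h = sqrt \<delta>"
  have h: "0 \<le> h" "h \<le> 1" "h\<^sup>2 = \<delta>" "h ^ 3 = \<delta> * sqrt \<delta>"
    using \<delta> by (auto simp: h_def power3_eq_cube)
  have "bump_taylor r x (H *v d) - 6 * (gap r x)\<^sup>2 * r * c * h\<^sup>2
      - drift_remainder r c * (h ^ 3 + norm (H *v d) ^ 3) \<le> bump r z"
    using bump_taylor_drift_le[OF r c h(1,2), of "z - x - H *v d" x "H *v d"] z h(3) by simp
  moreover have "drift_remainder r c * (h ^ 3 + norm (H *v d) ^ 3)
      \<le> drift_remainder r c * (h ^ 3 + B ^ 3 * norm d ^ 3)"
  proof (intro mult_left_mono add_left_mono drift_remainder_nonneg)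
    have "norm (H *v d) \<le> B * norm d"
      using norm_matrix_vector_mult_le[of H d] mult_right_mono[OF H norm_ge_zero[of d]] by linarith
    then have "norm (H *v d) ^ 3 \<le> (B * norm d) ^ 3" by (intro power_mono) auto
    then show "norm (H *v d) ^ 3 \<le> B ^ 3 * norm d ^ 3" by (simp add: power_mult_distrib)
  qed (use r c in auto)
  ultimately show ?thesis using h by (simp add: bump_step_lower_def mult_ac)
qed

context filtered_brownian
begin

context
  fixes u v r B :: real and A :: "'a set" and x :: "'a \<Rightarrow> real ^ 'm" and H :: "'a \<Rightarrow> real ^ 'n ^ 'm"
  assumes uv: "0 \<le> u" "u < v" "v \<le> T" and r: "r > 0"
    and meas [measurable]: "A \<in> sets (F u)" "x \<in> borel_measurable (F u)" "H \<in> borel_measurable (F u)"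
    and B: "\<And>\<omega>. \<omega> \<in> space M \<Longrightarrow> norm (H \<omega>) \<le> B"
begin

private abbreviation weight :: "'a \<Rightarrow> real" where
  "weight \<omega> \<equiv> indicator A \<omega> * gap r (x \<omega>)"

private abbreviation direction :: "'a \<Rightarrow> real ^ 'n" where
  "direction \<omega> \<equiv> transpose (H \<omega>) *v x \<omega>"

private lemma start_time: "u \<in> {0..T}"
  using uv by auto

private lemma weight_bounds: "0 \<le> weight \<omega>" "weight \<omega> \<le> r\<^sup>2"
  using gap_le[of r "x \<omega>"] by (auto simp: indicator_def)

private lemma weight_mult_norm_direction_power_le:
  assumes "\<omega> \<in> space M"
  shows "weight \<omega> * norm (direction \<omega>) ^ k \<le> r\<^sup>2 * (B * r) ^ k"
proof -
  have "weight \<omega> * norm (direction \<omega>) ^ k \<le> gap r (x \<omega>) * norm (direction \<omega>) ^ k"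
    by (intro mult_right_mono) (auto simp: indicator_def)
  also have "\<dots> \<le> r\<^sup>2 * (B * r) ^ k"
    by (intro gap_mult_norm_transpose_power_le r B assms)
  finally show ?thesis .
qed

private lemma has_bochner_integral_bump_taylor_linear:
  "has_bochner_integral M
    (\<lambda>\<omega>. (6 * weight \<omega> * gap r (x \<omega>)) *\<^sub>R direction \<omega> \<bullet> (W v \<omega> - W u \<omega>)) 0"
proof (intro has_bochner_integral_inner_increment[OF uv] integrable_F_bounded[OF start_time])
  fix \<omega> assume \<omega>: "\<omega> \<in> space M"
  have "norm ((6 * weight \<omega> * gap r (x \<omega>)) *\<^sub>R direction \<omega>)
      = 6 * gap r (x \<omega>) * (weight \<omega> * norm (direction \<omega>) ^ 1)"
    by simp
  also have "\<dots> \<le> 6 * r\<^sup>2 * (r\<^sup>2 * (B * r) ^ 1)"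
    by (intro mult_mono[of "6 * _"] weight_mult_norm_direction_power_le[OF \<omega>]) (auto simp: gap_le)
  finally show "norm ((6 * weight \<omega> * gap r (x \<omega>)) *\<^sub>R direction \<omega>) \<le> 6 * r\<^sup>2 * (r\<^sup>2 * (B * r) ^ 1)" .
qed measurable

private lemma integrable_bump_taylor_trace:
  "integrable M (\<lambda>\<omega>. (3 * weight \<omega> * gap r (x \<omega>)) * (norm (H \<omega>))\<^sup>2)"
proof (intro integrable_F_bounded[OF start_time])
  fix \<omega> assume \<omega>: "\<omega> \<in> space M"
  have "(3 * weight \<omega> * gap r (x \<omega>)) * (norm (H \<omega>))\<^sup>2 \<le> (3 * r\<^sup>2 * r\<^sup>2) * B\<^sup>2"
    using B[OF \<omega>]
    by (intro mult_mono[of _ _ "(norm (H \<omega>))\<^sup>2"] mult_mono weight_bounds power_mono) (auto simp: gap_le)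
  then show "norm ((3 * weight \<omega> * gap r (x \<omega>)) * (norm (H \<omega>))\<^sup>2) \<le> (3 * r\<^sup>2 * r\<^sup>2) * B\<^sup>2"
    by simp
qed measurable

private lemma integrable_bump_taylor_square:
  "integrable M (\<lambda>\<omega>. (12 * weight \<omega>) *\<^sub>R direction \<omega> \<bullet> direction \<omega>)"
proof (intro integrable_F_bounded[OF start_time])
  show "norm ((12 * weight \<omega>) *\<^sub>R direction \<omega> \<bullet> direction \<omega>) \<le> 12 * (r\<^sup>2 * (B * r)\<^sup>2)" if "\<omega> \<in> space M" for \<omega>
    using weight_mult_norm_direction_power_le[OF that, of 2] by (simp add: dot_square_norm mult.assoc)
qed measurable

private lemma has_bochner_integral_bump_taylor_square:
  "has_bochner_integral M
    (\<lambda>\<omega>. ((12 * weight \<omega>) *\<^sub>R direction \<omega> \<bullet> (W v \<omega> - W u \<omega>)) * (direction \<omega> \<bullet> (W v \<omega> - W u \<omega>)))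
    ((v - u) * expectation (\<lambda>\<omega>. (12 * weight \<omega>) *\<^sub>R direction \<omega> \<bullet> direction \<omega>))"
proof (rule has_bochner_integral_inner_mult_inner_increment[OF uv])
  show "integrable M (\<lambda>\<omega>. norm ((12 * weight \<omega>) *\<^sub>R direction \<omega>) * norm (direction \<omega>))"
    using integrable_bump_taylor_square by (simp add: dot_square_norm abs_mult power2_eq_square mult.assoc)
qed measurable

lemma has_bochner_integral_bump_taylor:
  "has_bochner_integral M (\<lambda>\<omega>. indicator A \<omega> * bump_taylor r (x \<omega>) (H \<omega> *v (W v \<omega> - W u \<omega>)))
    (expectation (\<lambda>\<omega>. indicator A \<omega> * bump r (x \<omega>))
      + (v - u) * expectation (\<lambda>\<omega>. indicator A \<omega> * bump_generator r 0 (H \<omega>) (x \<omega>)))"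
proof -
  let ?D = "\<lambda>\<omega>. W v \<omega> - W u \<omega>"
  have [measurable]: "A \<in> events" "x \<in> borel_measurable M"
    using meas by (auto intro: sets_F[OF start_time] measurable_F[OF start_time])
  have initial: "has_bochner_integral M (\<lambda>\<omega>. indicator A \<omega> * bump r (x \<omega>))
      (expectation (\<lambda>\<omega>. indicator A \<omega> * bump r (x \<omega>)))"
    by (intro has_bochner_integral_integrable integrable_indicator_mult_bump) measurable
  have trace: "has_bochner_integral M (\<lambda>\<omega>. (3 * weight \<omega> * gap r (x \<omega>)) * (norm (H \<omega> *v ?D \<omega>))\<^sup>2)
      ((v - u) * expectation (\<lambda>\<omega>. (3 * weight \<omega> * gap r (x \<omega>)) * (norm (H \<omega>))\<^sup>2))"
    by (intro has_bochner_integral_matrix_increment[OF uv] integrable_bump_taylor_trace) measurable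
  have taylor: "indicator A \<omega> * bump_taylor r (x \<omega>) (H \<omega> *v ?D \<omega>) = indicator A \<omega> * bump r (x \<omega>)
      - (6 * weight \<omega> * gap r (x \<omega>)) *\<^sub>R direction \<omega> \<bullet> ?D \<omega>
      - (3 * weight \<omega> * gap r (x \<omega>)) * (norm (H \<omega> *v ?D \<omega>))\<^sup>2
      + ((12 * weight \<omega>) *\<^sub>R direction \<omega> \<bullet> ?D \<omega>) * (direction \<omega> \<bullet> ?D \<omega>)" for \<omega>
    by (simp add: bump_taylor_def dot_lmul_matrix power2_eq_square algebra_simps)
  have "indicator A \<omega> * bump_generator r 0 (H \<omega>) (x \<omega>)
      = (12 * weight \<omega>) *\<^sub>R direction \<omega> \<bullet> direction \<omega> - (3 * weight \<omega> * gap r (x \<omega>)) * (norm (H \<omega>))\<^sup>2" for \<omega>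
    by (simp add: bump_generator_def dot_square_norm power2_eq_square algebra_simps)
  then have generator: "expectation (\<lambda>\<omega>. indicator A \<omega> * bump_generator r 0 (H \<omega>) (x \<omega>))
      = expectation (\<lambda>\<omega>. (12 * weight \<omega>) *\<^sub>R direction \<omega> \<bullet> direction \<omega>)
        - expectation (\<lambda>\<omega>. (3 * weight \<omega> * gap r (x \<omega>)) * (norm (H \<omega>))\<^sup>2)"
    by (simp only: Bochner_Integration.integral_diff[OF integrable_bump_taylor_square
          integrable_bump_taylor_trace])
  have regroup: "e + (v - u) * (f - g) = e - 0 - (v - u) * g + (v - u) * f" for e f g
    by (simp add: algebra_simps)
  show ?thesis
    unfolding taylor generator regroup
    by (intro has_bochner_integral_add has_bochner_integral_diff initial trace
        has_bochner_integral_bump_taylor_linear has_bochner_integral_bump_taylor_square)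
qed

lemma has_bochner_integral_bump_step_lower:
  fixes c :: real
  assumes c: "c \<ge> 0"
  defines "m\<^sub>3 \<equiv> (\<integral>x. norm x ^ 3 \<partial>(gauss_vec (v - u) :: (real ^ 'n) measure))"
  shows "has_bochner_integral M
      (\<lambda>\<omega>. indicator A \<omega> * bump_step_lower r c B (v - u) (x \<omega>) (H \<omega>) (W v \<omega> - W u \<omega>))
      (expectation (\<lambda>\<omega>. indicator A \<omega> * bump r (x \<omega>))
        + (v - u) * expectation (\<lambda>\<omega>. indicator A \<omega> * bump_generator r c (H \<omega>) (x \<omega>))
        - drift_remainder r c * ((v - u) * sqrt (v - u) * prob A + B ^ 3 * (prob A * m\<^sub>3)))"
proof -
  let ?D = "\<lambda>\<omega>. W v \<omega> - W u \<omega>" and ?R = "drift_remainder r c" and ?\<delta> = "v - u"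
  have [measurable]: "A \<in> events" "x \<in> borel_measurable M" "H \<in> borel_measurable M"
    using meas by (auto intro: sets_F[OF start_time] measurable_F[OF start_time])
  have int_indicator: "integrable M (indicat_real A)"
    by (intro integrable_real_indicator) (auto simp: less_top[symmetric])
  have const: "has_bochner_integral M (\<lambda>\<omega>. a * indicator A \<omega>) (a * prob A)" for a :: real
    using int_indicator by (simp add: has_bochner_integral_iff)
  have "has_bochner_integral (gauss_vec ?\<delta>) (\<lambda>x :: real ^ 'n. norm x ^ 3) m\<^sub>3"
    unfolding m\<^sub>3_def using uv by (intro has_bochner_integral_integrable integrable_gauss_vec_norm_cube) auto
  then have "has_bochner_integral M (\<lambda>\<omega>. indicator A \<omega> * norm (?D \<omega>) ^ 3) (expectation (indicator A) * m\<^sub>3)"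
    by (intro has_bochner_integral_mult_increment[OF uv, where g = "\<lambda>x. norm x ^ 3"] int_indicator) measurable
  then have cube: "has_bochner_integral M (\<lambda>\<omega>. indicator A \<omega> * norm (?D \<omega>) ^ 3) (prob A * m\<^sub>3)"
    by simp
  define drift_loss where "drift_loss \<omega> = indicator A \<omega> * (6 * (gap r (x \<omega>))\<^sup>2 * r * c)" for \<omega>
  have generator: "indicator A \<omega> * bump_generator r 0 (H \<omega>) (x \<omega>)
      = indicator A \<omega> * bump_generator r c (H \<omega>) (x \<omega>) + drift_loss \<omega>" for \<omega>
    by (simp add: bump_generator_def drift_loss_def algebra_simps)
  have int_generator: "integrable M (\<lambda>\<omega>. indicator A \<omega> * bump_generator r c' (H \<omega>) (x \<omega>))" if "c' \<ge> 0" for c'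
    by (intro integrable_indicator_mult_bump_generator[OF r that B]) measurable
  have int_drift_loss: "integrable M drift_loss"
    using Bochner_Integration.integrable_diff[OF int_generator[of 0] int_generator[of c]] c generator
    by (simp add: algebra_simps)
  have lower: "indicator A \<omega> * bump_step_lower r c B ?\<delta> (x \<omega>) (H \<omega>) (?D \<omega>)
      = indicator A \<omega> * bump_taylor r (x \<omega>) (H \<omega> *v ?D \<omega>) - ?\<delta> * drift_loss \<omega>
        - ?R * (?\<delta> * sqrt ?\<delta> * indicator A \<omega> + B ^ 3 * (indicator A \<omega> * norm (?D \<omega>) ^ 3))" for \<omega>
    by (simp add: bump_step_lower_def drift_loss_def algebra_simps)
  have "expectation (\<lambda>\<omega>. indicator A \<omega> * bump_generator r 0 (H \<omega>) (x \<omega>))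
      = expectation (\<lambda>\<omega>. indicator A \<omega> * bump_generator r c (H \<omega>) (x \<omega>)) + expectation drift_loss"
    unfolding generator by (rule Bochner_Integration.integral_add[OF int_generator[OF c] int_drift_loss])
  then have regroup: "e + ?\<delta> * expectation (\<lambda>\<omega>. indicator A \<omega> * bump_generator r c (H \<omega>) (x \<omega>)) - k
      = e + ?\<delta> * expectation (\<lambda>\<omega>. indicator A \<omega> * bump_generator r 0 (H \<omega>) (x \<omega>))
        - ?\<delta> * expectation drift_loss - k" for e k
    by (simp add: algebra_simps)
  show ?thesis
    unfolding lower regroup using int_drift_loss
    by (intro has_bochner_integral_add has_bochner_integral_diff has_bochner_integral_mult_right const cube
        has_bochner_integral_bump_taylor has_bochner_integral_integrable)
qed

end

lemma expectation_bump_step_ge: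
  fixes x Z :: "'a \<Rightarrow> real ^ 'm" and H :: "'a \<Rightarrow> real ^ 'n ^ 'm"
  assumes uv: "0 \<le> u" "u < v" "v \<le> T" "v - u \<le> 1" and r: "r > 0" and c: "c \<ge> 0"
    and F [measurable]: "A \<in> sets (F u)" "x \<in> borel_measurable (F u)" "H \<in> borel_measurable (F u)"
    and B: "\<And>\<omega>. \<omega> \<in> space M \<Longrightarrow> norm (H \<omega>) \<le> B"
    and Z: "Z \<in> borel_measurable M"
    and drift: "AE \<omega> in M. norm (Z \<omega> - x \<omega> - H \<omega> *v (W v \<omega> - W u \<omega>)) \<le> c * (v - u)"
  shows "expectation (\<lambda>\<omega>. indicator A \<omega> * bump r (x \<omega>))
      + (v - u) * expectation (\<lambda>\<omega>. indicator A \<omega> * bump_generator r c (H \<omega>) (x \<omega>))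
      - drift_remainder r c * (1 + 2 * real CARD('n) ^ 4 * B ^ 3) * ((v - u) * sqrt (v - u))
    \<le> expectation (\<lambda>\<omega>. indicator A \<omega> * bump r (Z \<omega>))"
proof -
  let ?R = "drift_remainder r c" and ?\<delta> = "v - u"
  define m\<^sub>3 where "m\<^sub>3 = (\<integral>x. norm x ^ 3 \<partial>(gauss_vec ?\<delta> :: (real ^ 'n) measure))"
  have "A \<in> events" using F(1) sets_F[of u] uv by auto
  note lower = has_bochner_integral_bump_step_lower[OF uv(1-3) r F B c, folded m\<^sub>3_def]
  have "AE \<omega> in M. indicator A \<omega> * bump_step_lower r c B ?\<delta> (x \<omega>) (H \<omega>) (W v \<omega> - W u \<omega>)
      \<le> indicator A \<omega> * bump r (Z \<omega>)"
    using drift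
  proof (rule AE_mp, intro AE_I2 impI mult_left_mono)
    fix \<omega> assume "\<omega> \<in> space M" and "norm (Z \<omega> - x \<omega> - H \<omega> *v (W v \<omega> - W u \<omega>)) \<le> c * ?\<delta>"
    then show "bump_step_lower r c B ?\<delta> (x \<omega>) (H \<omega>) (W v \<omega> - W u \<omega>) \<le> bump r (Z \<omega>)"
      using uv by (intro bump_step_lower_le r c B) auto
  qed simp
  then have "expectation (\<lambda>\<omega>. indicator A \<omega> * bump_step_lower r c B ?\<delta> (x \<omega>) (H \<omega>) (W v \<omega> - W u \<omega>))
      \<le> expectation (\<lambda>\<omega>. indicator A \<omega> * bump r (Z \<omega>))"
    using \<open>A \<in> events\<close> Z
    by (intro integral_mono_AE integrable.intros[OF lower] integrable_indicator_mult_bump)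
  moreover have "?R * (?\<delta> * sqrt ?\<delta> * prob A + B ^ 3 * (prob A * m\<^sub>3))
      \<le> ?R * (?\<delta> * sqrt ?\<delta> * 1 + B ^ 3 * (1 * (2 * real CARD('n) ^ 4 * (?\<delta> * sqrt ?\<delta>))))"
  proof (intro mult_left_mono add_mono mult_mono)
    obtain \<omega>\<^sub>0 where "\<omega>\<^sub>0 \<in> space M" using not_empty by auto
    then show "0 \<le> B ^ 3" using B norm_ge_zero order_trans zero_le_power by blast
    show "m\<^sub>3 \<le> 2 * real CARD('n) ^ 4 * (?\<delta> * sqrt ?\<delta>)"
      unfolding m\<^sub>3_def using uv by (intro gauss_vec_norm_cube_le) auto
    show "0 \<le> m\<^sub>3" unfolding m\<^sub>3_def by (intro integral_nonneg_AE) auto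
  qed (use r c uv in \<open>auto intro: drift_remainder_nonneg\<close>)
  ultimately show ?thesis
    using has_bochner_integral_integral_eq[OF lower] by (simp add: algebra_simps)
qed

end

subsection \<open>Monotonicity along small steps\<close>

lemma le_by_short_steps:
  fixes f :: "real \<Rightarrow> real"
  assumes d: "d > 0" and "a \<le> b"
    and step: "\<And>u v. a \<le> u \<Longrightarrow> u < v \<Longrightarrow> v \<le> b \<Longrightarrow> v - u \<le> d \<Longrightarrow> f u \<le> f v"
  shows "f a \<le> f b"
proof -
  obtain n :: nat where "(b - a) / d \<le> real n" using real_arch_simple by blast
  then have "b - a \<le> real n * d" using d by (simp add: field_simps)
  then show ?thesis using \<open>a \<le> b\<close> step
  proof (induction n arbitrary: a)
    case 0
    then show ?case by simp
  next
    case (Suc n)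
    show ?case
    proof (cases "b - a \<le> d")
      case True
      then show ?thesis using Suc.prems(2) Suc.prems(3)[of a b] by (cases "a = b") auto
    next
      case False
      have "f a \<le> f (a + d)" using False d by (intro Suc.prems(3)) auto
      also have "\<dots> \<le> f b" using False d Suc.prems by (intro Suc.IH) (auto simp: algebra_simps)
      finally show ?thesis .
    qed
  qed
qed

lemma le_by_local_steps:
  fixes f :: "real \<Rightarrow> real"
  assumes "finite S" and d: "d > 0" and "a \<le> b"
    and "\<And>u v. a \<le> u \<Longrightarrow> u < v \<Longrightarrow> v \<le> b \<Longrightarrow> {u<..<v} \<inter> S = {} \<Longrightarrow> v - u \<le> d \<Longrightarrow> f u \<le> f v"
  shows "f a \<le> f b"
  using assms(1,3,4)
proof (induction S arbitrary: a b rule: finite_induct)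
  case empty
  show ?case by (rule le_by_short_steps[OF d empty.prems(1)], rule empty.prems(2)) auto
next
  case (insert w S)
  have IH: "f u \<le> f v" if "a \<le> u" "u \<le> v" "v \<le> b" "w \<notin> {u<..<v}" for u v
  proof (rule insert.IH[OF \<open>u \<le> v\<close>])
    fix u' v' assume "u \<le> u'" "u' < v'" "v' \<le> v" "{u'<..<v'} \<inter> S = {}" "v' - u' \<le> d"
    moreover from this have "{u'<..<v'} \<inter> insert w S = {}" using that(4) by auto
    ultimately show "f u' \<le> f v'" using that(1,3) by (intro insert.prems(2)) simp_all
  qed
  show ?case
  proof (cases "w \<in> {a<..<b}")
    case True
    then have "f a \<le> f w" "f w \<le> f b" by (auto intro!: IH)
    then show ?thesis by simp
  next
    case False
    then show ?thesis using insert.prems(1) by (intro IH) auto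
  qed
qed

lemma le_by_local_steps_with_error:
  fixes f :: "real \<Rightarrow> real"
  assumes S: "finite S" and ab: "a \<le> b" and C: "C \<ge> 0"
    and step: "\<And>u v. a \<le> u \<Longrightarrow> u < v \<Longrightarrow> v \<le> b \<Longrightarrow> {u<..<v} \<inter> S = {} \<Longrightarrow> v - u \<le> 1 \<Longrightarrow>
      f u \<le> f v + C * ((v - u) * sqrt (v - u))"
  shows "f a \<le> f b"
proof -
  have "f a \<le> f b + d * (C * (b - a))" if d: "0 < d" "d \<le> 1" for d
  proof -
    have "f a + d * C * a \<le> f b + d * C * b"
    proof (rule le_by_local_steps[OF S _ ab])
      show "0 < d\<^sup>2" using d by simp
      fix u v assume uv: "a \<le> u" "u < v" "v \<le> b" "{u<..<v} \<inter> S = {}" "v - u \<le> d\<^sup>2"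
      have "d\<^sup>2 \<le> 1" using d by (simp add: power_le_one)
      then have "f u \<le> f v + C * ((v - u) * sqrt (v - u))" using uv by (intro step) auto
      moreover have "C * ((v - u) * sqrt (v - u)) \<le> C * ((v - u) * d)"
        using C uv d by (intro mult_left_mono real_le_lsqrt) auto
      ultimately show "f u + d * C * u \<le> f v + d * C * v" by (simp add: algebra_simps)
    qed
    then show ?thesis by (simp add: algebra_simps)
  qed
  then have bound: "\<forall>\<^sub>F d in at_right 0. f a \<le> f b + d * (C * (b - a))"
    by (intro eventually_at_rightI[of 0 1]) auto
  have "((\<lambda>d. f b + d * (C * (b - a))) \<longlongrightarrow> f b + 0 * (C * (b - a))) (at_right 0)"
    by (intro tendsto_intros)
  from tendsto_lowerbound[OF this bound] show ?thesis by simp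
qed

subsection \<open>Ito processes with simple diffusion coefficient\<close>

lemma (in filtered_prob_space) finite_measure_time: "finite_measure (restrict_space lborel {0..T})"
  by (rule finite_measureI) (auto simp: emeasure_restrict_space space_restrict_space emeasure_lborel_Icc_eq)

sublocale filtered_prob_space \<subseteq> time: finite_measure "restrict_space lborel {0..T}"
  by (rule finite_measure_time)

sublocale filtered_prob_space \<subseteq> time_space: pair_sigma_finite "restrict_space lborel {0..T}" M ..

context filtered_prob_space
begin

abbreviation "time_space \<equiv> restrict_space lborel {0..T} \<Otimes>\<^sub>M M"

definition mean_sq_dist ::
  "(real \<Rightarrow> 'a \<Rightarrow> 'b::real_normed_vector) \<Rightarrow> (real \<Rightarrow> 'a \<Rightarrow> 'b) \<Rightarrow> real \<Rightarrow> real" where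
  "mean_sq_dist H G s = expectation (\<lambda>\<omega>. (norm (H s \<omega> - G s \<omega>))\<^sup>2)"

lemma mean_sq_dist_nonneg: "0 \<le> mean_sq_dist H G t"
  unfolding mean_sq_dist_def by (intro integral_nonneg_AE) auto

lemma integral_mean_sq_dist_nonneg: "0 \<le> (LINT s:D|lborel. mean_sq_dist H G s)"
  unfolding set_lebesgue_integral_def by (intro integral_nonneg_AE) (auto simp: mean_sq_dist_nonneg)

lemma time_section_measurable:
  assumes "(\<lambda>p. H (fst p) (snd p)) \<in> measurable time_space N" "s \<in> {0..T}"
  shows "H s \<in> measurable M N"
  using measurable_compose[OF measurable_Pair1' assms(1)] assms(2) by (simp add: space_restrict_space)

end

lemma exp_minus_le:
  fixes x :: real
  assumes "0 \<le> x"
  shows "exp (- x) \<le> 1 - x + x\<^sup>2"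
proof -
  have "1 \<le> 1 + x ^ 3" using assms by simp
  also have "\<dots> = (1 - x + x\<^sup>2) * (1 + x)" by (simp add: power2_eq_square power3_eq_cube algebra_simps)
  also have "\<dots> \<le> (1 - x + x\<^sup>2) * exp x"
  proof (rule mult_left_mono)
    have "1 - x + x\<^sup>2 = (x - 1 / 2)\<^sup>2 + 3 / 4" by (simp add: power2_eq_square algebra_simps)
    then show "0 \<le> 1 - x + x\<^sup>2" by simp
  qed simp
  finally show ?thesis by (simp add: exp_minus field_simps)
qed

lemma exp_minus_mult_le:
  fixes a b x \<delta> :: real
  assumes a: "0 \<le> a" and \<delta>: "0 \<le> \<delta>" "\<delta> \<le> 1" and x: "0 \<le> x" "x \<le> b"
  shows "exp (- (a * \<delta>)) * x \<le> x - \<delta> * (a * x) + a\<^sup>2 * b * (\<delta> * sqrt \<delta>)"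
proof -
  have "exp (- (a * \<delta>)) * x \<le> (1 - a * \<delta> + (a * \<delta>)\<^sup>2) * x"
    using a \<delta> x by (intro mult_right_mono exp_minus_le) auto
  also have "\<dots> = x - \<delta> * (a * x) + a\<^sup>2 * (x * \<delta>\<^sup>2)" by algebra
  also have "x * \<delta>\<^sup>2 \<le> b * (\<delta> * sqrt \<delta>)"
  proof (rule mult_mono)
    have "\<delta> \<le> sqrt \<delta>" using \<delta> by (simp add: real_le_rsqrt power2_eq_square mult_left_le)
    then show "\<delta>\<^sup>2 \<le> \<delta> * sqrt \<delta>" using \<delta> by (simp add: power2_eq_square mult_left_mono)
  qed (use x in auto)
  finally show ?thesis by (simp add: mult_left_mono mult.assoc)
qed

locale simple_ito_process = filtered_brownian M F T W
  for M :: "'a measure" and F :: "real \<Rightarrow> 'a measure" and T :: real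
    and W :: "real \<Rightarrow> 'a \<Rightarrow> real ^ 'n::finite" +
  fixes Y :: "real \<Rightarrow> 'a \<Rightarrow> real ^ 'm::finite" and H :: "real \<Rightarrow> 'a \<Rightarrow> real ^ 'n ^ 'm"
    and S :: "real set" and c :: real
  assumes finite_S: "finite S"
    and c_nonneg: "c \<ge> 0"
    and Y_adapted: "t \<in> {0..T} \<Longrightarrow> Y t \<in> borel_measurable (F t)"
    and H_measurable [measurable]: "(\<lambda>p. H (fst p) (snd p)) \<in> borel_measurable time_space"
    and H_bounded: "\<exists>B. \<forall>s. \<forall>\<omega>\<in>space M. norm (H s \<omega>) \<le> B"
    and H_predictable: "0 \<le> u \<Longrightarrow> u < v \<Longrightarrow> v \<le> T \<Longrightarrow> {u<..<v} \<inter> S = {} \<Longrightarrow> H v \<in> borel_measurable (F u)"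
    and H_const: "0 \<le> u \<Longrightarrow> u < v \<Longrightarrow> v \<le> T \<Longrightarrow> {u<..<v} \<inter> S = {} \<Longrightarrow> s \<in> {u<..v} \<Longrightarrow> H s \<omega> = H v \<omega>"
    and drift_le: "0 \<le> u \<Longrightarrow> u < v \<Longrightarrow> v \<le> T \<Longrightarrow> {u<..<v} \<inter> S = {} \<Longrightarrow>
      AE \<omega> in M. norm (Y v \<omega> - Y u \<omega> - H v \<omega> *v (W v \<omega> - W u \<omega>)) \<le> c * (v - u)"

locale elliptic_diffusion = filtered_brownian M F T W
  for M :: "'a measure" and F :: "real \<Rightarrow> 'a measure" and T :: real
    and W :: "real \<Rightarrow> 'a \<Rightarrow> real ^ 'n::finite" +
  fixes \<sigma> :: "real \<Rightarrow> 'a \<Rightarrow> real ^ 'n ^ 'm::finite" and \<epsilon> N :: real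
  assumes \<sigma>_measurable [measurable]: "(\<lambda>p. \<sigma> (fst p) (snd p)) \<in> borel_measurable time_space"
    and \<epsilon>_pos: "\<epsilon> > 0"
    and \<sigma>_elliptic: "t \<in> {0..T} \<Longrightarrow> AE \<omega> in M. elliptic \<epsilon> N (\<sigma> t \<omega>)"

locale elliptic_simple_ito_process = simple_ito_process M F T W Y H S c + elliptic_diffusion M F T W \<sigma> \<epsilon> N
  for M :: "'a measure" and F :: "real \<Rightarrow> 'a measure" and T :: real
    and W :: "real \<Rightarrow> 'a \<Rightarrow> real ^ 'n::finite" and Y :: "real \<Rightarrow> 'a \<Rightarrow> real ^ 'm::finite"
    and H :: "real \<Rightarrow> 'a \<Rightarrow> real ^ 'n ^ 'm" and S :: "real set" and c :: real
    and \<sigma> :: "real \<Rightarrow> 'a \<Rightarrow> real ^ 'n ^ 'm" and \<epsilon> N :: real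
begin

abbreviation rate :: "real \<Rightarrow> real" where
  "rate r \<equiv> bump_rate \<epsilon> N r c"

lemma AE_sq_dist_le:
  assumes t: "t \<in> {0..T}" and B: "\<And>\<omega>. \<omega> \<in> space M \<Longrightarrow> norm (H t \<omega>) \<le> B"
  shows "AE \<omega> in M. (norm (H t \<omega> - \<sigma> t \<omega>))\<^sup>2 \<le> 2 * B\<^sup>2 + 2 * N"
  using \<sigma>_elliptic[OF t]
proof (rule AE_mp, intro AE_I2 impI)
  fix \<omega> assume "\<omega> \<in> space M" "elliptic \<epsilon> N (\<sigma> t \<omega>)"
  then show "(norm (H t \<omega> - \<sigma> t \<omega>))\<^sup>2 \<le> 2 * B\<^sup>2 + 2 * N"
    using norm_add_sq_le[of "H t \<omega>" "- \<sigma> t \<omega>"] power_mono[OF B norm_ge_zero, of \<omega> 2]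
    by (simp add: elliptic_def)
qed

lemma integrable_sq_dist:
  assumes t: "t \<in> {0..T}"
  shows "integrable M (\<lambda>\<omega>. (norm (H t \<omega> - \<sigma> t \<omega>))\<^sup>2)"
proof -
  obtain B where "\<And>\<omega>. \<omega> \<in> space M \<Longrightarrow> norm (H t \<omega>) \<le> B" using H_bounded by blast
  note bound = AE_sq_dist_le[OF t this]
  have [measurable]: "H t \<in> borel_measurable M" "\<sigma> t \<in> borel_measurable M"
    using t by (auto intro: time_section_measurable[OF H_measurable] time_section_measurable[OF \<sigma>_measurable])
  show ?thesis
    using bound by (intro integrable_const_bound[of _ "2 * B\<^sup>2 + 2 * N"]) auto
qed

lemma set_integrable_mean_sq_dist:
  assumes "D \<in> sets borel" "D \<subseteq> {0..T}"
  shows "set_integrable lborel D (mean_sq_dist H \<sigma>)"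
proof -
  obtain B where B: "\<And>s \<omega>. \<omega> \<in> space M \<Longrightarrow> norm (H s \<omega>) \<le> B" using H_bounded by blast
  have "mean_sq_dist H \<sigma> t \<le> 2 * B\<^sup>2 + 2 * N" if "t \<in> {0..T}" for t
    unfolding mean_sq_dist_def
    using integral_mono_AE[OF integrable_sq_dist[OF that] integrable_const AE_sq_dist_le[OF that B]]
    by (simp add: prob_space)
  then have "integrable (restrict_space lborel {0..T}) (mean_sq_dist H \<sigma>)"
    using mean_sq_dist_nonneg[of H \<sigma>] unfolding mean_sq_dist_def[abs_def]
    by (intro time.integrable_const_bound[of _ "2 * B\<^sup>2 + 2 * N"] AE_I2)
      (auto simp: space_restrict_space)
  then have "set_integrable lborel {0..T} (mean_sq_dist H \<sigma>)"
    by (simp add: integrable_restrict_space set_integrable_def)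
  then show ?thesis by (rule set_integrable_subset) (use assms in auto)
qed

lemma integral_mean_sq_dist_add:
  assumes "0 \<le> u" "u \<le> v" "v \<le> T"
  shows "(LINT s:{0..v}|lborel. mean_sq_dist H \<sigma> s)
    = (LINT s:{0..u}|lborel. mean_sq_dist H \<sigma> s) + (LINT s:{u<..v}|lborel. mean_sq_dist H \<sigma> s)"
proof -
  have "{0..v} = {0..u} \<union> {u<..v}" "{0..u} \<inter> {u<..v} = {}" using assms by auto
  moreover have "set_integrable lborel {0..u} (mean_sq_dist H \<sigma>)"
    "set_integrable lborel {u<..v} (mean_sq_dist H \<sigma>)"
    using assms by (auto intro!: set_integrable_mean_sq_dist)
  ultimately show ?thesis by (simp add: set_integral_Un)
qed

lemma expectation_generator_ge:
  fixes x :: "'a \<Rightarrow> real ^ 'm"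
  assumes uv: "0 \<le> u" "u < v" "v \<le> T" "{u<..<v} \<inter> S = {}" and s: "s \<in> {u<..v}" and r: "r > 0"
    and [measurable]: "A \<in> events" "x \<in> borel_measurable M"
  shows "- rate r * expectation (\<lambda>\<omega>. indicator A \<omega> * bump r (x \<omega>)) - 18 * r ^ 4 * mean_sq_dist H \<sigma> s
    \<le> expectation (\<lambda>\<omega>. indicator A \<omega> * bump_generator r c (H v \<omega>) (x \<omega>))"
proof -
  have st: "s \<in> {0..T}" "v \<in> {0..T}" using uv s by auto
  have [measurable]: "H v \<in> borel_measurable M" using st by (intro time_section_measurable[OF H_measurable])
  obtain B where B: "\<And>s \<omega>. \<omega> \<in> space M \<Longrightarrow> norm (H s \<omega>) \<le> B" using H_bounded by blast
  have int_bump: "integrable M (\<lambda>\<omega>. indicator A \<omega> * bump r (x \<omega>))"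
    by (intro integrable_indicator_mult_bump) measurable
  have int_generator: "integrable M (\<lambda>\<omega>. indicator A \<omega> * bump_generator r c (H v \<omega>) (x \<omega>))"
    by (intro integrable_indicator_mult_bump_generator[OF r c_nonneg B]) measurable
  have "AE \<omega> in M. - rate r * (indicator A \<omega> * bump r (x \<omega>)) - 18 * r ^ 4 * (norm (H s \<omega> - \<sigma> s \<omega>))\<^sup>2
      \<le> indicator A \<omega> * bump_generator r c (H v \<omega>) (x \<omega>)"
    using \<sigma>_elliptic[OF st(1)]
  proof eventually_elim
    case (elim \<omega>)
    then show ?case
      using bump_generator_ge[OF elim r \<epsilon>_pos, of c "x \<omega>" "H s \<omega>"] H_const[OF uv s, of \<omega>]
      by (auto simp: indicator_def)
  qed
  then have "expectation (\<lambda>\<omega>. - rate r * (indicator A \<omega> * bump r (x \<omega>)) - 18 * r ^ 4 * (norm (H s \<omega> - \<sigma> s \<omega>))\<^sup>2)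
      \<le> expectation (\<lambda>\<omega>. indicator A \<omega> * bump_generator r c (H v \<omega>) (x \<omega>))"
    using int_bump integrable_sq_dist[OF st(1)] by (intro integral_mono_AE int_generator) auto
  then show ?thesis
    using int_bump integrable_sq_dist[OF st(1)] by (simp add: mean_sq_dist_def)
qed

lemma step_mult_expectation_generator_ge:
  fixes x :: "'a \<Rightarrow> real ^ 'm"
  assumes uv: "0 \<le> u" "u < v" "v \<le> T" "{u<..<v} \<inter> S = {}" and r: "r > 0"
    and meas: "A \<in> events" "x \<in> borel_measurable M"
  shows "- ((v - u) * (rate r * expectation (\<lambda>\<omega>. indicator A \<omega> * bump r (x \<omega>))))
      - 18 * r ^ 4 * (LINT s:{u<..v}|lborel. mean_sq_dist H \<sigma> s)
    \<le> (v - u) * expectation (\<lambda>\<omega>. indicator A \<omega> * bump_generator r c (H v \<omega>) (x \<omega>))"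
proof -
  define g where "g = expectation (\<lambda>\<omega>. indicator A \<omega> * bump_generator r c (H v \<omega>) (x \<omega>))
    + rate r * expectation (\<lambda>\<omega>. indicator A \<omega> * bump r (x \<omega>))"
  have "set_integrable lborel {u<..v} (mean_sq_dist H \<sigma>)"
    using uv by (intro set_integrable_mean_sq_dist) auto
  moreover have const: "set_integrable lborel {u<..v} (\<lambda>s. g)"
    using uv by (simp add: set_integrable_def)
  ultimately have "(LINT s:{u<..v}|lborel. - 18 * r ^ 4 * mean_sq_dist H \<sigma> s) \<le> (LINT s:{u<..v}|lborel. g)"
  proof (intro set_integral_mono set_integrable_mult_right)
    fix s assume "s \<in> {u<..v}"
    from expectation_generator_ge[OF uv this r meas] show "- 18 * r ^ 4 * mean_sq_dist H \<sigma> s \<le> g"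
      by (simp add: g_def)
  qed
  also have "\<dots> = (v - u) * g" using uv by (simp add: set_lebesgue_integral_def)
  finally have "- 18 * r ^ 4 * (LINT s:{u<..v}|lborel. mean_sq_dist H \<sigma> s) \<le> (v - u) * g"
    unfolding set_integral_mult_right .
  then show ?thesis unfolding g_def distrib_left by linarith
qed

lemma exp_expectation_bump_step:
  assumes uv: "0 \<le> u" "u < v" "v \<le> T" "{u<..<v} \<inter> S = {}" "v - u \<le> 1" and r: "r > 0"
    and A: "A \<in> sets (F u)" and B: "\<And>\<omega>. \<omega> \<in> space M \<Longrightarrow> norm (H v \<omega>) \<le> B"
  defines "\<Phi> \<equiv> \<lambda>t. expectation (\<lambda>\<omega>. indicator A \<omega> * bump r (Y t \<omega>))"
  shows "exp (rate r * u) * \<Phi> u \<le> exp (rate r * v) * (\<Phi> v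
      + 18 * r ^ 4 * (LINT s:{u<..v}|lborel. mean_sq_dist H \<sigma> s)
      + (drift_remainder r c * (1 + 2 * real CARD('n) ^ 4 * B ^ 3) + (rate r)\<^sup>2 * r ^ 6)
        * ((v - u) * sqrt (v - u)))"
proof -
  let ?\<delta> = "v - u" and ?E = "LINT s:{u<..v}|lborel. mean_sq_dist H \<sigma> s"
  let ?C = "drift_remainder r c * (1 + 2 * real CARD('n) ^ 4 * B ^ 3)"
  have times: "u \<in> {0..T}" "v \<in> {0..T}" using uv by auto
  have meas: "A \<in> events" "Y u \<in> borel_measurable M" "Y v \<in> borel_measurable M"
    using sets_F[OF times(1) A] measurable_F[OF times(1) Y_adapted] measurable_F[OF times(2) Y_adapted] times
    by auto
  have "\<Phi> u - ?\<delta> * (rate r * \<Phi> u) - 18 * r ^ 4 * ?E - ?C * (?\<delta> * sqrt ?\<delta>) \<le> \<Phi> v"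
    using expectation_bump_step_ge[OF uv(1-3,5) r c_nonneg A Y_adapted[OF times(1)] H_predictable[OF uv(1-4)] B
        meas(3) drift_le[OF uv(1-4)]]
      step_mult_expectation_generator_ge[OF uv(1-4) r meas(1,2)]
    unfolding \<Phi>_def by linarith
  moreover have "exp (- (rate r * ?\<delta>)) * \<Phi> u \<le> \<Phi> u - ?\<delta> * (rate r * \<Phi> u) + (rate r)\<^sup>2 * r ^ 6 * (?\<delta> * sqrt ?\<delta>)"
  proof (intro exp_minus_mult_le bump_rate_nonneg[OF \<epsilon>_pos])
    show "0 \<le> \<Phi> u" unfolding \<Phi>_def by (intro integral_nonneg_AE) auto
    have "\<Phi> u \<le> expectation (\<lambda>\<omega>. r ^ 6)"
      unfolding \<Phi>_def using meas r
      by (intro integral_mono integrable_indicator_mult_bump) (auto simp: indicator_def bump_le)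
    then show "\<Phi> u \<le> r ^ 6" by (simp add: prob_space)
  qed (use uv in auto)
  ultimately have "exp (- (rate r * ?\<delta>)) * \<Phi> u
      \<le> \<Phi> v + 18 * r ^ 4 * ?E + (?C + (rate r)\<^sup>2 * r ^ 6) * (?\<delta> * sqrt ?\<delta>)"
    by (simp add: distrib_right)
  then have "exp (rate r * v) * (exp (- (rate r * ?\<delta>)) * \<Phi> u)
      \<le> exp (rate r * v) * (\<Phi> v + 18 * r ^ 4 * ?E + (?C + (rate r)\<^sup>2 * r ^ 6) * (?\<delta> * sqrt ?\<delta>))"
    by (rule mult_left_mono) simp
  moreover have "exp (rate r * v) * exp (- (rate r * ?\<delta>)) = exp (rate r * u)"
    by (simp add: algebra_simps flip: exp_add)
  ultimately show ?thesis by (simp flip: mult.assoc)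
qed

lemma exp_bump_almost_submartingale:
  assumes st: "0 \<le> s" "s \<le> t" "t \<le> T" and A: "A \<in> sets (F s)" and r: "r > 0"
  shows "exp (rate r * s) * expectation (\<lambda>\<omega>. indicator A \<omega> * bump r (Y s \<omega>))
    \<le> exp (rate r * t) * expectation (\<lambda>\<omega>. indicator A \<omega> * bump r (Y t \<omega>))
      + exp (rate r * T) * (18 * r ^ 4 * (LINT s:{0..T}|lborel. mean_sq_dist H \<sigma> s))"
proof -
  define \<Phi> where "\<Phi> t = expectation (\<lambda>\<omega>. indicator A \<omega> * bump r (Y t \<omega>))" for t
  define E where "E v = (LINT s:{0..v}|lborel. mean_sq_dist H \<sigma> s)" for v
  define f where "f v = exp (rate r * v) * \<Phi> v + exp (rate r * T) * (18 * r ^ 4 * E v)" for v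
  obtain B where B: "\<And>s \<omega>. \<omega> \<in> space M \<Longrightarrow> norm (H s \<omega>) \<le> B" using H_bounded by blast
  obtain \<omega>\<^sub>0 where "\<omega>\<^sub>0 \<in> space M" using not_empty by auto
  then have B0: "B \<ge> 0" using B norm_ge_zero order_trans by blast
  define C where "C = drift_remainder r c * (1 + 2 * real CARD('n) ^ 4 * B ^ 3) + (rate r)\<^sup>2 * r ^ 6"
  have C: "C \<ge> 0"
    unfolding C_def using r c_nonneg B0
    by (intro add_nonneg_nonneg mult_nonneg_nonneg drift_remainder_nonneg) auto
  have "f s \<le> f t"
  proof (rule le_by_local_steps_with_error[OF finite_S st(2)])
    show "0 \<le> exp (rate r * T) * C" using C by simp
    fix u v assume uv: "s \<le> u" "u < v" "v \<le> t" "{u<..<v} \<inter> S = {}" "v - u \<le> 1"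
    let ?E = "LINT s:{u<..v}|lborel. mean_sq_dist H \<sigma> s"
    have "A \<in> sets (F u)" using sets_F_mono[of s u A] st uv A by auto
    then have "exp (rate r * u) * \<Phi> u
        \<le> exp (rate r * v) * (\<Phi> v + 18 * r ^ 4 * ?E + C * ((v - u) * sqrt (v - u)))"
      unfolding \<Phi>_def C_def using uv st by (intro exp_expectation_bump_step r B) auto
    also have "\<dots> = exp (rate r * v) * \<Phi> v + exp (rate r * v) * (18 * r ^ 4 * ?E + C * ((v - u) * sqrt (v - u)))"
      by (simp add: algebra_simps)
    also have "\<dots>
        \<le> exp (rate r * v) * \<Phi> v + exp (rate r * T) * (18 * r ^ 4 * ?E + C * ((v - u) * sqrt (v - u)))"
      using uv st r C integral_mean_sq_dist_nonneg[of _ H \<sigma>] bump_rate_nonneg[OF \<epsilon>_pos]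
      by (intro add_left_mono mult_right_mono) (auto intro!: mult_left_mono add_nonneg_nonneg)
    finally show "f u \<le> f v + exp (rate r * T) * C * ((v - u) * sqrt (v - u))"
      using integral_mean_sq_dist_add[of u v] uv st by (simp add: f_def E_def algebra_simps)
  qed
  moreover have "E t \<le> E T"
    using integral_mean_sq_dist_add[of t T] integral_mean_sq_dist_nonneg[of _ H \<sigma>] st
    by (simp add: E_def)
  then have "exp (rate r * T) * (18 * r ^ 4 * E t) \<le> exp (rate r * T) * (18 * r ^ 4 * E T)"
    using r by (intro mult_left_mono) auto
  moreover have "0 \<le> exp (rate r * T) * (18 * r ^ 4 * E s)"
    using integral_mean_sq_dist_nonneg[of _ H \<sigma>] r by (simp add: E_def)
  ultimately show ?thesis unfolding f_def \<Phi>_def E_def by linarith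
qed

end

subsection \<open>Elementary processes\<close>

lemma
  assumes "admissible_elem M F T m \<tau> h"
  shows admissible_elem_mono: "i \<le> j \<Longrightarrow> j \<le> m \<Longrightarrow> \<tau> i \<le> \<tau> j"
    and admissible_elem_time: "k \<le> m \<Longrightarrow> \<tau> k \<in> {0..T}"
proof -
  have a: "\<tau> 0 = 0" "\<tau> m = T" "\<And>k. k < m \<Longrightarrow> \<tau> k < \<tau> (Suc k)"
    using assms by (auto simp: admissible_elem_def)
  have mono: "\<tau> i \<le> \<tau> j" if "i \<le> j" "j \<le> m" for i j
    using that
  proof (induction rule: dec_induct)
    case (step k)
    then show ?case using a(3)[of k] by simp
  qed simp
  show "i \<le> j \<Longrightarrow> j \<le> m \<Longrightarrow> \<tau> i \<le> \<tau> j" by (rule mono)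
  show "k \<le> m \<Longrightarrow> \<tau> k \<in> {0..T}" using mono[of 0 k] mono[of k m] a by simp
qed

context
  fixes m :: nat and \<tau> :: "nat \<Rightarrow> real" and u v :: real
  assumes uv: "u < v" and free: "{u<..<v} \<inter> \<tau> ` {..m} = {}" and mono: "\<And>k. k < m \<Longrightarrow> \<tau> k < \<tau> (Suc k)"
begin

private lemma interval_cases:
  assumes "k < m"
  obtains "\<tau> k \<le> u" "v \<le> \<tau> (Suc k)" | "v \<le> \<tau> k" | "\<tau> (Suc k) \<le> u"
proof -
  have "\<tau> k \<notin> {u<..<v}" "\<tau> (Suc k) \<notin> {u<..<v}" using free assms by auto
  then show thesis using that by fastforce
qed

lemma elem_proc_const_between:
  assumes "s \<in> {u<..v}"
  shows "elem_proc m \<tau> h s \<omega> = elem_proc m \<tau> h v \<omega>"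
  unfolding elem_proc_def
proof (intro sum.cong refl)
  fix k assume "k \<in> {..<m}"
  then have k: "k < m" by simp
  show "h k \<omega> * indicator {\<tau> k<..\<tau> (Suc k)} s = h k \<omega> * indicator {\<tau> k<..\<tau> (Suc k)} v"
    by (rule interval_cases[OF k]) (use assms mono[OF k] uv in \<open>auto simp: indicator_def\<close>)
qed

lemma elem_int_increment:
  "elem_int B m \<tau> h v \<omega> - elem_int B m \<tau> h u \<omega> = elem_proc m \<tau> h v \<omega> * (B v \<omega> - B u \<omega>)"
  unfolding elem_int_def elem_proc_def sum_distrib_right sum_subtractf[symmetric]
proof (intro sum.cong refl)
  fix k assume "k \<in> {..<m}"
  then have k: "k < m" by simp
  show "h k \<omega> * (B (min v (\<tau> (Suc k))) \<omega> - B (min v (\<tau> k)) \<omega>)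
      - h k \<omega> * (B (min u (\<tau> (Suc k))) \<omega> - B (min u (\<tau> k)) \<omega>)
      = h k \<omega> * indicator {\<tau> k<..\<tau> (Suc k)} v * (B v \<omega> - B u \<omega>)"
    by (rule interval_cases[OF k]) (use mono[OF k] uv in \<open>auto simp: min_def indicator_def algebra_simps\<close>)
qed

end

lemma elem_proc_bounded:
  assumes "admissible_elem M F T m \<tau> h"
  shows "\<exists>C. \<forall>s. \<forall>\<omega>\<in>space M. \<bar>elem_proc m \<tau> h s \<omega>\<bar> \<le> C"
proof -
  obtain C where C: "\<And>k \<omega>. k < m \<Longrightarrow> \<omega> \<in> space M \<Longrightarrow> \<bar>h k \<omega>\<bar> \<le> C k"
    using assms unfolding admissible_elem_def by metis
  have "\<bar>elem_proc m \<tau> h s \<omega>\<bar> \<le> (\<Sum>k<m. C k)" if "\<omega> \<in> space M" for s \<omega>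
    unfolding elem_proc_def
  proof (rule order_trans[OF sum_abs], rule sum_mono)
    fix k assume "k \<in> {..<m}"
    then have "\<bar>h k \<omega>\<bar> \<le> C k" using C that by simp
    then show "\<bar>h k \<omega> * indicator {\<tau> k<..\<tau> (Suc k)} s\<bar> \<le> C k"
      by (cases "s \<in> {\<tau> k<..\<tau> (Suc k)}") auto
  qed
  then show ?thesis by blast
qed

context filtered_prob_space
begin

context
  fixes m :: nat and \<tau> :: "nat \<Rightarrow> real" and h :: "nat \<Rightarrow> 'a \<Rightarrow> real"
  assumes admissible: "admissible_elem M F T m \<tau> h"
begin

private lemma coefficient_measurable:
  assumes "k < m" "\<tau> k \<le> t" "t \<le> T"
  shows "h k \<in> borel_measurable (F t)"
proof (rule measurable_F_mono)
  show "h k \<in> borel_measurable (F (\<tau> k))" using admissible assms by (auto simp: admissible_elem_def)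
qed (use assms admissible_elem_time[OF admissible, of k] in auto)

lemma elem_int_adapted:
  assumes t: "t \<in> {0..T}" and B: "\<And>s. s \<in> {0..T} \<Longrightarrow> B s \<in> borel_measurable (F s)"
  shows "elem_int B m \<tau> h t \<in> borel_measurable (F t)"
proof -
  have "(\<lambda>\<omega>. h k \<omega> * (B (min t (\<tau> (Suc k))) \<omega> - B (min t (\<tau> k)) \<omega>)) \<in> borel_measurable (F t)" if "k < m" for k
  proof (cases "\<tau> k \<le> t")
    case True
    have "B (min t (\<tau> j)) \<in> borel_measurable (F t)" if "j \<le> m" for j
      using t admissible_elem_time[OF admissible that] by (intro measurable_F_mono[of "min t (\<tau> j)" t] B) auto
    then have "B (min t (\<tau> (Suc k))) \<in> borel_measurable (F t)" "B (min t (\<tau> k)) \<in> borel_measurable (F t)"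
      using \<open>k < m\<close> by auto
    moreover have "h k \<in> borel_measurable (F t)" using True t that by (intro coefficient_measurable) auto
    ultimately show ?thesis by measurable
  next
    case False
    then show ?thesis using admissible_elem_mono[OF admissible, of k "Suc k"] that by (simp add: min_def)
  qed
  then show ?thesis
    unfolding elem_int_def[abs_def] by (intro borel_measurable_sum) auto
qed

lemma elem_proc_predictable:
  assumes uv: "u < v" "v \<le> T" and free: "{u<..<v} \<inter> \<tau> ` {..m} = {}"
  shows "elem_proc m \<tau> h v \<in> borel_measurable (F u)"
proof -
  have "(\<lambda>\<omega>. h k \<omega> * indicator {\<tau> k<..\<tau> (Suc k)} v) \<in> borel_measurable (F u)" if "k < m" for k
  proof (cases "\<tau> k \<le> u")
    case True
    then have "h k \<in> borel_measurable (F u)" using uv that by (intro coefficient_measurable) auto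
    then show ?thesis by measurable
  next
    case False
    moreover have "\<tau> k \<notin> {u<..<v}" using free that by auto
    ultimately show ?thesis by simp
  qed
  then show ?thesis
    unfolding elem_proc_def[abs_def] by (intro borel_measurable_sum) auto
qed

lemma elem_proc_measurable: "(\<lambda>p. elem_proc m \<tau> h (fst p) (snd p)) \<in> borel_measurable time_space"
  unfolding elem_proc_def
proof (intro borel_measurable_sum)
  fix k assume "k \<in> {..<m}"
  then have [measurable]: "h k \<in> borel_measurable M"
    using admissible_elem_time[OF admissible, of k]
    by (intro measurable_F[OF _ coefficient_measurable[of k "\<tau> k"]]) auto
  have [measurable]: "indicator {\<tau> k<..\<tau> (Suc k)} \<in> borel_measurable (restrict_space lborel {0..T})"
    by (intro measurable_restrict_space1) auto
  show "(\<lambda>p. h k (snd p) * indicator {\<tau> k<..\<tau> (Suc k)} (fst p)) \<in> borel_measurable time_space"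
    by measurable
qed

end

lemma progressive_measurable:
  assumes "progressive M F T f"
  shows "(\<lambda>p. f (fst p) (snd p)) \<in> borel_measurable time_space"
proof -
  have T: "T \<in> {0..T}" using T_pos by simp
  then have "(\<lambda>p. f (fst p) (snd p)) \<in> borel_measurable (restrict_space borel {0..T} \<Otimes>\<^sub>M F T)"
    using assms by (auto simp: progressive_def split_beta')
  moreover have "(\<lambda>p. (fst p, snd p)) \<in> time_space \<rightarrow>\<^sub>M restrict_space borel {0..T} \<Otimes>\<^sub>M F T"
  proof (rule measurable_Pair)
    have "sets (restrict_space lborel {0..T}) = sets (restrict_space borel {0..T})"
      by (intro sets_restrict_space_cong) simp
    then show "fst \<in> time_space \<rightarrow>\<^sub>M restrict_space borel {0..T}"
      using measurable_fst measurable_cong_sets by blast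
    show "snd \<in> time_space \<rightarrow>\<^sub>M F T"
      by (rule measurable_compose[OF measurable_snd measurable_from_subalg[OF subalgebra_F[OF T]]]) simp
  qed
  ultimately have "(\<lambda>p. f (fst (fst p, snd p)) (snd (fst p, snd p))) \<in> borel_measurable time_space"
    by (rule measurable_compose[rotated])
  then show ?thesis by simp
qed

end

definition ito_approximation ::
  "'a measure \<Rightarrow> (real \<Rightarrow> 'a measure) \<Rightarrow> real \<Rightarrow> (real \<Rightarrow> 'a \<Rightarrow> real) \<Rightarrow> (real \<Rightarrow> 'a \<Rightarrow> real)
     \<Rightarrow> (real \<Rightarrow> 'a \<Rightarrow> real) \<Rightarrow> (nat \<Rightarrow> nat) \<Rightarrow> (nat \<Rightarrow> nat \<Rightarrow> real) \<Rightarrow> (nat \<Rightarrow> nat \<Rightarrow> 'a \<Rightarrow> real) \<Rightarrow> bool" where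
  "ito_approximation M F T B H I m \<tau> h \<longleftrightarrow>
     (\<forall>j. admissible_elem M F T (m j) (\<tau> j) (h j)) \<and>
     (\<lambda>j. \<integral>\<^sup>+ \<omega>. (\<integral>\<^sup>+ s. ennreal ((H s \<omega> - elem_proc (m j) (\<tau> j) (h j) s \<omega>)\<^sup>2)
              * indicator {0..T} s \<partial>lborel) \<partial>M) \<longlonglongrightarrow> 0 \<and>
     (\<forall>t\<in>{0..T}. (\<lambda>j. \<integral>\<^sup>+ \<omega>. ennreal ((I t \<omega> - elem_int B (m j) (\<tau> j) (h j) t \<omega>)\<^sup>2) \<partial>M) \<longlonglongrightarrow> 0)"

lemma is_ito_integral_iff:
  "is_ito_integral M F T B H I \<longleftrightarrow>
     (\<forall>t\<in>{0..T}. I t \<in> borel_measurable (F t)) \<and>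
     (AE \<omega> in M. continuous_on {0..T} (\<lambda>t. I t \<omega>)) \<and>
     (\<exists>m \<tau> h. ito_approximation M F T B H I m \<tau> h)"
  by (simp add: is_ito_integral_def ito_approximation_def)

subsection \<open>Approximation of Ito processes\<close>

lemma (in filtered_prob_space) set_integral_diff_abs_le:
  fixes f :: "real \<Rightarrow> real"
  assumes f: "f \<in> borel_measurable (restrict_space lborel {0..T})"
    and bound: "AE s in lborel. s \<in> {0..T} \<longrightarrow> \<bar>f s\<bar> \<le> C"
    and uv: "0 \<le> u" "u < v" "v \<le> T"
  shows "\<bar>(LINT s:{0..v}|lborel. f s) - (LINT s:{0..u}|lborel. f s)\<bar> \<le> C * (v - u)"
proof -
  have "integrable (restrict_space lborel {0..T}) f"
    using f bound by (intro time.integrable_const_bound[of _ C]) (simp_all add: AE_restrict_space_iff)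
  then have int: "set_integrable lborel {0..T} f"
    by (simp add: integrable_restrict_space set_integrable_def)
  have int_u: "set_integrable lborel {0..u} f" and int_uv: "set_integrable lborel {u<..v} f"
    using uv by (auto intro!: set_integrable_subset[OF int])
  have "{0..v} = {0..u} \<union> {u<..v}" "{0..u} \<inter> {u<..v} = {}" using uv by auto
  then have "(LINT s:{0..v}|lborel. f s) - (LINT s:{0..u}|lborel. f s) = (LINT s:{u<..v}|lborel. f s)"
    using set_integral_Un[OF _ int_u int_uv] by simp
  also have "\<bar>\<dots>\<bar> \<le> (LINT s:{u<..v}|lborel. C)"
    unfolding set_lebesgue_integral_def
  proof (rule order_trans[OF integral_abs_bound], rule integral_mono_AE)
    show "integrable lborel (\<lambda>s. \<bar>indicat_real {u<..v} s *\<^sub>R f s\<bar>)"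
      using int_uv unfolding set_integrable_def by (rule integrable_abs)
    show "integrable lborel (\<lambda>s. indicat_real {u<..v} s *\<^sub>R C)"
      using uv by (simp add: integrable_real_mult_indicator)
    show "AE s in lborel. \<bar>indicat_real {u<..v} s *\<^sub>R f s\<bar> \<le> indicat_real {u<..v} s *\<^sub>R C"
      using bound by eventually_elim (use uv in \<open>auto simp: indicator_def\<close>)
  qed
  also have "\<dots> = C * (v - u)" using uv by (simp add: set_lebesgue_integral_def)
  finally show ?thesis .
qed

lemma borel_measurable_vec_lambda_comp:
  fixes f :: "'n::finite \<Rightarrow> 'a \<Rightarrow> 'b::euclidean_space"
  assumes "\<And>i. f i \<in> borel_measurable N"
  shows "(\<lambda>\<omega>. \<chi> i. f i \<omega>) \<in> borel_measurable N"
proof (rule borel_measurable_euclidean_space[THEN iffD2], intro ballI)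
  fix b :: "'b ^ 'n" assume "b \<in> Basis"
  then obtain i u where b: "b = axis i u" by (auto simp: Basis_vec_def)
  show "(\<lambda>\<omega>. (\<chi> i. f i \<omega>) \<bullet> b) \<in> borel_measurable N"
    using assms[of i] unfolding b inner_axis by simp
qed

locale approximated_ito_process = filtered_brownian M F T W
  for M :: "'a measure" and F :: "real \<Rightarrow> 'a measure" and T :: real
    and W :: "real \<Rightarrow> 'a \<Rightarrow> real ^ 'n::finite" +
  fixes \<mu> :: "real \<Rightarrow> 'a \<Rightarrow> real ^ 'm::finite" and \<sigma> :: "real \<Rightarrow> 'a \<Rightarrow> real ^ 'n ^ 'm"
    and X :: "real \<Rightarrow> 'a \<Rightarrow> real ^ 'm" and I :: "'m \<Rightarrow> 'n \<Rightarrow> real \<Rightarrow> 'a \<Rightarrow> real"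
    and m :: "'m \<Rightarrow> 'n \<Rightarrow> nat \<Rightarrow> nat" and \<tau> :: "'m \<Rightarrow> 'n \<Rightarrow> nat \<Rightarrow> nat \<Rightarrow> real"
    and h :: "'m \<Rightarrow> 'n \<Rightarrow> nat \<Rightarrow> nat \<Rightarrow> 'a \<Rightarrow> real" and C :: real
  assumes \<mu>_measurable [measurable]: "(\<lambda>p. \<mu> (fst p) (snd p)) \<in> borel_measurable time_space"
    and \<sigma>_measurable [measurable]: "(\<lambda>p. \<sigma> (fst p) (snd p)) \<in> borel_measurable time_space"
    and \<mu>_bounded: "t \<in> {0..T} \<Longrightarrow> AE \<omega> in M. norm (\<mu> t \<omega>) \<le> C"
    and X_adapted: "t \<in> {0..T} \<Longrightarrow> X t \<in> borel_measurable (F t)"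
    and I_adapted: "t \<in> {0..T} \<Longrightarrow> I i \<nu> t \<in> borel_measurable (F t)"
    and approximation: "ito_approximation M F T (\<lambda>t \<omega>. W t \<omega> $ \<nu>)
      (\<lambda>t \<omega>. \<sigma> t \<omega> $ i $ \<nu>) (I i \<nu>) (m i \<nu>) (\<tau> i \<nu>) (h i \<nu>)"
    and X_eq: "t \<in> {0..T} \<Longrightarrow> AE \<omega> in M. \<forall>i.
      X t \<omega> $ i = X 0 \<omega> $ i + (LINT s:{0..t}|lborel. \<mu> s \<omega> $ i) + (\<Sum>\<nu>\<in>UNIV. I i \<nu> t \<omega>)"
begin

lemma admissible: "admissible_elem M F T (m i \<nu> j) (\<tau> i \<nu> j) (h i \<nu> j)"
  using approximation[of \<nu> i] by (simp add: ito_approximation_def)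

lemma C_nonneg: "0 \<le> C"
proof -
  have "AE \<omega> in M. norm (\<mu> 0 \<omega>) \<le> C" using T_pos by (intro \<mu>_bounded) auto
  then have "AE \<omega> in M. 0 \<le> C" by eventually_elim (rule order_trans[OF norm_ge_zero])
  then show ?thesis by simp
qed

lemma drift_increment_le:
  assumes uv: "0 \<le> u" "u < v" "v \<le> T"
  shows "AE \<omega> in M. \<forall>i. \<bar>(LINT s:{0..v}|lborel. \<mu> s \<omega> $ i) - (LINT s:{0..u}|lborel. \<mu> s \<omega> $ i)\<bar> \<le> C * (v - u)"
proof -
  have "AE s in restrict_space lborel {0..T}. AE \<omega> in M. norm (\<mu> s \<omega>) \<le> C"
    using \<mu>_bounded by (intro AE_I2[of "restrict_space lborel {0..T}"]) (auto simp: space_restrict_space)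
  then have "AE \<omega> in M. AE s in restrict_space lborel {0..T}. norm (\<mu> s \<omega>) \<le> C"
    by (subst (asm) time_space.AE_commute) (auto simp: split_beta')
  then have "AE \<omega> in M. AE s in lborel. s \<in> {0..T} \<longrightarrow> norm (\<mu> s \<omega>) \<le> C"
    by (simp add: AE_restrict_space_iff)
  then show ?thesis
  proof (rule AE_mp, intro AE_I2 impI allI)
    fix \<omega> i assume \<omega>: "\<omega> \<in> space M" and bound: "AE s in lborel. s \<in> {0..T} \<longrightarrow> norm (\<mu> s \<omega>) \<le> C"
    have "(\<lambda>s. \<mu> s \<omega> $ i) \<in> borel_measurable (restrict_space lborel {0..T})"
      using measurable_compose[OF measurable_Pair2'[OF \<omega>] \<mu>_measurable]
      by (auto intro: borel_measurable_vec_nth_comp)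
    moreover from bound have "AE s in lborel. s \<in> {0..T} \<longrightarrow> \<bar>\<mu> s \<omega> $ i\<bar> \<le> C"
      by eventually_elim (use component_le_norm_cart order_trans in blast)
    ultimately show "\<bar>(LINT s:{0..v}|lborel. \<mu> s \<omega> $ i) - (LINT s:{0..u}|lborel. \<mu> s \<omega> $ i)\<bar> \<le> C * (v - u)"
      using uv by (rule set_integral_diff_abs_le)
  qed
qed

definition H_elem :: "nat \<Rightarrow> real \<Rightarrow> 'a \<Rightarrow> real ^ 'n ^ 'm" where
  "H_elem j s \<omega> = (\<chi> i \<nu>. elem_proc (m i \<nu> j) (\<tau> i \<nu> j) (h i \<nu> j) s \<omega>)"

definition elem_ito :: "nat \<Rightarrow> 'm \<Rightarrow> 'n \<Rightarrow> real \<Rightarrow> 'a \<Rightarrow> real" where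
  "elem_ito j i \<nu> = elem_int (\<lambda>t \<omega>. W t \<omega> $ \<nu>) (m i \<nu> j) (\<tau> i \<nu> j) (h i \<nu> j)"

definition X_elem :: "nat \<Rightarrow> real \<Rightarrow> 'a \<Rightarrow> real ^ 'm" where
  "X_elem j t \<omega> = (\<chi> i. X t \<omega> $ i + (\<Sum>\<nu>\<in>UNIV. elem_ito j i \<nu> t \<omega> - I i \<nu> t \<omega>))"

definition grid :: "nat \<Rightarrow> real set" where
  "grid j = (\<Union>i. \<Union>\<nu>. \<tau> i \<nu> j ` {..m i \<nu> j})"

lemma elem_ito_adapted: "t \<in> {0..T} \<Longrightarrow> elem_ito j i \<nu> t \<in> borel_measurable (F t)"
  unfolding elem_ito_def by (intro elem_int_adapted[OF admissible]) (use W_adapted in measurable)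

lemma X_elem_adapted: "t \<in> {0..T} \<Longrightarrow> X_elem j t \<in> borel_measurable (F t)"
  unfolding X_elem_def[abs_def]
  by (intro borel_measurable_vec_lambda_comp borel_measurable_add borel_measurable_sum borel_measurable_diff
      borel_measurable_vec_nth_comp X_adapted I_adapted elem_ito_adapted)

lemma H_elem_measurable [measurable]: "(\<lambda>p. H_elem j (fst p) (snd p)) \<in> borel_measurable time_space"
  unfolding H_elem_def by (intro borel_measurable_vec_lambda_comp elem_proc_measurable[OF admissible])

lemma H_elem_bounded: "\<exists>B. \<forall>s. \<forall>\<omega>\<in>space M. norm (H_elem j s \<omega>) \<le> B"
proof -
  obtain B where B: "\<And>i \<nu> s \<omega>. \<omega> \<in> space M \<Longrightarrow> \<bar>elem_proc (m i \<nu> j) (\<tau> i \<nu> j) (h i \<nu> j) s \<omega>\<bar> \<le> B i \<nu>"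
    using elem_proc_bounded[OF admissible[of _ _ j]] by metis
  have "norm (H_elem j s \<omega>) \<le> (\<Sum>i\<in>UNIV. \<Sum>\<nu>\<in>UNIV. B i \<nu>)" if "\<omega> \<in> space M" for s \<omega>
  proof -
    have "norm (H_elem j s \<omega>) \<le> (\<Sum>i\<in>UNIV. norm (H_elem j s \<omega> $ i))"
      unfolding norm_vec_def[of "H_elem j s \<omega>"] by (rule L2_set_le_sum) simp
    also have "\<dots> \<le> (\<Sum>i\<in>UNIV. \<Sum>\<nu>\<in>UNIV. \<bar>H_elem j s \<omega> $ i $ \<nu>\<bar>)"
      by (intro sum_mono norm_le_l1_cart)
    also have "\<dots> \<le> (\<Sum>i\<in>UNIV. \<Sum>\<nu>\<in>UNIV. B i \<nu>)"
      using B[OF that] by (intro sum_mono) (simp add: H_elem_def)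
    finally show ?thesis .
  qed
  then show ?thesis by blast
qed

context
  fixes j :: nat and u v :: real
  assumes uv: "0 \<le> u" "u < v" "v \<le> T" and free: "{u<..<v} \<inter> grid j = {}"
begin

private lemma entry_free: "{u<..<v} \<inter> \<tau> i \<nu> j ` {..m i \<nu> j} = {}"
  using free by (auto simp: grid_def)

private lemma entry_mono: "k < m i \<nu> j \<Longrightarrow> \<tau> i \<nu> j k < \<tau> i \<nu> j (Suc k)"
  using admissible[of i \<nu> j] by (simp add: admissible_elem_def)

lemma H_elem_predictable: "H_elem j v \<in> borel_measurable (F u)"
  unfolding H_elem_def[abs_def]
  by (intro borel_measurable_vec_lambda_comp elem_proc_predictable[OF admissible uv(2,3) entry_free])

lemma H_elem_const:
  assumes "s \<in> {u<..v}"
  shows "H_elem j s \<omega> = H_elem j v \<omega>"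
  unfolding H_elem_def
  by (intro arg_cong[of _ _ vec_lambda] ext elem_proc_const_between[OF uv(2) entry_free entry_mono assms])

lemma X_elem_drift_le:
  "AE \<omega> in M. norm (X_elem j v \<omega> - X_elem j u \<omega> - H_elem j v \<omega> *v (W v \<omega> - W u \<omega>))
      \<le> real CARD('m) * C * (v - u)"
proof -
  have "u \<in> {0..T}" "v \<in> {0..T}" using uv by auto
  from X_eq[OF this(1)] X_eq[OF this(2)] drift_increment_le[OF uv] show ?thesis
  proof eventually_elim
    case (elim \<omega>)
    define Y where "Y = X_elem j v \<omega> - X_elem j u \<omega> - H_elem j v \<omega> *v (W v \<omega> - W u \<omega>)"
    have "\<bar>Y $ i\<bar> \<le> C * (v - u)" for i
    proof -
      have "elem_ito j i \<nu> v \<omega> - elem_ito j i \<nu> u \<omega> = H_elem j v \<omega> $ i $ \<nu> * (W v \<omega> - W u \<omega>) $ \<nu>" for \<nu>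
        using elem_int_increment[OF uv(2) entry_free entry_mono, where B = "\<lambda>t \<omega>. W t \<omega> $ \<nu>"]
        by (simp add: elem_ito_def H_elem_def)
      then have "(H_elem j v \<omega> *v (W v \<omega> - W u \<omega>)) $ i = (\<Sum>\<nu>\<in>UNIV. elem_ito j i \<nu> v \<omega> - elem_ito j i \<nu> u \<omega>)"
        by (simp add: matrix_vector_mult_def)
      then have "Y $ i = X v \<omega> $ i - X u \<omega> $ i - (\<Sum>\<nu>\<in>UNIV. I i \<nu> v \<omega>) + (\<Sum>\<nu>\<in>UNIV. I i \<nu> u \<omega>)"
        unfolding Y_def X_elem_def by (simp add: sum_subtractf)
      also have "\<dots> = (LINT s:{0..v}|lborel. \<mu> s \<omega> $ i) - (LINT s:{0..u}|lborel. \<mu> s \<omega> $ i)"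
        using elim by simp
      finally show ?thesis using elim by simp
    qed
    then have "(\<Sum>i\<in>UNIV. \<bar>Y $ i\<bar>) \<le> (\<Sum>i\<in>(UNIV :: 'm set). C * (v - u))" by (intro sum_mono)
    then show ?case using norm_le_l1_cart[of Y] by (simp add: Y_def)
  qed
qed

end

lemma simple_ito_process_elem: "simple_ito_process M F T W (X_elem j) (H_elem j) (grid j) (real CARD('m) * C)"
proof
  show "finite (grid j)" by (simp add: grid_def)
  show "0 \<le> real CARD('m) * C" using C_nonneg by simp
qed (fact X_elem_adapted H_elem_measurable H_elem_bounded H_elem_predictable H_elem_const X_elem_drift_le)+

end

lemma ennreal_tendsto_0_le:
  fixes f g :: "nat \<Rightarrow> ennreal"
  assumes "\<And>j. f j \<le> g j" "g \<longlonglongrightarrow> 0"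
  shows "f \<longlonglongrightarrow> 0"
  by (rule tendsto_sandwich[OF _ _ tendsto_const assms(2)]) (simp_all add: assms(1))

lemma (in prob_space) nn_integral_abs_tendsto_0:
  fixes Y :: "nat \<Rightarrow> 'a \<Rightarrow> real"
  assumes [measurable]: "\<And>j. Y j \<in> borel_measurable M"
    and lim: "(\<lambda>j. \<integral>\<^sup>+ \<omega>. ennreal ((Y j \<omega>)\<^sup>2) \<partial>M) \<longlonglongrightarrow> 0"
  shows "(\<lambda>j. \<integral>\<^sup>+ \<omega>. ennreal \<bar>Y j \<omega>\<bar> \<partial>M) \<longlonglongrightarrow> 0"
proof (rule order_tendstoI)
  fix a :: ennreal assume "0 < a"
  then have "\<forall>\<^sub>F j in sequentially. (\<integral>\<^sup>+ \<omega>. ennreal ((Y j \<omega>)\<^sup>2) \<partial>M) < a\<^sup>2"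
    by (intro order_tendstoD[OF lim]) (simp add: zero_less_iff_neq_zero)
  then show "\<forall>\<^sub>F j in sequentially. (\<integral>\<^sup>+ \<omega>. ennreal \<bar>Y j \<omega>\<bar> \<partial>M) < a"
  proof eventually_elim
    case (elim j)
    let ?y = "\<integral>\<^sup>+ \<omega>. ennreal \<bar>Y j \<omega>\<bar> \<partial>M"
    have "?y\<^sup>2 \<le> (\<integral>\<^sup>+ \<omega>. ennreal ((Y j \<omega>)\<^sup>2) \<partial>M)"
      using Cauchy_Schwarz_nn_integral[of "\<lambda>\<omega>. ennreal \<bar>Y j \<omega>\<bar>" M "\<lambda>_. 1"]
      by (simp add: ennreal_power emeasure_space_1)
    with elim have "\<not> a\<^sup>2 \<le> ?y\<^sup>2" by simp
    then show ?case using mult_mono[of a ?y a ?y] unfolding power2_eq_square not_le[symmetric] by auto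
  qed
qed simp

lemma (in prob_space) tendsto_expectation_lipschitz:
  fixes Y :: "nat \<Rightarrow> 'a \<Rightarrow> 'b::euclidean_space" and f :: "'b \<Rightarrow> real"
  assumes f: "L-lipschitz_on UNIV f"
    and [measurable]: "A \<in> events" "\<And>j. Y j \<in> borel_measurable M" "Z \<in> borel_measurable M"
    and int: "\<And>j. integrable M (\<lambda>\<omega>. indicator A \<omega> * f (Y j \<omega>))" "integrable M (\<lambda>\<omega>. indicator A \<omega> * f (Z \<omega>))"
    and lim: "(\<lambda>j. \<integral>\<^sup>+ \<omega>. ennreal (norm (Y j \<omega> - Z \<omega>)) \<partial>M) \<longlonglongrightarrow> 0"
  shows "(\<lambda>j. expectation (\<lambda>\<omega>. indicator A \<omega> * f (Y j \<omega>))) \<longlonglongrightarrow> expectation (\<lambda>\<omega>. indicator A \<omega> * f (Z \<omega>))"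
proof (rule tendsto_L1_int[OF int])
  have "(\<integral>\<^sup>+ \<omega>. ennreal (norm (indicator A \<omega> * f (Y j \<omega>) - indicator A \<omega> * f (Z \<omega>))) \<partial>M)
      \<le> ennreal L * (\<integral>\<^sup>+ \<omega>. ennreal (norm (Y j \<omega> - Z \<omega>)) \<partial>M)" for j
  proof -
    have "(\<integral>\<^sup>+ \<omega>. ennreal (norm (indicator A \<omega> * f (Y j \<omega>) - indicator A \<omega> * f (Z \<omega>))) \<partial>M)
        \<le> (\<integral>\<^sup>+ \<omega>. ennreal (L * norm (Y j \<omega> - Z \<omega>)) \<partial>M)"
      using lipschitz_on_normD[OF f] lipschitz_on_nonneg[OF f]
      by (intro nn_integral_mono ennreal_leI) (auto simp: indicator_def)
    also have "\<dots> = ennreal L * (\<integral>\<^sup>+ \<omega>. ennreal (norm (Y j \<omega> - Z \<omega>)) \<partial>M)"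
      using lipschitz_on_nonneg[OF f] by (simp add: ennreal_mult' nn_integral_cmult)
    finally show ?thesis .
  qed
  moreover have "(\<lambda>j. ennreal L * (\<integral>\<^sup>+ \<omega>. ennreal (norm (Y j \<omega> - Z \<omega>)) \<partial>M)) \<longlonglongrightarrow> ennreal L * 0"
    by (intro ennreal_tendsto_cmult lim) simp
  then have "(\<lambda>j. ennreal L * (\<integral>\<^sup>+ \<omega>. ennreal (norm (Y j \<omega> - Z \<omega>)) \<partial>M)) \<longlonglongrightarrow> 0" by simp
  ultimately show "(\<lambda>j. \<integral>\<^sup>+ \<omega>. ennreal (norm (indicator A \<omega> * f (Y j \<omega>) - indicator A \<omega> * f (Z \<omega>))) \<partial>M) \<longlonglongrightarrow> 0"
    by (rule ennreal_tendsto_0_le)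
qed

context approximated_ito_process
begin

lemma integrand_tendsto:
  "(\<lambda>j. \<integral>\<^sup>+ \<omega>. (\<integral>\<^sup>+ s. ennreal ((\<sigma> s \<omega> $ i $ \<nu> - elem_proc (m i \<nu> j) (\<tau> i \<nu> j) (h i \<nu> j) s \<omega>)\<^sup>2)
     * indicator {0..T} s \<partial>lborel) \<partial>M) \<longlonglongrightarrow> 0"
  using approximation[of \<nu> i] unfolding ito_approximation_def by blast

lemma elem_ito_tendsto:
  "t \<in> {0..T} \<Longrightarrow> (\<lambda>j. \<integral>\<^sup>+ \<omega>. ennreal ((I i \<nu> t \<omega> - elem_ito j i \<nu> t \<omega>)\<^sup>2) \<partial>M) \<longlonglongrightarrow> 0"
  using approximation[of \<nu> i] unfolding elem_ito_def ito_approximation_def by blast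

lemma nn_integral_H_elem_sq_dist_tendsto:
  "(\<lambda>j. \<integral>\<^sup>+ p. ennreal ((norm (H_elem j (fst p) (snd p) - \<sigma> (fst p) (snd p)))\<^sup>2) \<partial>time_space) \<longlonglongrightarrow> 0"
proof -
  define e where "e i \<nu> j s \<omega> = ennreal ((\<sigma> s \<omega> $ i $ \<nu> - elem_proc (m i \<nu> j) (\<tau> i \<nu> j) (h i \<nu> j) s \<omega>)\<^sup>2)"
    for i \<nu> j s \<omega>
  have [measurable]: "(\<lambda>p. e i \<nu> j (fst p) (snd p)) \<in> borel_measurable time_space" for i \<nu> j
    unfolding e_def using elem_proc_measurable[OF admissible] by measurable
  have sq_dist: "ennreal ((norm (H_elem j s \<omega> - \<sigma> s \<omega>))\<^sup>2) = (\<Sum>i\<in>UNIV. \<Sum>\<nu>\<in>UNIV. e i \<nu> j s \<omega>)" for j s \<omega>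
    unfolding norm_matrix_sq
    by (simp add: e_def norm_vec_def L2_set_def sum_nonneg H_elem_def power2_commute sum_ennreal)
  have "(\<integral>\<^sup>+ p. e i \<nu> j (fst p) (snd p) \<partial>time_space)
      = (\<integral>\<^sup>+ \<omega>. (\<integral>\<^sup>+ s. e i \<nu> j s \<omega> * indicator {0..T} s \<partial>lborel) \<partial>M)" for i \<nu> j
    by (subst time_space.nn_integral_snd[symmetric]) (auto simp: nn_integral_restrict_space)
  then have "(\<integral>\<^sup>+ p. ennreal ((norm (H_elem j (fst p) (snd p) - \<sigma> (fst p) (snd p)))\<^sup>2) \<partial>time_space)
      = (\<Sum>i\<in>UNIV. \<Sum>\<nu>\<in>UNIV. \<integral>\<^sup>+ \<omega>. (\<integral>\<^sup>+ s. e i \<nu> j s \<omega> * indicator {0..T} s \<partial>lborel) \<partial>M)" for j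
    unfolding sq_dist by (simp add: nn_integral_sum)
  moreover have "(\<lambda>j. \<Sum>i\<in>UNIV. \<Sum>\<nu>\<in>UNIV. \<integral>\<^sup>+ \<omega>. (\<integral>\<^sup>+ s. e i \<nu> j s \<omega> * indicator {0..T} s \<partial>lborel) \<partial>M)
      \<longlonglongrightarrow> (\<Sum>i\<in>(UNIV :: 'm set). \<Sum>\<nu>\<in>(UNIV :: 'n set). 0)"
    unfolding e_def by (intro tendsto_sum integrand_tendsto)
  ultimately show ?thesis by simp
qed

lemma integral_mean_sq_dist_tendsto:
  "(\<lambda>j. LINT s:{0..T}|lborel. mean_sq_dist (H_elem j) \<sigma> s) \<longlonglongrightarrow> 0"
proof -
  let ?e = "\<lambda>j s \<omega>. ennreal ((norm (H_elem j s \<omega> - \<sigma> s \<omega>))\<^sup>2)"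
  let ?R = "restrict_space lborel {0..T}"
  have "(LINT s:{0..T}|lborel. mean_sq_dist (H_elem j) \<sigma> s) = (\<integral>s. mean_sq_dist (H_elem j) \<sigma> s \<partial>?R)" for j
    by (simp add: integral_restrict_space set_lebesgue_integral_def)
  also have "\<dots> j = enn2real (\<integral>\<^sup>+ s. ennreal (mean_sq_dist (H_elem j) \<sigma> s) \<partial>?R)" for j
    unfolding mean_sq_dist_def by (intro integral_eq_nn_integral AE_I2 integral_nonneg_AE) auto
  finally have integral_eq: "(LINT s:{0..T}|lborel. mean_sq_dist (H_elem j) \<sigma> s)
    = enn2real (\<integral>\<^sup>+ s. ennreal (mean_sq_dist (H_elem j) \<sigma> s) \<partial>?R)" for j .
  have "(\<integral>\<^sup>+ s. ennreal (mean_sq_dist (H_elem j) \<sigma> s) \<partial>?R) \<le> (\<integral>\<^sup>+ p. ?e j (fst p) (snd p) \<partial>time_space)" for j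
  proof -
    have "ennreal (mean_sq_dist (H_elem j) \<sigma> s) \<le> (\<integral>\<^sup>+ \<omega>. ?e j s \<omega> \<partial>M)" if "s \<in> {0..T}" for s
    proof -
      have [measurable]: "H_elem j s \<in> borel_measurable M" "\<sigma> s \<in> borel_measurable M"
        using that
        by (auto intro: time_section_measurable[OF H_elem_measurable]
            time_section_measurable[OF \<sigma>_measurable])
      have "mean_sq_dist (H_elem j) \<sigma> s = enn2real (\<integral>\<^sup>+ \<omega>. ?e j s \<omega> \<partial>M)"
        unfolding mean_sq_dist_def by (rule integral_eq_nn_integral) auto
      then show ?thesis by (simp add: ennreal_enn2real_if)
    qed
    then have "(\<integral>\<^sup>+ s. ennreal (mean_sq_dist (H_elem j) \<sigma> s) \<partial>?R) \<le> (\<integral>\<^sup>+ s. (\<integral>\<^sup>+ \<omega>. ?e j s \<omega> \<partial>M) \<partial>?R)"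
      by (intro nn_integral_mono) (simp add: space_restrict_space)
    also have "\<dots> = (\<integral>\<^sup>+ p. ?e j (fst p) (snd p) \<partial>time_space)"
      by (subst nn_integral_fst[symmetric]) auto
    finally show ?thesis .
  qed
  then have "(\<lambda>j. \<integral>\<^sup>+ s. ennreal (mean_sq_dist (H_elem j) \<sigma> s) \<partial>?R) \<longlonglongrightarrow> 0"
    by (rule ennreal_tendsto_0_le[OF _ nn_integral_H_elem_sq_dist_tendsto])
  then show ?thesis
    unfolding integral_eq by (intro tendsto_enn2real) simp_all
qed

lemma nn_integral_X_elem_dist_tendsto:
  assumes t: "t \<in> {0..T}"
  shows "(\<lambda>j. \<integral>\<^sup>+ \<omega>. ennreal (norm (X_elem j t \<omega> - X t \<omega>)) \<partial>M) \<longlonglongrightarrow> 0"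
proof -
  define e where "e i \<nu> j \<omega> = I i \<nu> t \<omega> - elem_ito j i \<nu> t \<omega>" for i \<nu> j \<omega>
  have [measurable]: "e i \<nu> j \<in> borel_measurable M" for i \<nu> j
    unfolding e_def by (intro borel_measurable_diff measurable_F[OF t] I_adapted elem_ito_adapted t)
  have norm_le: "norm (X_elem j t \<omega> - X t \<omega>) \<le> (\<Sum>i\<in>UNIV. \<Sum>\<nu>\<in>UNIV. \<bar>e i \<nu> j \<omega>\<bar>)" for j \<omega>
  proof -
    have "(X_elem j t \<omega> - X t \<omega>) $ i = - (\<Sum>\<nu>\<in>UNIV. e i \<nu> j \<omega>)" for i
      by (simp add: X_elem_def e_def flip: sum_negf)
    then have "\<bar>(X_elem j t \<omega> - X t \<omega>) $ i\<bar> \<le> (\<Sum>\<nu>\<in>UNIV. \<bar>e i \<nu> j \<omega>\<bar>)" for i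
      by (metis abs_minus_cancel sum_abs)
    then show ?thesis
      using norm_le_l1_cart[of "X_elem j t \<omega> - X t \<omega>"] by (meson order_trans sum_mono)
  qed
  have "(\<integral>\<^sup>+ \<omega>. ennreal (norm (X_elem j t \<omega> - X t \<omega>)) \<partial>M)
      \<le> (\<Sum>i\<in>UNIV. \<Sum>\<nu>\<in>UNIV. \<integral>\<^sup>+ \<omega>. ennreal \<bar>e i \<nu> j \<omega>\<bar> \<partial>M)" for j
  proof -
    have "(\<integral>\<^sup>+ \<omega>. ennreal (norm (X_elem j t \<omega> - X t \<omega>)) \<partial>M)
        \<le> (\<integral>\<^sup>+ \<omega>. (\<Sum>i\<in>UNIV. \<Sum>\<nu>\<in>UNIV. ennreal \<bar>e i \<nu> j \<omega>\<bar>) \<partial>M)"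
      using ennreal_leI[OF norm_le] by (intro nn_integral_mono) (simp add: sum_nonneg)
    then show ?thesis by (simp add: nn_integral_sum del: sum_ennreal)
  qed
  moreover have "(\<lambda>j. \<Sum>i\<in>UNIV. \<Sum>\<nu>\<in>UNIV. \<integral>\<^sup>+ \<omega>. ennreal \<bar>e i \<nu> j \<omega>\<bar> \<partial>M)
      \<longlonglongrightarrow> (\<Sum>i\<in>(UNIV :: 'm set). \<Sum>\<nu>\<in>(UNIV :: 'n set). 0)"
  proof (intro tendsto_sum nn_integral_abs_tendsto_0)
    show "(\<lambda>j. \<integral>\<^sup>+ \<omega>. ennreal ((e i \<nu> j \<omega>)\<^sup>2) \<partial>M) \<longlonglongrightarrow> 0" for i \<nu>
      unfolding e_def by (rule elem_ito_tendsto[OF t])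
  qed measurable
  then have "(\<lambda>j. \<Sum>i\<in>UNIV. \<Sum>\<nu>\<in>UNIV. \<integral>\<^sup>+ \<omega>. ennreal \<bar>e i \<nu> j \<omega>\<bar> \<partial>M) \<longlonglongrightarrow> 0" by simp
  ultimately show ?thesis by (rule ennreal_tendsto_0_le)
qed

end

lemma (in simple_ito_process) simple_ito_process_minus_lipschitz:
  assumes p: "L-lipschitz_on {0..T} p"
  shows "simple_ito_process M F T W (\<lambda>t \<omega>. Y t \<omega> - p t) H S (c + L)"
proof
  show "0 \<le> c + L" using c_nonneg lipschitz_on_nonneg[OF p] by simp
  show "(\<lambda>\<omega>. Y t \<omega> - p t) \<in> borel_measurable (F t)" if "t \<in> {0..T}" for t
    using Y_adapted[OF that] by measurable
  fix u v :: real assume uv: "0 \<le> u" "u < v" "v \<le> T" "{u<..<v} \<inter> S = {}"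
  from drift_le[OF uv]
  show "AE \<omega> in M. norm (Y v \<omega> - p v - (Y u \<omega> - p u) - H v \<omega> *v (W v \<omega> - W u \<omega>)) \<le> (c + L) * (v - u)"
  proof eventually_elim
    case (elim \<omega>)
    have "norm (p v - p u) \<le> L * (v - u)"
      using lipschitz_on_normD[OF p, of v u] uv by simp
    moreover have regroup: "Y v \<omega> - p v - (Y u \<omega> - p u) - H v \<omega> *v (W v \<omega> - W u \<omega>)
        = (Y v \<omega> - Y u \<omega> - H v \<omega> *v (W v \<omega> - W u \<omega>)) - (p v - p u)"
      by simp
    ultimately show ?case
      using elim norm_triangle_ineq4[of "Y v \<omega> - Y u \<omega> - H v \<omega> *v (W v \<omega> - W u \<omega>)" "p v - p u"]
      unfolding regroup distrib_right by linarith
  qed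
qed (fact finite_S H_measurable H_bounded H_predictable H_const)+

locale elliptic_ito_process =
  approximated_ito_process M F T W \<mu> \<sigma> X I m \<tau> h C + elliptic_diffusion M F T W \<sigma> \<epsilon> N
  for M :: "'a measure" and F :: "real \<Rightarrow> 'a measure" and T :: real
    and W :: "real \<Rightarrow> 'a \<Rightarrow> real ^ 'n::finite"
    and \<mu> :: "real \<Rightarrow> 'a \<Rightarrow> real ^ 'm::finite" and \<sigma> :: "real \<Rightarrow> 'a \<Rightarrow> real ^ 'n ^ 'm"
    and X :: "real \<Rightarrow> 'a \<Rightarrow> real ^ 'm" and I :: "'m \<Rightarrow> 'n \<Rightarrow> real \<Rightarrow> 'a \<Rightarrow> real"
    and m :: "'m \<Rightarrow> 'n \<Rightarrow> nat \<Rightarrow> nat" and \<tau> :: "'m \<Rightarrow> 'n \<Rightarrow> nat \<Rightarrow> nat \<Rightarrow> real"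
    and h :: "'m \<Rightarrow> 'n \<Rightarrow> nat \<Rightarrow> nat \<Rightarrow> 'a \<Rightarrow> real" and C \<epsilon> N :: real
begin

lemma expectation_bump_X_elem_tendsto:
  assumes t: "t \<in> {0..T}" and A: "A \<in> events" and r: "r > 0"
  shows "(\<lambda>j. expectation (\<lambda>\<omega>. indicator A \<omega> * bump r (X_elem j t \<omega> - p t)))
    \<longlonglongrightarrow> expectation (\<lambda>\<omega>. indicator A \<omega> * bump r (X t \<omega> - p t))"
proof -
  have [measurable]: "X t \<in> borel_measurable M" "X_elem j t \<in> borel_measurable M" for j
    by (auto intro!: measurable_F[OF t] X_adapted X_elem_adapted t)
  show ?thesis
    using nn_integral_X_elem_dist_tendsto[OF t] A
    by (intro tendsto_expectation_lipschitz[OF bump_lipschitz_on[OF r]] integrable_indicator_mult_bump)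
      simp_all
qed

lemma exp_bump_X_elem_almost_submartingale:
  assumes st: "0 \<le> s" "s \<le> t" "t \<le> T" and A: "A \<in> sets (F s)" and r: "r > 0"
    and p: "L-lipschitz_on {0..T} p"
  defines "rate \<equiv> bump_rate \<epsilon> N r (real CARD('m) * C + L)"
  shows "exp (rate * s) * expectation (\<lambda>\<omega>. indicator A \<omega> * bump r (X_elem j s \<omega> - p s))
    \<le> exp (rate * t) * expectation (\<lambda>\<omega>. indicator A \<omega> * bump r (X_elem j t \<omega> - p t))
      + exp (rate * T) * (18 * r ^ 4 * (LINT s:{0..T}|lborel. mean_sq_dist (H_elem j) \<sigma> s))"
proof -
  let ?Y = "\<lambda>t \<omega>. X_elem j t \<omega> - p t" and ?c = "real CARD('m) * C + L"
  interpret simple: simple_ito_process M F T W ?Y "H_elem j" "grid j" ?c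
    by (rule simple_ito_process.simple_ito_process_minus_lipschitz[OF simple_ito_process_elem p])
  interpret elliptic_simple_ito_process M F T W ?Y "H_elem j" "grid j" ?c \<sigma> \<epsilon> N
    by unfold_locales
  show ?thesis unfolding rate_def by (rule exp_bump_almost_submartingale[OF st A r])
qed

lemma exp_bump_submartingale:
  assumes st: "0 \<le> s" "s \<le> t" "t \<le> T" and A: "A \<in> sets (F s)" and r: "r > 0"
    and p: "L-lipschitz_on {0..T} p"
  defines "rate \<equiv> bump_rate \<epsilon> N r (real CARD('m) * C + L)"
  shows "exp (rate * s) * expectation (\<lambda>\<omega>. indicator A \<omega> * bump r (X s \<omega> - p s))
    \<le> exp (rate * t) * expectation (\<lambda>\<omega>. indicator A \<omega> * bump r (X t \<omega> - p t))"
proof -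
  define \<Phi> where "\<Phi> j u = expectation (\<lambda>\<omega>. indicator A \<omega> * bump r (X_elem j u \<omega> - p u))" for j u
  define error where
    "error j = exp (rate * T) * (18 * r ^ 4 * (LINT s:{0..T}|lborel. mean_sq_dist (H_elem j) \<sigma> s))" for j
  have times: "s \<in> {0..T}" "t \<in> {0..T}" using st by auto
  have \<Phi>_tendsto: "(\<lambda>j. \<Phi> j u) \<longlonglongrightarrow> expectation (\<lambda>\<omega>. indicator A \<omega> * bump r (X u \<omega> - p u))"
    if "u \<in> {0..T}" for u
    unfolding \<Phi>_def by (rule expectation_bump_X_elem_tendsto[OF that sets_F[OF times(1) A] r])
  have "error \<longlonglongrightarrow> 0"
    unfolding error_def[abs_def] by (intro tendsto_mult_right_zero integral_mean_sq_dist_tendsto)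
  then have "(\<lambda>j. exp (rate * t) * \<Phi> j t + error j)
      \<longlonglongrightarrow> exp (rate * t) * expectation (\<lambda>\<omega>. indicator A \<omega> * bump r (X t \<omega> - p t)) + 0"
    by (intro tendsto_add tendsto_mult_left \<Phi>_tendsto times)
  moreover have "(\<lambda>j. exp (rate * s) * \<Phi> j s)
      \<longlonglongrightarrow> exp (rate * s) * expectation (\<lambda>\<omega>. indicator A \<omega> * bump r (X s \<omega> - p s))"
    by (intro tendsto_mult_left \<Phi>_tendsto times)
  moreover have "exp (rate * s) * \<Phi> j s \<le> exp (rate * t) * \<Phi> j t + error j" for j
    unfolding \<Phi>_def error_def rate_def by (rule exp_bump_X_elem_almost_submartingale[OF st A r p])
  ultimately have "exp (rate * s) * expectation (\<lambda>\<omega>. indicator A \<omega> * bump r (X s \<omega> - p s))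
      \<le> exp (rate * t) * expectation (\<lambda>\<omega>. indicator A \<omega> * bump r (X t \<omega> - p t)) + 0"
    by (rule tendsto_le[OF sequentially_bot _ _ always_eventually[OF allI]])
  then show ?thesis by simp
qed

end

subsection \<open>Submartingales that stay positive\<close>

lemma (in prob_space) prob_Ball_countable_ge:
  assumes Q: "countable Q" and [measurable]: "A \<in> events" "\<And>s. s \<in> Q \<Longrightarrow> Measurable.pred M (P s)"
    and finite: "\<And>S. finite S \<Longrightarrow> S \<subseteq> Q \<Longrightarrow> a \<le> prob {\<omega> \<in> A. \<forall>s\<in>S. P s \<omega>}"
  shows "a \<le> prob {\<omega> \<in> A. \<forall>s\<in>Q. P s \<omega>}"
proof (cases "Q = {}")
  case True
  then show ?thesis using finite[of "{}"] by simp
next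
  case False
  define e where "e = from_nat_into Q"
  have e: "range e = Q" unfolding e_def by (rule range_from_nat_into[OF False Q])
  define D where "D n = {\<omega> \<in> A. \<forall>s\<in>e ` {..<n}. P s \<omega>}" for n
  have "D n \<in> events" for n
  proof -
    have "{\<omega> \<in> space M. \<forall>s\<in>e ` {..<n}. P s \<omega>} \<in> events"
      using e by (intro sets.sets_Collect_finite_All) (auto intro: predE)
    moreover have "D n = A \<inter> {\<omega> \<in> space M. \<forall>s\<in>e ` {..<n}. P s \<omega>}"
      using sets.sets_into_space[OF \<open>A \<in> events\<close>] by (auto simp: D_def)
    ultimately show ?thesis by simp
  qed
  then have "(\<lambda>n. prob (D n)) \<longlonglongrightarrow> prob (\<Inter>n. D n)"
    by (intro finite_Lim_measure_decseq) (auto simp: decseq_def D_def)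
  moreover have "a \<le> prob (D n)" for n
    unfolding D_def using e by (intro finite) auto
  ultimately have "a \<le> prob (\<Inter>n. D n)"
    by (intro tendsto_lowerbound) auto
  also have "(\<Inter>n. D n) = {\<omega> \<in> A. \<forall>s\<in>Q. P s \<omega>}"
    unfolding D_def e[symmetric] by auto
  finally show ?thesis .
qed

locale bounded_submartingale = filtered_prob_space M F T
  for M :: "'a measure" and F :: "real \<Rightarrow> 'a measure" and T :: real +
  fixes V :: "real \<Rightarrow> 'a \<Rightarrow> real" and K :: real
  assumes V_adapted: "t \<in> {0..T} \<Longrightarrow> V t \<in> borel_measurable (F t)"
    and V_nonneg: "0 \<le> V t \<omega>"
    and V_bounded: "t \<in> {0..T} \<Longrightarrow> V t \<omega> \<le> K"
    and V_submartingale: "0 \<le> s \<Longrightarrow> s \<le> t \<Longrightarrow> t \<le> T \<Longrightarrow> A \<in> sets (F s) \<Longrightarrow>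
      expectation (\<lambda>\<omega>. indicator A \<omega> * V s \<omega>) \<le> expectation (\<lambda>\<omega>. indicator A \<omega> * V t \<omega>)"
begin

lemma V_measurable: "t \<in> {0..T} \<Longrightarrow> V t \<in> borel_measurable M"
  using V_adapted measurable_F by blast

lemma integrable_indicator_mult_V:
  assumes "A \<in> events" "t \<in> {0..T}"
  shows "integrable M (\<lambda>\<omega>. indicator A \<omega> * V t \<omega>)"
proof (rule integrable_const_bound[OF AE_I2])
  show "norm (indicator A \<omega> * V t \<omega>) \<le> K" for \<omega>
    using V_nonneg[of t \<omega>] V_bounded[OF assms(2), of \<omega>] by (auto simp: indicator_def)
  show "(\<lambda>\<omega>. indicator A \<omega> * V t \<omega>) \<in> borel_measurable M"
    using assms V_measurable by measurable
qed

lemma positive_on_finite_set_adapted: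
  assumes "t \<in> {0..T}" "A \<in> sets (F t)" "u \<in> {t..T}" "finite S" "S \<subseteq> {t..u}"
  shows "{\<omega> \<in> A. \<forall>s\<in>S. 0 < V s \<omega>} \<in> sets (F u)"
proof -
  have "{\<omega> \<in> space (F u). 0 < V s \<omega>} \<in> sets (F u)" if "s \<in> S" for s
  proof -
    have "V s \<in> borel_measurable (F u)"
      using assms that by (intro measurable_F_mono[of s u] V_adapted) auto
    then show ?thesis by measurable
  qed
  then have "{\<omega> \<in> space (F u). \<forall>s\<in>S. 0 < V s \<omega>} \<in> sets (F u)"
    using assms(4) by (rule sets.sets_Collect_finite_All)
  moreover have A: "A \<in> sets (F u)" using assms by (intro sets_F_mono[of t u]) auto
  ultimately have "A \<inter> {\<omega> \<in> space (F u). \<forall>s\<in>S. 0 < V s \<omega>} \<in> sets (F u)" by (intro sets.Int)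
  also have "A \<inter> {\<omega> \<in> space (F u). \<forall>s\<in>S. 0 < V s \<omega>} = {\<omega> \<in> A. \<forall>s\<in>S. 0 < V s \<omega>}"
    using sets.sets_into_space[OF A] by auto
  finally show ?thesis .
qed

text \<open>The process vanishes off the event that it is positive, so that the event may be cut down at
  each of the finitely many times without decreasing the integral.\<close>

lemma expectation_positive_on_finite_set_ge:
  assumes t: "t \<in> {0..T}" and A: "A \<in> sets (F t)" and "finite S" "S \<subseteq> {t..u}" "u \<in> {t..T}"
  shows "expectation (\<lambda>\<omega>. indicator A \<omega> * V t \<omega>)
    \<le> expectation (\<lambda>\<omega>. indicator {\<omega> \<in> A. \<forall>s\<in>S. 0 < V s \<omega>} \<omega> * V u \<omega>)"
  using assms(3-5)
proof (induction S arbitrary: u rule: finite_linorder_max_induct)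
  case empty
  then show ?case using t A by (auto intro!: V_submartingale)
next
  case (insert b S)
  let ?pos = "\<lambda>S. {\<omega> \<in> A. \<forall>s\<in>S. 0 < V s \<omega>}"
  have b: "S \<subseteq> {t..b}" "b \<in> {t..T}" "b \<le> u" using insert.prems insert.hyps(2) by (auto simp: less_imp_le)
  have "expectation (\<lambda>\<omega>. indicator A \<omega> * V t \<omega>) \<le> expectation (\<lambda>\<omega>. indicator (?pos S) \<omega> * V b \<omega>)"
    by (rule insert.IH[OF b(1,2)])
  also have "(\<lambda>\<omega>. indicator (?pos S) \<omega> * V b \<omega>) = (\<lambda>\<omega>. indicator (?pos (insert b S)) \<omega> * V b \<omega>)"
  proof
    fix \<omega> show "indicator (?pos S) \<omega> * V b \<omega> = indicator (?pos (insert b S)) \<omega> * V b \<omega>"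
      using V_nonneg[of b \<omega>] by (cases "V b \<omega> = 0") (auto simp: indicator_def)
  qed
  also have "expectation \<dots> \<le> expectation (\<lambda>\<omega>. indicator (?pos (insert b S)) \<omega> * V u \<omega>)"
    using t b insert by (intro V_submartingale positive_on_finite_set_adapted[OF t A]) auto
  finally show ?case .
qed

lemma expectation_indicator_mult_V_pos:
  assumes t: "t \<in> {0..T}" and A: "A \<in> events" "prob A > 0" and pos: "\<And>\<omega>. \<omega> \<in> A \<Longrightarrow> 0 < V t \<omega>"
  shows "0 < expectation (\<lambda>\<omega>. indicator A \<omega> * V t \<omega>)"
proof -
  have "expectation (\<lambda>\<omega>. indicator A \<omega> * V t \<omega>) \<noteq> 0"
  proof
    assume "expectation (\<lambda>\<omega>. indicator A \<omega> * V t \<omega>) = 0"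
    then have "AE \<omega> in M. indicator A \<omega> * V t \<omega> = 0"
      using integral_nonneg_eq_0_iff_AE[OF integrable_indicator_mult_V[OF A(1) t]] V_nonneg by simp
    then have "AE \<omega> in M. \<omega> \<notin> A" by eventually_elim (use pos in fastforce)
    then have "prob A = 0" using A(1) by (simp add: prob_eq_0)
    then show False using A(2) by simp
  qed
  moreover have "0 \<le> expectation (\<lambda>\<omega>. indicator A \<omega> * V t \<omega>)"
    using V_nonneg by (intro integral_nonneg_AE) auto
  ultimately show ?thesis by simp
qed

lemma prob_stays_positive:
  assumes t: "t \<in> {0..T}" and A: "A \<in> sets (F t)" "prob A > 0" and start: "\<And>\<omega>. \<omega> \<in> A \<Longrightarrow> 0 < V t \<omega>"
    and Q: "countable Q" "Q \<subseteq> {t..T}"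
  shows "0 < prob {\<omega> \<in> A. \<forall>s\<in>Q. 0 < V s \<omega>}"
proof -
  let ?pos = "\<lambda>S. {\<omega> \<in> A. \<forall>s\<in>S. 0 < V s \<omega>}"
  have T: "T \<in> {0..T}" "T \<in> {t..T}" using t by auto
  have AM: "A \<in> events" using sets_F[OF t A(1)] .
  define a where "a = expectation (\<lambda>\<omega>. indicator A \<omega> * V t \<omega>)"
  have a: "0 < a" unfolding a_def by (intro expectation_indicator_mult_V_pos t AM A(2) start)
  have "a \<le> K * prob (?pos S)" if S: "finite S" "S \<subseteq> Q" for S
  proof -
    have pos: "?pos S \<in> events"
      by (rule sets_F[OF T(1) positive_on_finite_set_adapted[OF t A(1) T(2) S(1)]]) (use S Q in auto)
    have "a \<le> expectation (\<lambda>\<omega>. indicator (?pos S) \<omega> * V T \<omega>)"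
      unfolding a_def by (rule expectation_positive_on_finite_set_ge[OF t A(1) S(1) _ T(2)]) (use S Q in auto)
    also have "\<dots> \<le> expectation (\<lambda>\<omega>. indicator (?pos S) \<omega> * K)"
    proof (rule integral_mono[OF integrable_indicator_mult_V[OF pos T(1)]])
      show "integrable M (\<lambda>\<omega>. indicat_real (?pos S) \<omega> * K)"
        using pos by (intro integrable_mult_left integrable_real_indicator) (auto simp: less_top[symmetric])
    qed (intro mult_left_mono V_bounded[OF T(1)], simp)
    also have "\<dots> = K * prob (?pos S)" using pos by (simp add: mult.commute)
    finally show ?thesis .
  qed
  moreover from this[of "{}"] have K: "0 < K" using a zero_less_mult_pos2[of K "prob A"] A(2) by auto
  ultimately have finite: "a / K \<le> prob (?pos S)" if "finite S" "S \<subseteq> Q" for S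
    using that by (simp add: field_simps)
  have "Measurable.pred M (\<lambda>\<omega>. 0 < V s \<omega>)" if "s \<in> Q" for s
  proof -
    have [measurable]: "V s \<in> borel_measurable M" using that Q(2) t by (intro V_measurable) auto
    show ?thesis by measurable
  qed
  from prob_Ball_countable_ge[OF Q(1) AM this finite] have "a / K \<le> prob (?pos Q)" .
  then show ?thesis using a K by (meson divide_pos_pos less_le_trans)
qed

end

subsection \<open>Polynomial paths\<close>

fun poly_path :: "'b::real_vector list \<Rightarrow> real \<Rightarrow> 'b" where
  "poly_path [] s = 0"
| "poly_path (c # cs) s = c + s *\<^sub>R poly_path cs s"

lemma poly_path_eq_sum: "poly_path cs s = (\<Sum>k<length cs. s ^ k *\<^sub>R (cs ! k))"
proof (induction cs)
  case (Cons c cs)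
  then show ?case by (simp add: sum.lessThan_Suc_shift scaleR_sum_right del: sum.lessThan_Suc)
qed simp

lemma poly_path_lipschitz:
  fixes cs :: "'b::real_normed_vector list"
  shows "\<exists>L. L-lipschitz_on {a..b} (poly_path cs)"
proof (induction cs)
  case Nil
  show ?case by (intro exI[of _ 0]) (simp add: lipschitz_on_def)
next
  case (Cons c cs)
  let ?q = "poly_path cs"
  from Cons.IH obtain L where L: "L-lipschitz_on {a..b} ?q" ..
  have "compact (?q ` {a..b})"
    by (intro compact_continuous_image lipschitz_on_continuous_on[OF L]) simp
  then obtain B where B: "\<And>s. s \<in> {a..b} \<Longrightarrow> norm (?q s) \<le> B"
    using compact_imp_bounded bounded_iff by (metis imageI)
  let ?R = "max \<bar>a\<bar> \<bar>b\<bar>"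
  have "(\<bar>B\<bar> + ?R * L)-lipschitz_on {a..b} (poly_path (c # cs))"
  proof (rule lipschitz_onI)
    fix s t assume st: "s \<in> {a..b}" "t \<in> {a..b}"
    have "s *\<^sub>R ?q s - t *\<^sub>R ?q t = (s - t) *\<^sub>R ?q s + t *\<^sub>R (?q s - ?q t)"
      by (simp add: algebra_simps)
    then have "dist (poly_path (c # cs) s) (poly_path (c # cs) t)
        \<le> \<bar>s - t\<bar> * norm (?q s) + \<bar>t\<bar> * norm (?q s - ?q t)"
      using norm_triangle_ineq[of "(s - t) *\<^sub>R ?q s" "t *\<^sub>R (?q s - ?q t)"] by (simp add: dist_norm)
    also have "\<dots> \<le> \<bar>s - t\<bar> * \<bar>B\<bar> + ?R * (L * \<bar>s - t\<bar>)"
      using B[OF st(1)] st lipschitz_on_normD[OF L st] by (intro add_mono mult_mono) auto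
    finally show "dist (poly_path (c # cs) s) (poly_path (c # cs) t) \<le> (\<bar>B\<bar> + ?R * L) * dist s t"
      by (simp add: dist_norm algebra_simps)
  qed (use lipschitz_on_nonneg[OF L] in auto)
  then show ?case by blast
qed

lemma polynomial_function_imp_poly_path:
  fixes p :: "real \<Rightarrow> 'b::euclidean_space"
  assumes "polynomial_function p"
  shows "\<exists>cs. p = poly_path cs"
proof -
  have "\<exists>a n. \<forall>s. p s \<bullet> b = (\<Sum>k\<le>n. a k * s ^ k)" if "b \<in> Basis" for b
    using assms that
    by (simp add: polynomial_function_iff_Basis_inner real_polynomial_function_iff_sum fun_eq_iff)
  then obtain a n where a: "\<And>b s. b \<in> Basis \<Longrightarrow> p s \<bullet> b = (\<Sum>k\<le>n b. a b k * s ^ k)"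
    by metis
  define m where "m = Suc (Max (n ` Basis))"
  define coeff where "coeff b k = (if k \<le> n b then a b k else 0)" for b k
  have "p s = poly_path (map (\<lambda>k. \<Sum>b\<in>Basis. coeff b k *\<^sub>R b) [0..<m]) s" for s
  proof -
    have "p s \<bullet> b = (\<Sum>k<m. s ^ k * coeff b k)" if b: "b \<in> Basis" for b
    proof -
      have "n b < m" using b by (simp add: m_def less_Suc_eq_le)
      then have "(\<Sum>k<m. s ^ k * coeff b k) = (\<Sum>k\<le>n b. a b k * s ^ k)"
        by (intro sum.mono_neutral_cong_right) (auto simp: coeff_def)
      then show ?thesis using a[OF b] by simp
    qed
    then have "p s = (\<Sum>b\<in>Basis. (\<Sum>k<m. s ^ k * coeff b k) *\<^sub>R b)"
      using euclidean_representation[of "p s"] by simp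
    also have "\<dots> = (\<Sum>k<m. s ^ k *\<^sub>R (\<Sum>b\<in>Basis. coeff b k *\<^sub>R b))"
      unfolding scaleR_sum_left scaleR_sum_right by (subst sum.swap) simp
    finally show ?thesis by (simp add: poly_path_eq_sum)
  qed
  then show ?thesis by blast
qed

lemma poly_path_approx_coeffs:
  fixes D :: "'b::real_normed_vector set"
  assumes D: "closure D = UNIV" and "e > 0"
  shows "\<exists>ds\<in>lists D. \<forall>s\<in>{a..b}. norm (poly_path cs s - poly_path ds s) < e"
  using \<open>e > 0\<close>
proof (induction cs arbitrary: e)
  case Nil
  then show ?case by (intro bexI[of _ "[]"]) auto
next
  case (Cons c cs)
  define R where "R = max \<bar>a\<bar> \<bar>b\<bar> + 1"
  have R: "R > 0" by (simp add: R_def)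
  have "c \<in> closure D" "0 < e / 2" using D Cons.prems by auto
  then obtain d where d: "d \<in> D" "norm (c - d) < e / 2"
    unfolding closure_approachable dist_norm by (metis norm_minus_commute)
  have "0 < e / (2 * R)" using Cons.prems R by simp
  from Cons.IH[OF this] obtain ds
    where ds: "ds \<in> lists D" "\<And>s. s \<in> {a..b} \<Longrightarrow> norm (poly_path cs s - poly_path ds s) < e / (2 * R)"
    by blast
  have "norm (poly_path (c # cs) s - poly_path (d # ds) s) < e" if s: "s \<in> {a..b}" for s
  proof -
    have "poly_path (c # cs) s - poly_path (d # ds) s = (c - d) + s *\<^sub>R (poly_path cs s - poly_path ds s)"
      by (simp add: algebra_simps)
    also have "norm \<dots> \<le> norm (c - d) + \<bar>s\<bar> * norm (poly_path cs s - poly_path ds s)"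
      using norm_triangle_ineq[of "c - d" "s *\<^sub>R (poly_path cs s - poly_path ds s)"] by simp
    also have "\<bar>s\<bar> * norm (poly_path cs s - poly_path ds s) \<le> R * (e / (2 * R))"
    proof (rule mult_mono)
      have "\<bar>s\<bar> \<le> max \<bar>a\<bar> \<bar>b\<bar>" using s by auto
      then show "\<bar>s\<bar> \<le> R" by (simp add: R_def)
    qed (use ds(2)[OF s] R in auto)
    also have "norm (c - d) + R * (e / (2 * R)) < e" using d(2) R by simp
    finally show ?thesis by simp
  qed
  moreover have "d # ds \<in> lists D" using d(1) ds(1) by simp
  ultimately show ?case by blast
qed

lemma poly_path_dense:
  fixes g :: "real \<Rightarrow> 'b::euclidean_space"
  assumes g: "continuous_on {a..b} g" and D: "closure D = UNIV" and e: "e > 0"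
  shows "\<exists>cs\<in>lists D. \<forall>s\<in>{a..b}. norm (g s - poly_path cs s) < e"
proof -
  have "0 < e / 2" using e by simp
  from Stone_Weierstrass_polynomial_function[OF compact_Icc g this] obtain p
    where "polynomial_function p" and p: "\<And>s. s \<in> {a..b} \<Longrightarrow> norm (g s - p s) < e / 2" by blast
  then obtain bs where bs: "p = poly_path bs" using polynomial_function_imp_poly_path by blast
  from poly_path_approx_coeffs[OF D \<open>0 < e / 2\<close>, of a b bs] obtain cs
    where cs: "cs \<in> lists D" "\<And>s. s \<in> {a..b} \<Longrightarrow> norm (p s - poly_path cs s) < e / 2"
    unfolding bs by blast
  have "norm (g s - poly_path cs s) < e" if "s \<in> {a..b}" for s
    using norm_triangle_ineq[of "g s - p s" "p s - poly_path cs s"] p[OF that] cs(2)[OF that] by simp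
  then show ?thesis using cs(1) by blast
qed

subsection \<open>Conditional full support from tubes\<close>

definition tube_in :: "real \<Rightarrow> (real \<Rightarrow> 'b::real_normed_vector) set \<Rightarrow> (real \<Rightarrow> 'b) \<Rightarrow> real \<Rightarrow> bool" where
  "tube_in T G p r \<longleftrightarrow> r > 0 \<and> (\<forall>g. continuous_on {0..T} g \<longrightarrow> (\<forall>s\<in>{0..T}. norm (g s - p s) \<le> r) \<longrightarrow> g \<in> G)"

lemma uniform_open_tube:
  fixes G :: "(real \<Rightarrow> 'b::euclidean_space) set"
  assumes G: "uniform_open T G" "g \<in> G" and D: "closure D = UNIV"
  shows "\<exists>cs\<in>lists D. \<exists>r\<in>\<rat>. tube_in T G (poly_path cs) r \<and> (\<forall>s\<in>{0..T}. norm (g s - poly_path cs s) < r)"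
proof -
  obtain e where e: "e > 0" and cont: "continuous_on {0..T} g"
    and sub: "\<And>f. continuous_on {0..T} f \<Longrightarrow> (\<And>s. s \<in> {0..T} \<Longrightarrow> dist (f s) (g s) < e) \<Longrightarrow> f \<in> G"
    using G unfolding uniform_open_def by metis
  obtain r where r: "r \<in> \<rat>" "0 < r" "r < e / 2" using Rats_dense_in_real[of 0 "e / 2"] e by auto
  obtain cs where cs: "cs \<in> lists D" "\<And>s. s \<in> {0..T} \<Longrightarrow> norm (g s - poly_path cs s) < r"
    using poly_path_dense[OF cont D r(2)] by blast
  have "tube_in T G (poly_path cs) r"
    unfolding tube_in_def
  proof (intro conjI allI impI sub)
    fix f s assume f: "\<forall>s\<in>{0..T}. norm (f s - poly_path cs s) \<le> r" and s: "s \<in> {0..T}"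
    have "dist (f s) (g s) \<le> norm (f s - poly_path cs s) + norm (g s - poly_path cs s)"
      by (metis dist_norm dist_triangle2)
    then show "dist (f s) (g s) < e" using f s cs(2)[OF s] r(3) by fastforce
  qed (use r in auto)
  then show ?thesis using cs r by blast
qed

lemma uniform_open_countable_tubes:
  fixes G :: "(real \<Rightarrow> 'b::euclidean_space) set"
  assumes G: "uniform_open T G"
  shows "\<exists>P. countable P \<and> (\<forall>(p, r)\<in>P. tube_in T G p r \<and> (\<exists>L. L-lipschitz_on {0..T} p))
    \<and> (\<forall>g\<in>G. \<exists>(p, r)\<in>P. \<forall>s\<in>{0..T}. norm (g s - p s) < r)"
proof -
  obtain D :: "'b set" where "countable D" "UNIV \<subseteq> closure D"
    by (rule separable[of UNIV]) blast
  then have D: "countable D" "closure D = UNIV" by blast+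
  define P where "P = (poly_path ` lists D \<times> \<rat>) \<inter> {(p, r). tube_in T G p r}"
  have "countable (poly_path ` lists D \<times> (\<rat> :: real set))"
    using D(1) countable_rat by (intro countable_SIGMA countable_image) auto
  then have "countable P" unfolding P_def by (rule countable_Int1)
  moreover have "\<forall>(p, r)\<in>P. tube_in T G p r \<and> (\<exists>L. L-lipschitz_on {0..T} p)"
    using poly_path_lipschitz by (auto simp: P_def)
  moreover have "\<forall>g\<in>G. \<exists>(p, r)\<in>P. \<forall>s\<in>{0..T}. norm (g s - p s) < r"
    using uniform_open_tube[OF G _ D(2)] unfolding P_def by blast
  ultimately show ?thesis by blast
qed

lemma (in finite_measure_subalgebra) AE_real_cond_exp_indicator_pos:
  assumes B: "B \<in> sets F" and E: "E \<in> sets M"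
    and pos: "\<And>A. A \<in> sets F \<Longrightarrow> A \<subseteq> B \<Longrightarrow> 0 < measure M A \<Longrightarrow> 0 < measure M (A \<inter> E)"
  shows "AE \<omega> in M. \<omega> \<in> B \<longrightarrow> 0 < real_cond_exp M F (indicator E) \<omega>"
proof -
  define Z where "Z = real_cond_exp M F (indicator E)"
  define A where "A = {\<omega> \<in> space F. \<omega> \<in> B \<and> Z \<omega> \<le> 0}"
  have A: "A \<in> sets F"
    unfolding A_def Z_def using B by measurable
  then have AM: "A \<in> sets M" using subalg by (auto simp: subalgebra_def)
  have "measure M A = 0"
  proof (rule ccontr)
    assume "measure M A \<noteq> 0"
    then have "0 < measure M (A \<inter> E)"
      using A by (intro pos) (auto simp: A_def zero_less_measure_iff)
    also have "measure M (A \<inter> E) = (\<integral>\<omega>\<in>A. indicator E \<omega> \<partial>M)"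
      using AM E by (simp add: set_lebesgue_integral_def flip: indicator_inter_arith)
    also have "\<dots> = (\<integral>\<omega>\<in>A. Z \<omega> \<partial>M)"
      unfolding Z_def
      using E by (intro real_cond_exp_intA A integrable_real_indicator) (auto simp: less_top[symmetric])
    also have "\<dots> \<le> 0"
    proof -
      have "0 \<le> (\<integral>\<omega>. - (indicat_real A \<omega> *\<^sub>R Z \<omega>) \<partial>M)"
        by (intro integral_nonneg_AE AE_I2) (auto simp: A_def indicator_def)
      then show ?thesis unfolding set_lebesgue_integral_def by simp
    qed
    finally show False by simp
  qed
  then have "AE \<omega> in M. \<omega> \<notin> A"
    using AM by (intro AE_not_in) (simp add: null_sets_def emeasure_eq_measure)
  then show ?thesis
  proof (rule AE_mp, intro AE_I2 impI)
    fix \<omega> assume "\<omega> \<in> space M" "\<omega> \<notin> A" "\<omega> \<in> B"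
    then show "0 < real_cond_exp M F (indicator E) \<omega>"
      using subalg by (auto simp: A_def Z_def subalgebra_def not_le)
  qed
qed

lemma countable_dense_Icc:
  fixes a b :: real
  obtains Q where "countable Q" "Q \<subseteq> {a..b}" "closure Q = {a..b}"
proof -
  obtain Q where "countable Q" "Q \<subseteq> {a..b}" "{a..b} \<subseteq> closure Q"
    by (rule separable[of "{a..b}"]) blast
  then show thesis using that closure_minimal[of Q "{a..b}"] by auto
qed

context filtered_prob_space
begin

lemma sets_of_AE_eq:
  assumes B: "B \<in> events" and eq: "AE \<omega> in M. \<omega> \<in> A \<longleftrightarrow> \<omega> \<in> B" and A: "A \<subseteq> space M"
  shows "A \<in> events"
proof -
  obtain N where N: "N \<in> null_sets M" "\<And>\<omega>. \<omega> \<in> space M \<Longrightarrow> \<omega> \<notin> N \<Longrightarrow> \<omega> \<in> A \<longleftrightarrow> \<omega> \<in> B"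
    using eq by (rule AE_E3) blast
  have "A = (B - N) \<union> (A \<inter> N)" using N(2) A sets.sets_into_space[OF B] by blast
  moreover have "A \<inter> N \<in> events"
    using filtration N(1) unfolding filtration_usual_def by blast
  ultimately show ?thesis using B N(1) by (metis null_setsD2 sets.Diff sets.Un)
qed

definition stays_in_tubes :: "(real \<Rightarrow> 'a \<Rightarrow> 'b::real_normed_vector) \<Rightarrow> bool" where
  "stays_in_tubes X \<longleftrightarrow> (\<forall>p L r t A Q. L-lipschitz_on {0..T} p \<longrightarrow> r > 0 \<longrightarrow> t \<in> {0..T} \<longrightarrow>
     A \<in> sets (F t) \<longrightarrow> prob A > 0 \<longrightarrow> (\<forall>\<omega>\<in>A. norm (X t \<omega> - p t) < r) \<longrightarrow> countable Q \<longrightarrow> Q \<subseteq> {t..T} \<longrightarrow>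
     prob {\<omega> \<in> A. \<forall>s\<in>Q. norm (X s \<omega> - p s) < r} > 0)"

end

locale continuous_adapted_process = filtered_prob_space M F T
  for M :: "'a measure" and F :: "real \<Rightarrow> 'a measure" and T :: real +
  fixes X :: "real \<Rightarrow> 'a \<Rightarrow> 'b::euclidean_space"
  assumes adapted: "t \<in> {0..T} \<Longrightarrow> X t \<in> borel_measurable (F t)"
    and continuous: "AE \<omega> in M. continuous_on {0..T} (\<lambda>t. X t \<omega>)"
begin

lemma tube_event_adapted:
  assumes "countable Q" "Q \<subseteq> {0..t}" "t \<in> {0..T}"
  shows "{\<omega> \<in> space (F t). \<forall>s\<in>Q. norm (X s \<omega> - p s) \<le> r} \<in> sets (F t)"
proof (intro sets.sets_Collect_countable_All' assms(1))
  fix s assume "s \<in> Q"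
  then have "X s \<in> borel_measurable (F t)"
    using assms by (intro measurable_F_mono[of s t] adapted) auto
  then show "{\<omega> \<in> space (F t). norm (X s \<omega> - p s) \<le> r} \<in> sets (F t)" by measurable
qed

lemma AE_path_in_if_dense:
  assumes tube: "tube_in T G p r" and p: "L-lipschitz_on {0..T} p" and Q: "closure Q = {0..T}"
  shows "AE \<omega> in M. (\<forall>s\<in>Q. norm (X s \<omega> - p s) \<le> r) \<longrightarrow> (\<lambda>s. X s \<omega>) \<in> G"
  using continuous
proof (rule AE_mp, intro AE_I2 impI)
  fix \<omega> assume cont: "continuous_on {0..T} (\<lambda>t. X t \<omega>)" and le: "\<forall>s\<in>Q. norm (X s \<omega> - p s) \<le> r"
  have "continuous_on {0..T} (\<lambda>s. norm (X s \<omega> - p s))"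
    by (intro continuous_intros cont lipschitz_on_continuous_on[OF p])
  then have "norm (X s \<omega> - p s) \<le> r" if "s \<in> {0..T}" for s
    using continuous_le_on_closure[of Q "\<lambda>s. norm (X s \<omega> - p s)" s r] Q le that by auto
  then show "(\<lambda>s. X s \<omega>) \<in> G" using tube cont by (simp add: tube_in_def)
qed

lemma path_event_measurable:
  assumes G: "uniform_open T G"
  shows "{\<omega> \<in> space M. (\<lambda>s. X s \<omega>) \<in> G} \<in> events"
proof -
  from uniform_open_countable_tubes[OF G] obtain P where P: "countable P"
    and tube: "\<forall>(p, r)\<in>P. tube_in T G p r \<and> (\<exists>L. L-lipschitz_on {0..T} p)"
    and cover: "\<forall>g\<in>G. \<exists>(p, r)\<in>P. \<forall>s\<in>{0..T}. norm (g s - p s) < r"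
    by blast
  obtain Q where Q: "countable Q" "Q \<subseteq> {0..T}" "closure Q = {0..T}" by (rule countable_dense_Icc)
  have T: "T \<in> {0..T}" using T_pos by simp
  define U where "U = (\<Union>(p, r)\<in>P. {\<omega> \<in> space M. \<forall>s\<in>Q. norm (X s \<omega> - p s) \<le> r})"
  have "U \<in> events"
    unfolding U_def
    using sets_F[OF T tube_event_adapted[OF Q(1,2) T]] space_F[OF T]
    by (intro sets.countable_UN'[OF P]) auto
  moreover have "AE \<omega> in M. \<forall>(p, r)\<in>P. (\<forall>s\<in>Q. norm (X s \<omega> - p s) \<le> r) \<longrightarrow> (\<lambda>s. X s \<omega>) \<in> G"
  proof (subst AE_ball_countable[OF P], clarify)
    fix p r assume "(p, r) \<in> P"
    then obtain L where "tube_in T G p r" "L-lipschitz_on {0..T} p" using tube by blast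
    from AE_path_in_if_dense[OF this Q(3)]
    show "AE \<omega> in M. (\<forall>s\<in>Q. norm (X s \<omega> - p s) \<le> r) \<longrightarrow> (\<lambda>s. X s \<omega>) \<in> G" .
  qed
  then have "AE \<omega> in M. \<omega> \<in> {\<omega> \<in> space M. (\<lambda>s. X s \<omega>) \<in> G} \<longleftrightarrow> \<omega> \<in> U"
  proof (rule AE_mp, intro AE_I2 impI)
    fix \<omega> assume \<omega>: "\<omega> \<in> space M"
      and in_G: "\<forall>(p, r)\<in>P. (\<forall>s\<in>Q. norm (X s \<omega> - p s) \<le> r) \<longrightarrow> (\<lambda>s. X s \<omega>) \<in> G"
    have "\<omega> \<in> U" if "(\<lambda>s. X s \<omega>) \<in> G"
    proof -
      from bspec[OF cover that] obtain p r where pr: "(p, r) \<in> P" "\<forall>s\<in>{0..T}. norm (X s \<omega> - p s) < r" by blast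
      then have "\<forall>s\<in>Q. norm (X s \<omega> - p s) \<le> r" using Q(2) by (auto intro: less_imp_le)
      then show ?thesis using pr(1) \<omega> unfolding U_def by blast
    qed
    then show "\<omega> \<in> {\<omega> \<in> space M. (\<lambda>s. X s \<omega>) \<in> G} \<longleftrightarrow> \<omega> \<in> U"
      using \<omega> in_G unfolding U_def by blast
  qed
  ultimately show ?thesis by (rule sets_of_AE_eq) auto
qed

lemma cond_exp_pos_in_tube:
  assumes tubes: "stays_in_tubes X" and t: "t \<in> {0..T}" and G: "uniform_open T G"
    and tube: "tube_in T G p r" and p: "L-lipschitz_on {0..T} p"
  shows "AE \<omega> in M. (\<forall>s\<in>{0..t}. norm (X s \<omega> - p s) < r) \<longrightarrow>
    0 < real_cond_exp M (F t) (indicator {\<omega>' \<in> space M. (\<lambda>s. X s \<omega>') \<in> G}) \<omega>"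
proof -
  interpret Ft: finite_measure_subalgebra M "F t"
    using subalgebra_F[OF t] by unfold_locales
  let ?E = "{\<omega> \<in> space M. (\<lambda>s. X s \<omega>) \<in> G}"
  have E: "?E \<in> events" by (rule path_event_measurable[OF G])
  obtain Q\<^sub>0 where Q\<^sub>0: "countable Q\<^sub>0" "Q\<^sub>0 \<subseteq> {0..t}" "closure Q\<^sub>0 = {0..t}" by (rule countable_dense_Icc)
  obtain Q\<^sub>1 where Q\<^sub>1: "countable Q\<^sub>1" "Q\<^sub>1 \<subseteq> {t..T}" "closure Q\<^sub>1 = {t..T}" by (rule countable_dense_Icc)
  have dense: "closure (Q\<^sub>0 \<union> Q\<^sub>1) = {0..T}" using Q\<^sub>0(3) Q\<^sub>1(3) t by (auto simp: closure_Un)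
  define B where "B = {\<omega> \<in> space (F t). (\<forall>s\<in>Q\<^sub>0. norm (X s \<omega> - p s) \<le> r) \<and> norm (X t \<omega> - p t) < r}"
  have "{\<omega> \<in> space (F t). norm (X t \<omega> - p t) < r} \<in> sets (F t)"
    using adapted[OF t] by measurable
  then have B: "B \<in> sets (F t)"
    unfolding B_def by (intro sets.sets_Collect_conj tube_event_adapted Q\<^sub>0 t)
  have pos: "0 < prob (A \<inter> ?E)" if A: "A \<in> sets (F t)" "A \<subseteq> B" "0 < prob A" for A
  proof -
    let ?A' = "{\<omega> \<in> A. \<forall>s\<in>Q\<^sub>1. norm (X s \<omega> - p s) < r}"
    have "0 < prob ?A'"
      using tubes p tube t A Q\<^sub>1 unfolding stays_in_tubes_def tube_in_def B_def by blast
    also have "prob ?A' \<le> prob (A \<inter> ?E)"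
    proof (rule finite_measure_mono_AE)
      show "AE \<omega> in M. \<omega> \<in> ?A' \<longrightarrow> \<omega> \<in> A \<inter> ?E"
        using AE_path_in_if_dense[OF tube p dense]
      proof (rule AE_mp, intro AE_I2 impI)
        fix \<omega> assume "\<omega> \<in> space M" "\<omega> \<in> ?A'"
          and in_G: "(\<forall>s\<in>Q\<^sub>0 \<union> Q\<^sub>1. norm (X s \<omega> - p s) \<le> r) \<longrightarrow> (\<lambda>s. X s \<omega>) \<in> G"
        moreover from this A(2) have "\<forall>s\<in>Q\<^sub>0 \<union> Q\<^sub>1. norm (X s \<omega> - p s) \<le> r"
          by (auto simp: B_def intro: less_imp_le)
        ultimately show "\<omega> \<in> A \<inter> ?E" by simp
      qed
    qed (use sets_F[OF t A(1)] E in auto)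
    finally show ?thesis .
  qed
  have "AE \<omega> in M. \<omega> \<in> B \<longrightarrow> 0 < real_cond_exp M (F t) (indicator ?E) \<omega>"
    by (rule Ft.AE_real_cond_exp_indicator_pos[OF B E pos])
  then show ?thesis
    using Q\<^sub>0(2) t space_F[OF t] by (elim AE_mp, intro AE_I2) (auto simp: B_def intro: less_imp_le)
qed

theorem cond_full_support_if_stays_in_tubes:
  assumes tubes: "stays_in_tubes X"
  shows "cond_full_support M F T X"
  unfolding cond_full_support_def
proof (intro ballI allI impI)
  fix t and G :: "(real \<Rightarrow> 'b) set"
  assume t: "t \<in> {0..T}" and G: "uniform_open T G"
  from uniform_open_countable_tubes[OF G] obtain P where "countable P"
    and tube: "\<forall>(p, r)\<in>P. tube_in T G p r \<and> (\<exists>L. L-lipschitz_on {0..T} p)"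
    and cover: "\<forall>g\<in>G. \<exists>(p, r)\<in>P. \<forall>s\<in>{0..T}. norm (g s - p s) < r"
    by blast
  let ?Z = "real_cond_exp M (F t) (indicator {\<omega>' \<in> space M. (\<lambda>s. X s \<omega>') \<in> G})"
  have "AE \<omega> in M. \<forall>(p, r)\<in>P. (\<forall>s\<in>{0..t}. norm (X s \<omega> - p s) < r) \<longrightarrow> 0 < ?Z \<omega>"
  proof (subst AE_ball_countable[OF \<open>countable P\<close>], clarify)
    fix p r assume pr: "(p, r) \<in> P"
    then obtain L where "tube_in T G p r" "L-lipschitz_on {0..T} p" using tube by blast
    from cond_exp_pos_in_tube[OF tubes t G this]
    show "AE \<omega> in M. (\<forall>s\<in>{0..t}. norm (X s \<omega> - p s) < r) \<longrightarrow> 0 < ?Z \<omega>" .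
  qed
  then show "AE \<omega> in M. (\<exists>g\<in>G. \<forall>s\<in>{0..t}. X s \<omega> = g s) \<longrightarrow> 0 < ?Z \<omega>"
  proof (rule AE_mp, intro AE_I2 impI)
    fix \<omega> assume pos: "\<forall>(p, r)\<in>P. (\<forall>s\<in>{0..t}. norm (X s \<omega> - p s) < r) \<longrightarrow> 0 < ?Z \<omega>"
      and "\<exists>g\<in>G. \<forall>s\<in>{0..t}. X s \<omega> = g s"
    then obtain g where g: "g \<in> G" "\<And>s. s \<in> {0..t} \<Longrightarrow> X s \<omega> = g s" by auto
    from cover g(1) obtain p r where pr: "(p, r) \<in> P" and less: "\<forall>s\<in>{0..T}. norm (g s - p s) < r" by blast
    from less g(2) t have "\<forall>s\<in>{0..t}. norm (X s \<omega> - p s) < r" by simp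
    with pos pr show "0 < ?Z \<omega>" by blast
  qed
qed

end

lemma (in elliptic_ito_process) X_stays_in_tubes: "stays_in_tubes X"
  unfolding stays_in_tubes_def
proof (intro allI impI)
  fix p L r t A Q
  assume p: "L-lipschitz_on {0..T} p" and r: "(r :: real) > 0" and t: "t \<in> {0..T}"
    and A: "A \<in> sets (F t)" "0 < prob A" and start: "\<forall>\<omega>\<in>A. norm (X t \<omega> - p t) < r"
    and Q: "countable Q" "Q \<subseteq> {t..T}"
  define rate where "rate = bump_rate \<epsilon> N r (real CARD('m) * C + L)"
  define V where "V s \<omega> = exp (rate * s) * bump r (X s \<omega> - p s)" for s \<omega>
  interpret bounded_submartingale M F T V "exp (rate * T) * r ^ 6"
  proof
    show "V s \<in> borel_measurable (F s)" if "s \<in> {0..T}" for s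
      unfolding V_def using X_adapted[OF that] by measurable
    show "0 \<le> V s \<omega>" for s \<omega> by (simp add: V_def)
    show "V s \<omega> \<le> exp (rate * T) * r ^ 6" if "s \<in> {0..T}" for s \<omega>
      unfolding V_def using that bump_rate_nonneg[OF \<epsilon>_pos]
      by (intro mult_mono bump_le) (auto simp: rate_def intro!: mult_left_mono)
    show "expectation (\<lambda>\<omega>. indicator B \<omega> * V s \<omega>) \<le> expectation (\<lambda>\<omega>. indicator B \<omega> * V u \<omega>)"
      if "0 \<le> s" "s \<le> u" "u \<le> T" "B \<in> sets (F s)" for s u B
    proof -
      have "expectation (\<lambda>\<omega>. indicator B \<omega> * V t \<omega>)
          = exp (rate * t) * expectation (\<lambda>\<omega>. indicator B \<omega> * bump r (X t \<omega> - p t))" for t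
        by (simp add: V_def mult.left_commute[of "indicator B _"])
      then show ?thesis using exp_bump_submartingale[OF that r p] by (simp only: rate_def)
    qed
  qed
  have V_pos_iff: "0 < V s \<omega> \<longleftrightarrow> norm (X s \<omega> - p s) < r" for s \<omega>
    by (simp add: V_def zero_less_mult_iff bump_pos_iff[OF r])
  show "0 < prob {\<omega> \<in> A. \<forall>s\<in>Q. norm (X s \<omega> - p s) < r}"
    using prob_stays_positive[OF t A _ Q] start unfolding V_pos_iff by blast
qed

theorem theorem2:
  fixes M :: "'a measure" and F :: "real \<Rightarrow> 'a measure" and T :: real
    and W :: "real \<Rightarrow> 'a \<Rightarrow> real ^ 'n::finite"
    and \<mu> :: "real \<Rightarrow> 'a \<Rightarrow> real ^ 'n"
    and \<sigma> :: "real \<Rightarrow> 'a \<Rightarrow> real ^ 'n ^ 'n"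
    and X :: "real \<Rightarrow> 'a \<Rightarrow> real ^ 'n"
  assumes "T > 0"
    and "prob_space M"
    and "filtration_usual M F T"
    and "trivial_sigma M (F 0)"
    and "brownian_motion M F T W"
    and "progressive M F T \<mu>"
    and "progressive M F T \<sigma>"
    and "ito_process M F T W \<mu> \<sigma> X"
    and "\<exists>C. \<forall>t\<in>{0..T}. AE \<omega> in M. norm (\<mu> t \<omega>) \<le> C"
    and "\<epsilon> > 0" and "K > 0"
    and "\<forall>t\<in>{0..T}. AE \<omega> in M. \<forall>\<xi> :: real ^ 'n.
           \<epsilon> * (norm \<xi>)\<^sup>2 \<le> (norm (transpose (\<sigma> t \<omega>) *v \<xi>))\<^sup>2 \<and>
           (norm (transpose (\<sigma> t \<omega>) *v \<xi>))\<^sup>2 \<le> K * (norm \<xi>)\<^sup>2"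
  shows "cond_full_support M F T X"
proof -
  obtain C where C: "\<And>t. t \<in> {0..T} \<Longrightarrow> AE \<omega> in M. norm (\<mu> t \<omega>) \<le> C"
    using assms(9) by blast
  obtain I where I: "\<And>i \<nu>. is_ito_integral M F T (\<lambda>t \<omega>. W t \<omega> $ \<nu>) (\<lambda>t \<omega>. \<sigma> t \<omega> $ i $ \<nu>) (I i \<nu>)"
    and X: "\<And>t. t \<in> {0..T} \<Longrightarrow> X t \<in> borel_measurable (F t)"
      "AE \<omega> in M. continuous_on {0..T} (\<lambda>t. X t \<omega>)"
      "\<And>t. t \<in> {0..T} \<Longrightarrow> AE \<omega> in M. \<forall>i.
         X t \<omega> $ i = X 0 \<omega> $ i + (LINT s:{0..t}|lborel. \<mu> s \<omega> $ i) + (\<Sum>\<nu>\<in>UNIV. I i \<nu> t \<omega>)"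
    using assms(8) unfolding ito_process_def by blast
  obtain m \<tau> h where approximation: "\<And>i \<nu>. ito_approximation M F T (\<lambda>t \<omega>. W t \<omega> $ \<nu>)
      (\<lambda>t \<omega>. \<sigma> t \<omega> $ i $ \<nu>) (I i \<nu>) (m i \<nu>) (\<tau> i \<nu>) (h i \<nu>)"
    using I unfolding is_ito_integral_iff by metis
  have elliptic: "AE \<omega> in M. elliptic \<epsilon> (real CARD('n) * K) (\<sigma> t \<omega>)" if "t \<in> {0..T}" for t
    using bspec[OF assms(12) that] by eventually_elim (blast intro: ellipticI)
  interpret prob_space M by fact
  interpret filtered_brownian M F T W
    using assms by unfold_locales
  interpret elliptic_ito_process M F T W \<mu> \<sigma> X I m \<tau> h C \<epsilon> "real CARD('n) * K"
    using assms(6,7,10) C X approximation elliptic I[unfolded is_ito_integral_iff]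
    by unfold_locales (auto intro: progressive_measurable)
  interpret continuous_adapted_process M F T X
    using X by unfold_locales
  show ?thesis by (rule cond_full_support_if_stays_in_tubes[OF X_stays_in_tubes])
qed

end
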